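(* Let $N\ge2$, let $\Omega\subset\mathbb{R}^N$ be a bounded domain with $C^2$ boundary, and let $g\in L^\infty_{loc}(\mathbb{R}^N\setminus\Omega)\cap\bigcap_{s\in(0,1)}L^1_s(\mathbb{R}^N)$ (i.e. $g$ is defined on $\mathbb{R}^N\setminus\Omega$, bounded on bounded subsets of $\mathbb{R}^N\setminus\Omega$, and its extension by $0$ lies in every $L^1_s$). Let $\tilde g(r)=\frac{1}{r^{N-1}\omega_{N-1}}\int_{S_r}g\,d\sigma$ and for $\delta>0$, $R>0$ let $M^\delta_R:=\{r\in[R,2R]:|\tilde g(r)|\ge\delta\}$. Assume $$\int_{M_R^\delta}|\tilde g(r)|\,dr=o(R)\quad\text{as }R\to\infty,\ \text{for every }\delta>0.$$ For $s\in(0,1)$ let $u_s$ be the unique function which is $s$-harmonic in $\Omega$, bounded in a neighborhood of $\partial\Omega$, and equals $g$ in $\mathbb{R}^N\setminus\Omega$. Then $u_s\to0$ almost uniformly in $\Omega$ as $s\to0^+$.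
   Context: $S_r$ is the sphere of radius $r$ centered at $0$, $\omega_{N-1}$ the area of the unit sphere. $L^1_s(\mathbb{R}^N)=\{u\in L^1_{loc}:\int|u|(1+|x|)^{-N-2s}dx<\infty\}$. $(-\Delta)^su(x)=c_{N,s}\lim_{\epsilon\to0}\int_{|x-y|>\epsilon}\frac{u(x)-u(y)}{|x-y|^{N+2s}}dy$ with $c_{N,s}=\frac{4^s\Gamma(\frac N2+s)}{\Gamma(2-s)\pi^{N/2}}s(1-s)$; $u\in L^1_s$ is $s$-harmonic in $\Omega$ if $\int u(-\Delta)^s\phi=0$ for all $\phi\in C_c^\infty(\Omega)$. $\delta_\Omega(x)=\operatorname{dist}(x,\partial\Omega)$; $v_s\to v$ almost uniformly in $\Omega$ means $\|\delta_\Omega^\varepsilon(v_s-v)\|_{L^\infty(\Omega)}\to0$ for every $\varepsilon>0$. *)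

theory Defs
  imports "HOL-Analysis.Analysis" "HOL-Library.Landau_Symbols"
begin

fun Ck :: "nat \<Rightarrow> ('a::euclidean_space \<Rightarrow> real) \<Rightarrow> bool" where
  "Ck 0 f = continuous_on UNIV f"
| "Ck (Suc k) f = ((\<forall>x. f differentiable (at x)) \<and>
                   (\<forall>v. Ck k (\<lambda>x. frechet_derivative f (at x) v)))"

definition smooth :: "('a::euclidean_space \<Rightarrow> real) \<Rightarrow> bool" where
  "smooth f \<longleftrightarrow> (\<forall>k. Ck k f)"

definition test_fun :: "'a::euclidean_space set \<Rightarrow> ('a \<Rightarrow> real) \<Rightarrow> bool" where
  "test_fun \<Omega> \<phi> \<longleftrightarrow> smooth \<phi> \<and>
     (\<exists>K. compact K \<and> K \<subseteq> \<Omega> \<and> (\<forall>x. x \<notin> K \<longrightarrow> \<phi> x = 0))"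

text \<open>Omega has C^2 boundary: near every boundary point, after choosing a unit direction nu,
  Omega is the region above the graph of a C^2 function over the hyperplane orthogonal to nu.\<close>
definition C2_boundary :: "'a::euclidean_space set \<Rightarrow> bool" where
  "C2_boundary \<Omega> \<longleftrightarrow> (\<forall>x\<in>frontier \<Omega>. \<exists>r>0. \<exists>\<nu> \<gamma>. norm \<nu> = 1 \<and> Ck 2 \<gamma> \<and>
      \<Omega> \<inter> ball x r = {y \<in> ball x r. \<gamma> (y - (y \<bullet> \<nu>) *\<^sub>R \<nu>) < y \<bullet> \<nu>})"

definition L1s :: "real \<Rightarrow> ('a::euclidean_space \<Rightarrow> real) \<Rightarrow> bool" where
  "L1s s u \<longleftrightarrow> u \<in> borel_measurable lebesgue \<and>
     integrable lebesgue (\<lambda>x. \<bar>u x\<bar> * (1 + norm x) powr (- (real DIM('a) + 2 * s)))"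

definition cNs :: "nat \<Rightarrow> real \<Rightarrow> real" where
  "cNs N s = 4 powr s * Gamma (real N / 2 + s) / (Gamma (2 - s) * pi powr (real N / 2)) * s * (1 - s)"

definition fraclap :: "real \<Rightarrow> ('a::euclidean_space \<Rightarrow> real) \<Rightarrow> 'a \<Rightarrow> real" where
  "fraclap s u x = cNs DIM('a) s *
     Lim (at_right 0) (\<lambda>\<epsilon>::real. LINT y:{y. \<epsilon> < dist x y}|lebesgue.
              (u x - u y) / dist x y powr (real DIM('a) + 2 * s))"

definition s_harmonic :: "real \<Rightarrow> 'a::euclidean_space set \<Rightarrow> ('a \<Rightarrow> real) \<Rightarrow> bool" where
  "s_harmonic s \<Omega> u \<longleftrightarrow> L1s s u \<and>
     (\<forall>\<phi>. test_fun \<Omega> \<phi> \<longrightarrow> (LINT x|lebesgue. u x * fraclap s \<phi> x) = 0)"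

text \<open>Spherical mean: (1/(r^(N-1) omega_(N-1))) * integral over S_r of g dsigma,
  written via the identity  integral_{S_1} h dsigma = N * integral_{B_1} h(x/|x|) dx
  and omega_(N-1) = N |B_1|.\<close>
definition sph_mean :: "('a::euclidean_space \<Rightarrow> real) \<Rightarrow> real \<Rightarrow> real" where
  "sph_mean g r = (LINT x:ball 0 1|lebesgue. g ((r / norm x) *\<^sub>R x)) / measure lebesgue (ball (0::'a) 1)"

end

theory Submission
  imports Defs
begin

text \<open>
  For \<open>s < 1/2\<close> the fractional Laplacian of a Lipschitz function is an absolutely convergent integral, so every
  comparison function only needs to be Lipschitz. Fix a large ball \<open>B\<^sub>R\<close> and split \<open>u\<^sub>s\<close> into its part
  inside and outside \<open>B\<^sub>R\<close>. The outer part acts on the inner one as a right-hand side \<open>F\<^sub>s\<close>; comparing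
  \<open>|x - y|\<^bsup>-N-2s\<^esup>\<close> with \<open>|x|\<^bsup>-N-2s\<^esup>\<close> and passing to polar coordinates, the hypothesis on the spherical means
  gives \<open>s F\<^sub>s \<rightarrow> 0\<close> uniformly in \<open>\<Omega>\<close>. On the other hand, a Lipschitz function \<open>W\<close> with bounded support and
  \<open>W \<ge> \<eta>\<close> in \<open>\<Omega>\<close> satisfies \<open>s (-\<Delta>)\<^sup>s W \<ge> c \<eta>\<close> (up to the constant \<open>c\<^bsub>N,s\<^esub>\<close>) for small \<open>s\<close>, because the
  kernel has mass of order \<open>1/s\<close> at infinity and bounded first moment near the origin. Hence \<open>\<bar>u\<^sub>s\<bar> \<le> W\<close> for a
  \<open>W\<close> that equals the bound of \<open>g\<close> on \<open>B\<^sub>R - \<Omega>\<close> and \<open>\<eta>\<close> away from the boundary.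

  The maximum principle is applied to a function that is only known to be bounded near the boundary, without control
  of the bound. Mollify, use Kato's inequality for the negative part, and test with a cutoff that vanishes in a boundary
  layer of width \<open>h\<close>: the error is \<open>O(h\<^bsup>-2s\<^esup>)\<close> times the volume \<open>O(h)\<close> of the layer.
\<close>

section \<open>A smooth bump function\<close>

text \<open>Everything is measured on the scale 1/s. The constant c_{N,s} enters only through its
  positivity and is divided out, so a forcing of size o(1/s) is compared with a barrier on which the
  operator is at least a constant times \<eta>/s; contributions that stay bounded as s tends to 0
  lose against either. Only signed spherical means of g are controlled, so absolute values may not
  be taken too early. The radial kernel |x|^(-N-2s) sees nothing but these means, while its
  difference from |x-y|^(-N-2s) gains one power of |x| and can be estimated absolutely by one fixed
  norm, that of L^1_s with s = 1/2. The obstacle is that u_s is a weak solution whose bound near the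
  boundary depends on s in an unknown way. It may enter only with a factor that vanishes for fixed
  s; here this is h^(1-2s), so 2s < 1 is used a second time. The weight dist^\<epsilon> pays for the
  thin layer where the barrier is as large as the bound of g.\<close>

definition expinv :: "nat \<Rightarrow> real \<Rightarrow> real" where
  "expinv n t = (if t \<le> 0 then 0 else inverse t ^ n * exp (- inverse t))"

lemma expinv_nonneg: "0 \<le> expinv n t"
  by (auto simp: expinv_def)

lemma expinv_pos_iff: "0 < expinv n t \<longleftrightarrow> 0 < t"
  by (auto simp: expinv_def)

text \<open>The term of order \<open>n + 2\<close> of the exponential series in \<open>1/t\<close>
  beats the pole of order \<open>n\<close> with two powers of \<open>t\<close> to spare: one is
  spent on the difference quotient at 0, the other sends it to 0.\<close>

lemma expinv_bound: "\<bar>expinv n t\<bar> \<le> fact (n + 2) * t\<^sup>2"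
proof (cases "t \<le> 0")
  case False
  then have t: "t > 0" by simp
  have "inverse t ^ (n + 2) / fact (n + 2) \<le> exp (inverse t)"
    using sum_le_suminf[OF summable_exp[of "inverse t"], of "{n + 2}"] t
    by (simp add: exp_def divide_inverse mult.commute del: fact_Suc power_Suc power_inverse)
  then have "inverse t ^ (n + 2) \<le> fact (n + 2) * exp (inverse t)"
    by (simp only: pos_divide_le_eq[OF fact_gt_zero] mult.commute)
  then have "inverse t ^ (n + 2) * exp (- inverse t) \<le> fact (n + 2)"
    by (simp only: exp_minus pos_divide_le_eq[OF exp_gt_zero] flip: divide_inverse)
  then have "inverse t ^ (n + 2) * exp (- inverse t) * t\<^sup>2 \<le> fact (n + 2) * t\<^sup>2"
    by (rule mult_right_mono) simp
  moreover have "inverse t ^ (n + 2) * exp (- inverse t) * t\<^sup>2 = expinv n t"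
    using t by (simp add: expinv_def power_add power2_eq_square field_simps)
  ultimately show ?thesis using expinv_nonneg[of n t] by simp
qed (simp add: expinv_def)

text \<open>The power \<open>n\<close> is carried along because this two-term formula keeps
  derivatives inside the span of the family, also at the gluing point 0.\<close>

lemma expinv_has_derivative:
  "(expinv n has_real_derivative (expinv (n + 2) t - real n * expinv (n + 1) t)) (at t)"
proof -
  consider "t > 0" | "t < 0" | "t = 0" by linarith
  then show ?thesis
  proof cases
    case 1
    have d: "(inverse has_real_derivative - (inverse t)\<^sup>2) (at t)"
      using 1 by (auto intro!: derivative_eq_intros simp: power2_eq_square)
    have "((\<lambda>t. inverse t ^ n * exp (- inverse t)) has_real_derivative
        (real n * inverse t ^ (n - 1) * - (inverse t)\<^sup>2) * exp (- inverse t) +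
        (exp (- inverse t) * (inverse t)\<^sup>2) * inverse t ^ n) (at t)"
      using DERIV_mult[OF DERIV_power[OF d] DERIV_fun_exp[OF DERIV_minus[OF d]], of n] by (simp add: mult_ac)
    moreover have "(real n * inverse t ^ (n - 1) * - (inverse t)\<^sup>2) * exp (- inverse t) +
        (exp (- inverse t) * (inverse t)\<^sup>2) * inverse t ^ n = expinv (n + 2) t - real n * expinv (n + 1) t"
      using 1 by (cases n) (auto simp: expinv_def power2_eq_square algebra_simps)
    ultimately have "((\<lambda>t. inverse t ^ n * exp (- inverse t)) has_real_derivative
        (expinv (n + 2) t - real n * expinv (n + 1) t)) (at t)" by simp
    then show ?thesis
      using 1 by (subst DERIV_cong_ev[OF refl _ refl])
        (auto simp: expinv_def elim!: eventually_mono[OF order_tendstoD(1)[OF tendsto_ident_at, of 0], rotated]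
          intro: eventually_nhds_in_open[of "{0<..}", THEN eventually_mono])
  next
    case 2
    have "((\<lambda>_. 0) has_real_derivative 0) (at t)" by simp
    then show ?thesis
      using 2 by (subst DERIV_cong_ev[OF refl _ refl])
        (auto simp: expinv_def intro: eventually_nhds_in_open[of "{..<0}", THEN eventually_mono])
  next
    case 3
    have "(\<lambda>h. expinv n h / h) \<midarrow>0\<rightarrow> 0"
    proof (rule Lim_null_comparison)
      show "\<forall>\<^sub>F h in at 0. norm (expinv n h / h) \<le> fact (n + 2) * \<bar>h\<bar>"
      proof (intro always_eventually allI)
        fix h :: real
        have "\<bar>expinv n h\<bar> \<le> fact (n + 2) * \<bar>h\<bar> * \<bar>h\<bar>"
          using expinv_bound[of n h] by (simp only: mult.assoc abs_mult_self_eq power2_eq_square)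
        then show "norm (expinv n h / h) \<le> fact (n + 2) * \<bar>h\<bar>"
          by (cases "h = 0") (simp_all add: divide_simps del: fact_Suc)
      qed
      show "((\<lambda>h::real. fact (n + 2) * \<bar>h\<bar>) \<longlongrightarrow> 0) (at 0)"
        by (intro tendsto_eq_intros refl) auto
    qed
    then show ?thesis
      using 3 by (simp add: DERIV_def expinv_def)
  qed
qed

text \<open>\<open>Ck\<close> recurses through all directional derivatives, so a class of
  differentiable functions closed under them is smooth as a whole. Formulas for higher derivatives
  never appear.\<close>

lemma CkI:
  assumes "\<And>f x. P f \<Longrightarrow> f differentiable (at x)"
    and "\<And>f v. P f \<Longrightarrow> P (\<lambda>x. frechet_derivative f (at x) v)"
    and "P f"
  shows "Ck k f"
  using assms(3)
proof (induction k arbitrary: f)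
  case 0
  then show ?case
    using assms(1) by (auto simp: continuous_on_eq_continuous_within intro!: differentiable_imp_continuous_within)
qed (use assms in auto)

text \<open>For quadratic \<open>q\<close> the derivative of \<open>expinv n (q x)\<close> is an
  affine function of \<open>x\<close> times members of the same family. The generated algebra is
  therefore closed under directional derivatives, as \<open>CkI\<close> asks.\<close>

inductive bump_alg :: "('a::euclidean_space \<Rightarrow> real) \<Rightarrow> ('a \<Rightarrow> real) \<Rightarrow> bool" for q where
  const: "bump_alg q (\<lambda>_. c)"
| inner: "bump_alg q (\<lambda>x. x \<bullet> v)"
| add: "bump_alg q f \<Longrightarrow> bump_alg q g \<Longrightarrow> bump_alg q (\<lambda>x. f x + g x)"
| mult: "bump_alg q f \<Longrightarrow> bump_alg q g \<Longrightarrow> bump_alg q (\<lambda>x. f x * g x)"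
| comp: "bump_alg q (\<lambda>x. expinv n (q x))"

lemma bump_alg_derivative:
  fixes q :: "'a::euclidean_space \<Rightarrow> real"
  assumes q: "\<And>x. q x = r - (norm (x - c))\<^sup>2" and "bump_alg q f"
  shows "\<exists>f'. (\<forall>x. (f has_derivative f' x) (at x)) \<and> (\<forall>v. bump_alg q (\<lambda>x. f' x v))"
  using assms(2)
proof induction
  case (const c)
  show ?case
    by (rule exI[of _ "\<lambda>_ _. 0"]) (auto intro: bump_alg.intros)
next
  case (inner v)
  show ?case
    by (rule exI[of _ "\<lambda>_ w. w \<bullet> v"]) (auto intro!: bump_alg.intros derivative_eq_intros)
next
  case (add f g)
  then obtain f' g' where "\<And>x. (f has_derivative f' x) (at x)" "\<And>v. bump_alg q (\<lambda>x. f' x v)"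
    "\<And>x. (g has_derivative g' x) (at x)" "\<And>v. bump_alg q (\<lambda>x. g' x v)" by blast
  then show ?case
    by (intro exI[of _ "\<lambda>x v. f' x v + g' x v"]) (auto intro!: bump_alg.intros derivative_eq_intros)
next
  case (mult f g)
  then obtain f' g' where "\<And>x. (f has_derivative f' x) (at x)" "\<And>v. bump_alg q (\<lambda>x. f' x v)"
    "\<And>x. (g has_derivative g' x) (at x)" "\<And>v. bump_alg q (\<lambda>x. g' x v)" by blast
  with mult.hyps show ?case
    by (intro exI[of _ "\<lambda>x v. f x * g' x v + f' x v * g x"])
      (auto intro!: bump_alg.intros has_derivative_mult)
next
  case (comp n)
  have q': "q = (\<lambda>x. r - (x - c) \<bullet> (x - c))"
    by (auto simp: q power2_norm_eq_inner)
  have dq: "(q has_derivative (\<lambda>v. - (2 * ((x - c) \<bullet> v)))) (at x)" for x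
    unfolding q' by (rule derivative_eq_intros refl | simp add: inner_commute)+
  have "((\<lambda>x. expinv n (q x)) has_derivative
      (\<lambda>v. - (2 * ((x - c) \<bullet> v)) * (expinv (n + 2) (q x) - real n * expinv (n + 1) (q x)))) (at x)" for x
    using DERIV_compose_FDERIV[OF expinv_has_derivative dq] by simp
  moreover have "bump_alg q (\<lambda>x. - (2 * ((x - c) \<bullet> v)) * (expinv (n + 2) (q x) - real n * expinv (n + 1) (q x)))"
    for v
  proof -
    have "bump_alg q (\<lambda>x. (-2 * (x \<bullet> v) + 2 * (c \<bullet> v)) *
        (expinv (n + 2) (q x) + (- real n) * expinv (n + 1) (q x)))"
      by (intro bump_alg.intros)
    then show ?thesis
      by (simp add: inner_diff_left algebra_simps)
  qed
  ultimately show ?case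
    by (intro exI[of _ "\<lambda>x v. - (2 * ((x - c) \<bullet> v)) *
        (expinv (n + 2) (q x) - real n * expinv (n + 1) (q x))"]) simp
qed

text \<open>The standard mollifier exp(-1/(r^2 - |x-c|^2)), not normalised. The squared norm makes
  the inner function polynomial, hence smooth at the centre too.\<close>

definition bump :: "'a::euclidean_space \<Rightarrow> real \<Rightarrow> 'a \<Rightarrow> real" where
  "bump c r x = expinv 0 (r\<^sup>2 - (norm (x - c))\<^sup>2)"

lemma smooth_bump: "smooth (bump c r)"
  unfolding smooth_def
proof
  fix k
  let ?q = "\<lambda>x. r\<^sup>2 - (norm (x - c))\<^sup>2"
  show "Ck k (bump c r)"
  proof (rule CkI[where P = "bump_alg ?q"])
    show "bump_alg ?q (bump c r)"
      unfolding bump_def[abs_def] by (rule bump_alg.comp)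
    fix f assume f: "bump_alg ?q f"
    obtain f' where f': "\<And>x. (f has_derivative f' x) (at x)" "\<And>v. bump_alg ?q (\<lambda>x. f' x v)"
      using bump_alg_derivative[OF refl f] by blast
    show "f differentiable (at x)" for x
      using f'(1) by (auto simp: differentiable_def)
    have "frechet_derivative f (at x) = f' x" for x
      using f'(1) by (simp add: frechet_derivative_at[symmetric])
    then show "bump_alg ?q (\<lambda>x. frechet_derivative f (at x) v)" for v
      using f'(2) by simp
  qed
qed

lemma bump_nonneg: "0 \<le> bump c r x"
  by (simp add: bump_def expinv_nonneg)

lemma bump_le_1: "bump c r x \<le> 1"
  by (simp add: bump_def expinv_def)

lemma bump_pos_iff:
  assumes "0 < r"
  shows "0 < bump c r x \<longleftrightarrow> dist x c < r"
proof -
  have "(norm (x - c))\<^sup>2 < r\<^sup>2 \<longleftrightarrow> norm (x - c) < r"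
    using assms by (meson norm_ge_zero power2_less_imp_less power_strict_mono less_imp_le pos2)
  then show ?thesis by (simp add: bump_def expinv_pos_iff dist_norm)
qed

lemma bump_eq_0: "0 < r \<Longrightarrow> r \<le> dist x c \<Longrightarrow> bump c r x = 0"
  using bump_pos_iff[of r c x] bump_nonneg[of c r x] by linarith

lemma bump_translate: "bump c r (x + z) = bump (c - z) r x"
  by (simp add: bump_def algebra_simps)

lemma bump_commute: "bump c r x = bump x r c"
  by (simp add: bump_def norm_minus_commute)

lemma test_fun_bump:
  assumes "0 < r" "cball c r \<subseteq> \<Omega>"
  shows "test_fun \<Omega> (bump c r)"
  unfolding test_fun_def
  using assms by (auto intro!: smooth_bump exI[of _ "cball c r"] bump_eq_0 simp: dist_commute)

text \<open>The second order makes the first partial derivatives continuous, hence bounded on the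
  compact ball; the mean value inequality on this convex set turns the bound into a Lipschitz
  constant.\<close>

lemma Ck_Suc_lipschitz:
  fixes f :: "'a::euclidean_space \<Rightarrow> real"
  assumes "Ck (Suc (Suc 0)) f"
  shows "\<exists>C\<ge>0. \<forall>x\<in>cball c r. \<forall>y\<in>cball c r. \<bar>f x - f y\<bar> \<le> C * dist x y"
proof -
  have d: "(f has_derivative frechet_derivative f (at x)) (at x)" for x
    using assms by (simp add: frechet_derivative_works)
  have "\<exists>B\<ge>0. \<forall>x\<in>cball c r. \<bar>frechet_derivative f (at x) b\<bar> \<le> B" for b
  proof -
    have "(\<lambda>x. frechet_derivative f (at x) b) differentiable at x" for x
      using assms by simp
    then have "continuous_on (cball c r) (\<lambda>x. frechet_derivative f (at x) b)"
      by (meson continuous_at_imp_continuous_on differentiable_imp_continuous_within)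
    then have "bounded ((\<lambda>x. frechet_derivative f (at x) b) ` cball c r)"
      by (intro compact_imp_bounded compact_continuous_image) auto
    then obtain B where "\<forall>x\<in>cball c r. \<bar>frechet_derivative f (at x) b\<bar> \<le> B"
      by (auto simp: bounded_iff)
    then show ?thesis by (intro exI[of _ "max B 0"]) (auto simp: le_max_iff_disj)
  qed
  then obtain B where B: "\<And>b. B b \<ge> 0" "\<And>b x. x \<in> cball c r \<Longrightarrow> \<bar>frechet_derivative f (at x) b\<bar> \<le> B b"
    by metis
  let ?C = "\<Sum>b\<in>Basis. B b"
  have on: "onorm (frechet_derivative f (at x)) \<le> ?C" if x: "x \<in> cball c r" for x
  proof (rule onorm_le)
    fix v :: 'a
    interpret D: bounded_linear "frechet_derivative f (at x)"
      using d by (rule has_derivative_bounded_linear)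
    have "frechet_derivative f (at x) v = frechet_derivative f (at x) (\<Sum>b\<in>Basis. (v \<bullet> b) *\<^sub>R b)"
      by (simp add: euclidean_representation)
    also have "\<dots> = (\<Sum>b\<in>Basis. (v \<bullet> b) * frechet_derivative f (at x) b)"
      by (simp add: D.sum D.scaleR)
    finally have "\<bar>frechet_derivative f (at x) v\<bar> \<le> (\<Sum>b\<in>Basis. \<bar>(v \<bullet> b) * frechet_derivative f (at x) b\<bar>)"
      by (metis sum_abs)
    also have "\<dots> \<le> (\<Sum>b\<in>Basis. norm v * B b)"
      using x B by (intro sum_mono) (auto simp: abs_mult intro!: mult_mono Basis_le_norm)
    finally show "norm (frechet_derivative f (at x) v) \<le> ?C * norm v"
      by (simp add: sum_distrib_left mult.commute)
  qed
  have "norm (f x - f y) \<le> ?C * norm (x - y)" if "x \<in> cball c r" "y \<in> cball c r" for x y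
    using that by (intro differentiable_bound[OF convex_cball has_derivative_at_withinI[OF d] on])
  then show ?thesis
    using B(1) by (intro exI[of _ ?C]) (auto simp: dist_norm sum_nonneg)
qed

lemma bump_lipschitz:
  assumes "0 < r"
  shows "\<exists>C\<ge>0. \<forall>x y. \<bar>bump c r x - bump c r y\<bar> \<le> C * min 1 (dist x y)"
proof -
  have "Ck (Suc (Suc 0)) (bump c r)"
    using smooth_bump[of c r] by (auto simp: smooth_def simp del: Ck.simps)
  from Ck_Suc_lipschitz[OF this, of c "r + 1"] obtain C where C: "C \<ge> 0"
    "\<And>x y. x \<in> cball c (r + 1) \<Longrightarrow> y \<in> cball c (r + 1) \<Longrightarrow> \<bar>bump c r x - bump c r y\<bar> \<le> C * dist x y"
    by blast
  have b: "\<bar>bump c r x - bump c r y\<bar> \<le> 1" for x y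
    using bump_nonneg[of c r x] bump_nonneg[of c r y] bump_le_1[of c r x] bump_le_1[of c r y] by linarith
  \<comment> \<open>Two points at distance below 1 either both lie in the ball enlarged by 1, where
    the local constant applies, or both lie outside the support.\<close>
  have l: "\<bar>bump c r x - bump c r y\<bar> \<le> (C + 1) * dist x y" if "dist x y < 1" for x y
  proof (cases "x \<in> cball c (r + 1) \<and> y \<in> cball c (r + 1)")
    case True
    then show ?thesis using C(2)[of x y] by (simp add: distrib_right add_increasing2)
  next
    case False
    have "dist x c \<le> dist x y + dist y c" "dist y c \<le> dist x y + dist x c"
      by (metis dist_commute dist_triangle)+
    then have "dist x c \<ge> r" "dist y c \<ge> r" using False that by (auto simp: dist_commute)
    then show ?thesis using assms C(1) by (simp add: bump_eq_0)
  qed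
  show ?thesis
  proof (intro exI[of _ "C + 1"] conjI allI)
    fix x y
    show "\<bar>bump c r x - bump c r y\<bar> \<le> (C + 1) * min 1 (dist x y)"
      using b[of x y] l[of x y] C(1) by (cases "dist x y < 1") (auto simp: min_def)
  qed (use C in auto)
qed

section \<open>Polar coordinates\<close>

lemma ball_in_borel [measurable]: "ball (c::'a::euclidean_space) r \<in> sets borel"
  by simp

lemma nn_integral_lborel_scaleR:
  fixes f :: "'a::euclidean_space \<Rightarrow> ennreal"
  assumes [measurable]: "f \<in> borel_measurable borel" and "c \<noteq> 0"
  shows "(\<integral>\<^sup>+x. f x \<partial>lborel) = ennreal (\<bar>c\<bar> ^ DIM('a)) * (\<integral>\<^sup>+x. f (c *\<^sub>R x) \<partial>lborel)"
  using assms(2)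
  by (subst lborel_affine[of c 0]) (auto simp: nn_integral_density nn_integral_distr nn_integral_cmult)

lemma nn_integral_powr_to_inf:
  fixes a p :: real
  assumes "p < -1" "0 < a"
  shows "(\<integral>\<^sup>+t. ennreal (indicator {a..} t * t powr p) \<partial>lborel) = ennreal (- (a powr (p + 1)) / (p + 1))"
proof (rule nn_integral_has_integral_lborel)
  have "(\<lambda>t. indicator {a..} t * t powr p) = (\<lambda>t. if t \<in> {a..} then t powr p else 0)"
    by (auto simp: indicator_def)
  then show "((\<lambda>t. indicator {a..} t * t powr p) has_integral - (a powr (p + 1)) / (p + 1)) UNIV"
    using has_integral_powr_to_inf[OF assms] by (simp only: has_integral_restrict_UNIV)
qed auto

lemma ennreal_mult_assoc: "0 \<le> a \<Longrightarrow> a * b = c \<Longrightarrow> ennreal a * (ennreal b * g) = ennreal c * g"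
  by (simp add: mult.assoc[symmetric] ennreal_mult'[symmetric])

lemma AE_lborel_nonzero: "AE x in lborel. x \<noteq> (0::'a::euclidean_space)"
  using AE_lborel_singleton[of "0::'a"] by simp

text \<open>Two changes of scale, radial and spatial, reduce the identity to
  \<open>\<integral> N \<bar>y\<bar>\<^sup>N t\<^bsup>-N-1\<^esup> dt = 1\<close> over \<open>t > \<bar>y\<bar>\<close>, so no surface measure is needed.\<close>

lemma nn_integral_polar:
  fixes G :: "'a::euclidean_space \<Rightarrow> ennreal"
  assumes [measurable]: "G \<in> borel_measurable borel"
  shows "(\<integral>\<^sup>+r. \<integral>\<^sup>+x. ennreal (indicator {0<..} r * (real DIM('a) * r ^ (DIM('a) - 1)) * indicator (ball 0 1) x)
      * G ((r / norm x) *\<^sub>R x) \<partial>lborel \<partial>lborel) = (\<integral>\<^sup>+x. G x \<partial>lborel)" (is "?L = _")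
proof -
  let ?N = "DIM('a)"
  let ?v = "\<lambda>t x. indicator {0<..} t * (real ?N * norm x ^ ?N * t ^ (?N - 1)) * indicator (ball (0::'a) 1) x"
  let ?w = "\<lambda>r x. indicator {0<..} r * (real ?N * r ^ (?N - 1)) * indicator (ball (0::'a) 1) x"
  let ?k = "\<lambda>t y. indicator {0<..} (t - norm y) * (real ?N * norm (y::'a) ^ ?N / t ^ (?N + 1))"
  have N: "?N > 0" by simp
  have "?L = (\<integral>\<^sup>+x. \<integral>\<^sup>+r. ennreal (?w r x)
      * G ((r / norm x) *\<^sub>R x) \<partial>lborel \<partial>(lborel::'a measure))"
    by (rule lborel_pair.Fubini') measurable
  also have "\<dots> = (\<integral>\<^sup>+x. \<integral>\<^sup>+t. ennreal (?v t x)
      * G (t *\<^sub>R x) \<partial>lborel \<partial>(lborel::'a measure))"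
  proof (rule nn_integral_cong_AE, use AE_lborel_nonzero in eventually_elim)
    fix x :: 'a assume x: "x \<noteq> 0"
    have "(\<integral>\<^sup>+r. ennreal (?w r x)
        * G ((r / norm x) *\<^sub>R x) \<partial>lborel)
      = ennreal (norm x) * (\<integral>\<^sup>+t. ennreal (?w (norm x * t) x)
        * G ((norm x * t / norm x) *\<^sub>R x) \<partial>lborel)"
      using x by (subst nn_integral_real_affine[where c = "norm x" and t = 0]) auto
    also have "\<dots> = (\<integral>\<^sup>+t. ennreal (norm x) * (ennreal (?w (norm x * t) x)
        * G ((norm x * t / norm x) *\<^sub>R x)) \<partial>lborel)"
      by (rule nn_integral_cmult[symmetric]) measurable
    also have "\<dots> = (\<integral>\<^sup>+t. ennreal (?v t x)
      * G (t *\<^sub>R x) \<partial>lborel)"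
    proof (rule nn_integral_cong)
      fix t :: real
      have "norm x * (?w (norm x * t) x)
          = ?v t x"
        using x N by (cases ?N) (auto simp: indicator_def zero_less_mult_iff power_mult_distrib)
      then show "ennreal (norm x) * (ennreal (?w (norm x * t) x)
          * G ((norm x * t / norm x) *\<^sub>R x))
        = ennreal (?v t x)
          * G (t *\<^sub>R x)"
        using x by (subst ennreal_mult_assoc) auto
    qed
    finally show "(\<integral>\<^sup>+r. ennreal (?w r x)
        * G ((r / norm x) *\<^sub>R x) \<partial>lborel) = (\<integral>\<^sup>+t. ennreal (?v t x)
      * G (t *\<^sub>R x) \<partial>lborel)" .
  qed
  also have "\<dots> = (\<integral>\<^sup>+t. \<integral>\<^sup>+x. ennreal (?v t x)
      * G (t *\<^sub>R x) \<partial>(lborel::'a measure) \<partial>lborel)"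
    by (rule lborel_pair.Fubini') measurable
  also have "\<dots> = (\<integral>\<^sup>+t. \<integral>\<^sup>+y. ennreal (?k t y) * G y
      \<partial>(lborel::'a measure) \<partial>lborel)"
  proof (rule nn_integral_cong)
    fix t :: real
    show "(\<integral>\<^sup>+x. ennreal (?v t x)
      * G (t *\<^sub>R x) \<partial>(lborel::'a measure)) = (\<integral>\<^sup>+y. ennreal (?k t y) * G y
      \<partial>(lborel::'a measure))"
    proof (cases "t > 0")
      case True
      have "(\<integral>\<^sup>+x. ennreal (?v t x)
        * G (t *\<^sub>R x) \<partial>(lborel::'a measure))
       = ennreal (\<bar>1 / t\<bar> ^ ?N) * (\<integral>\<^sup>+y. ennreal (?v t ((1/t) *\<^sub>R y))
        * G (t *\<^sub>R ((1/t) *\<^sub>R y)) \<partial>(lborel::'a measure))"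
        using True by (intro nn_integral_lborel_scaleR) auto
      also have "\<dots> = (\<integral>\<^sup>+y. ennreal (\<bar>1 / t\<bar> ^ ?N) * (ennreal (?v t ((1/t) *\<^sub>R y))
        * G (t *\<^sub>R ((1/t) *\<^sub>R y))) \<partial>(lborel::'a measure))"
        by (rule nn_integral_cmult[symmetric]) measurable
      also have "\<dots> = (\<integral>\<^sup>+y. ennreal (?k t y) * G y
        \<partial>(lborel::'a measure))"
      proof (rule nn_integral_cong)
        fix y :: 'a
        obtain m where m: "?N = Suc m" using N by (cases ?N) auto
        have "\<bar>1 / t\<bar> ^ ?N * (?v t ((1/t) *\<^sub>R y))
          = ?k t y"
          using True unfolding m by (auto simp: indicator_def power_divide field_simps)
        then show "ennreal (\<bar>1 / t\<bar> ^ ?N) * (ennreal (?v t ((1/t) *\<^sub>R y))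
          * G (t *\<^sub>R ((1/t) *\<^sub>R y)))
          = ennreal (?k t y) * G y"
          using True by (subst ennreal_mult_assoc) auto
      qed
      finally show ?thesis .
    next
      case False
      then have "indicator {0<..} (t - norm y) = (0::real)" for y :: 'a
        using order.strict_trans1[OF norm_ge_zero[of y], of t] by (auto simp: indicator_def)
      then show ?thesis using False by simp
    qed
  qed
  also have "\<dots> = (\<integral>\<^sup>+y. \<integral>\<^sup>+t. ennreal (?k t y) * G y
      \<partial>lborel \<partial>(lborel::'a measure))"
    by (rule lborel_pair.Fubini') measurable
  also have "\<dots> = (\<integral>\<^sup>+y. G y \<partial>lborel)"
  proof (rule nn_integral_cong_AE, use AE_lborel_nonzero in eventually_elim)
    fix y :: 'a assume y: "y \<noteq> 0"
    have "(\<integral>\<^sup>+t. ennreal (?k t y) * G y \<partial>lborel)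
      = (\<integral>\<^sup>+t. ennreal (?k t y) \<partial>lborel) * G y"
      by (rule nn_integral_multc) measurable
    also have "(\<integral>\<^sup>+t. ennreal (?k t y) \<partial>lborel)
      = (\<integral>\<^sup>+t. ennreal (real ?N * norm y ^ ?N) * ennreal (indicator {norm y..} t * t powr (- real ?N - 1)) \<partial>lborel)"
    proof (rule nn_integral_cong_AE, use AE_lborel_singleton[of "norm y"] in eventually_elim)
      fix t :: real assume tn: "t \<noteq> norm y"
      have pw: "t powr (- real ?N - 1) = 1 / t ^ (?N + 1)" if "t > 0"
      proof -
        have "- real ?N - 1 = - real (?N + 1)" by simp
        then show ?thesis using that by (simp only: powr_minus_divide powr_realpow)
      qed
      show "ennreal (?k t y)
        = ennreal (real ?N * norm y ^ ?N) * ennreal (indicator {norm y..} t * t powr (- real ?N - 1))"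
      proof (cases "norm y < t")
        case True
        then have "t > 0" using order.strict_trans1[OF norm_ge_zero] by blast
        then show ?thesis using True pw
          by (simp add: indicator_def ennreal_mult'[symmetric])
      qed (use tn in \<open>auto simp: indicator_def\<close>)
    qed
    also have "\<dots> = ennreal (real ?N * norm y ^ ?N) * (\<integral>\<^sup>+t. ennreal (indicator {norm y..} t * t powr (- real ?N - 1)) \<partial>lborel)"
      by (rule nn_integral_cmult) measurable
    also have "\<dots> = ennreal (real ?N * norm y ^ ?N) * ennreal (norm y powr (- real ?N) / real ?N)"
      using y N by (subst nn_integral_powr_to_inf) (auto simp: divide_simps)
    also have "\<dots> = 1"
      using y N by (simp add: ennreal_mult'[symmetric] powr_minus powr_realpow divide_simps)
    finally show "(\<integral>\<^sup>+t. ennreal (?k t y) * G y \<partial>lborel) = G y"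
      by simp
  qed
  finally show ?thesis .
qed

text \<open>Restating polar coordinates as a push-forward that equals \<open>lborel\<close>
  transfers integrability and signed integrals at once, without a detour through positive and
  negative parts.\<close>

definition polar_measure :: "(real \<times> 'a::euclidean_space) measure" where
  "polar_measure = density (lborel \<Otimes>\<^sub>M lborel)
    (\<lambda>(r, x). ennreal (indicator {0<..} r * (real DIM('a) * r ^ (DIM('a) - 1)) * indicator (ball 0 1) x))"

lemma sets_polar_measure [measurable_cong]: "sets polar_measure = sets (borel \<Otimes>\<^sub>M borel)"
  by (simp add: polar_measure_def)

lemma distr_polar_measure:
  "distr (polar_measure :: (real \<times> 'a::euclidean_space) measure) borel (\<lambda>(r, x). (r / norm x) *\<^sub>R x) = lborel"
proof (rule measure_eqI)
  let ?w = "\<lambda>r x. indicator {0<..} r * (real DIM('a) * r ^ (DIM('a) - 1)) * indicator (ball (0::'a) 1) x"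
  fix A :: "'a set" assume "A \<in> sets (distr (polar_measure :: (real \<times> 'a) measure) borel (\<lambda>(r, x). (r / norm x) *\<^sub>R x))"
  then have [measurable]: "A \<in> sets borel" by simp
  let ?T = "\<lambda>(r, x::'a). (r / norm x) *\<^sub>R x"
  have "emeasure (distr (polar_measure :: (real \<times> 'a) measure) borel ?T) A = (\<integral>\<^sup>+y. indicator A y \<partial>distr polar_measure borel ?T)"
    by simp
  also have "\<dots> = (\<integral>\<^sup>+p. indicator A (?T p) \<partial>polar_measure)"
    by (rule nn_integral_distr) measurable
  also have "\<dots> = (\<integral>\<^sup>+p. (case p of (r, x) \<Rightarrow> ennreal (?w r x))
      * indicator A (?T p) \<partial>(lborel \<Otimes>\<^sub>M lborel))"
    unfolding polar_measure_def by (rule nn_integral_density) measurable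
  also have "\<dots> = (\<integral>\<^sup>+r. \<integral>\<^sup>+x. ennreal (?w r x)
      * indicator A ((r / norm x) *\<^sub>R x) \<partial>lborel \<partial>lborel)"
    by (subst lborel.nn_integral_fst[symmetric]) auto
  also have "\<dots> = emeasure lborel A"
    by (subst nn_integral_polar) auto
  finally show "emeasure (distr (polar_measure :: (real \<times> 'a) measure) borel ?T) A = emeasure lborel A" .
qed simp

lemma integral_polar:
  fixes G :: "'a::euclidean_space \<Rightarrow> real"
  assumes G: "integrable lborel G"
  shows "(LINT y|lborel. G y) = (LINT r|lborel. indicator {0<..} r * (real DIM('a) * r ^ (DIM('a) - 1)) *
     (LINT x|lborel. indicator (ball 0 1) x * G ((r / norm x) *\<^sub>R x)))"
proof -
  let ?T = "\<lambda>(r, x::'a). (r / norm x) *\<^sub>R x"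
  let ?w = "\<lambda>(r, x::'a). indicator {0<..} r * (real DIM('a) * r ^ (DIM('a) - 1)) * indicator (ball 0 1) x"
  have [measurable]: "G \<in> borel_measurable borel" using G by auto
  have wm: "?w \<in> borel_measurable (lborel \<Otimes>\<^sub>M lborel)" by measurable
  have wnn: "0 \<le> ?w p" for p by (auto simp: split_beta indicator_def)
  have pm: "polar_measure = density (lborel \<Otimes>\<^sub>M lborel) (\<lambda>p. ennreal (?w p))"
    unfolding polar_measure_def by (rule arg_cong[of _ _ "density _"]) auto
  have "integrable (distr polar_measure borel ?T) G"
    using G unfolding distr_polar_measure .
  then have "integrable polar_measure (\<lambda>p. G (?T p))"
    by (subst (asm) integrable_distr_eq) auto
  then have int: "integrable (lborel \<Otimes>\<^sub>M lborel) (\<lambda>p. ?w p *\<^sub>R G (?T p))"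
    unfolding pm by (subst (asm) integrable_density) (use wm wnn in auto)
  have "(LINT y|lborel. G y) = (LINT y|distr polar_measure borel ?T. G y)"
    unfolding distr_polar_measure ..
  also have "\<dots> = (LINT p|polar_measure. G (?T p))"
    by (rule integral_distr) auto
  also have "\<dots> = (LINT p|(lborel \<Otimes>\<^sub>M lborel). ?w p *\<^sub>R G (?T p))"
    unfolding pm by (rule integral_density) (use wm wnn in auto)
  also have "\<dots> = (LINT r|lborel. LINT x|lborel. ?w (r, x) *\<^sub>R G (?T (r, x)))"
    by (rule lborel_pair.integral_fst'[OF int, symmetric])
  finally show ?thesis
    by (simp add: mult.assoc)
qed

text \<open>A null set has mass zero in polar coordinates, so almost every sphere meets it in a null
  set of directions. Spherical means may thus ignore null sets, although each single sphere is
  itself null.\<close>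

lemma AE_polar:
  fixes P :: "'a::euclidean_space \<Rightarrow> bool"
  assumes "AE y in lborel. P y"
  shows "AE r in lborel. 0 < r \<longrightarrow> (AE x in lborel. x \<in> ball 0 1 \<longrightarrow> P ((r / norm x) *\<^sub>R x))"
proof -
  let ?w = "\<lambda>r x. indicator {0<..} r * (real DIM('a) * r ^ (DIM('a) - 1)) * indicator (ball (0::'a) 1) x"
  obtain A where A: "{y. \<not> P y} \<subseteq> A" "A \<in> sets lborel" "emeasure lborel A = 0"
    using assms by (auto elim!: AE_E)
  then have [measurable]: "A \<in> sets borel" by simp
  have "(\<integral>\<^sup>+r. \<integral>\<^sup>+x. ennreal (?w r x)
      * indicator A ((r / norm x) *\<^sub>R x) \<partial>lborel \<partial>lborel) = 0"
    by (subst nn_integral_polar) (use A in auto)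
  then have "AE r in lborel. (\<integral>\<^sup>+x. ennreal (?w r x)
      * indicator A ((r / norm x) *\<^sub>R x) \<partial>lborel) = 0"
    by (subst (asm) nn_integral_0_iff_AE) auto
  then show ?thesis
  proof eventually_elim
    fix r :: real
    assume "(\<integral>\<^sup>+x. ennreal (?w r x)
      * indicator A ((r / norm x) *\<^sub>R x) \<partial>lborel) = 0"
    then have *: "AE x in lborel. ennreal (?w r x)
      * indicator A ((r / norm x) *\<^sub>R x) = 0"
      by (subst (asm) nn_integral_0_iff_AE) auto
    show "0 < r \<longrightarrow> (AE x in lborel. x \<in> ball 0 1 \<longrightarrow> P ((r / norm x) *\<^sub>R x))"
    proof
      assume r: "0 < r"
      show "AE x in lborel. x \<in> ball 0 1 \<longrightarrow> P ((r / norm x) *\<^sub>R x)"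
        using * by eventually_elim (use A(1) r in \<open>auto simp: indicator_def split: if_splits\<close>)
    qed
  qed
qed

lemma nn_integral_radial:
  fixes f :: "real \<Rightarrow> ennreal"
  assumes [measurable]: "f \<in> borel_measurable borel"
  shows "(\<integral>\<^sup>+x. f (norm (x::'a::euclidean_space)) \<partial>lborel) =
    ennreal (real DIM('a) * measure lborel (ball (0::'a) 1)) * (\<integral>\<^sup>+r. ennreal (indicator {0<..} r * r ^ (DIM('a) - 1)) * f r \<partial>lborel)"
proof -
  let ?w = "\<lambda>r x. indicator {0<..} r * (real DIM('a) * r ^ (DIM('a) - 1)) * indicator (ball (0::'a) 1) x"
  let ?V = "measure lborel (ball (0::'a) 1)"
  have V: "emeasure lborel (ball (0::'a) 1) = ennreal ?V"
    by (rule emeasure_eq_ennreal_measure) (use emeasure_lborel_ball_finite[of "0::'a" 1] in auto)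
  have "(\<integral>\<^sup>+x. f (norm (x::'a)) \<partial>lborel) = (\<integral>\<^sup>+r. \<integral>\<^sup>+x. ennreal (?w r x)
      * f (norm ((r / norm x) *\<^sub>R x)) \<partial>(lborel::'a measure) \<partial>lborel)"
    by (rule nn_integral_polar[symmetric]) measurable
  also have "\<dots> = (\<integral>\<^sup>+r. \<integral>\<^sup>+x. (ennreal (indicator {0<..} r * (real DIM('a) * r ^ (DIM('a) - 1))) * f r) * indicator (ball 0 1) x \<partial>(lborel::'a measure) \<partial>lborel)"
  proof (rule nn_integral_cong, rule nn_integral_cong_AE, use AE_lborel_nonzero in eventually_elim)
    fix r and x :: 'a assume "x \<noteq> 0"
    then show "ennreal (?w r x)
      * f (norm ((r / norm x) *\<^sub>R x)) = (ennreal (indicator {0<..} r * (real DIM('a) * r ^ (DIM('a) - 1))) * f r) * indicator (ball 0 1) x"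
      by (auto simp: indicator_def)
  qed
  also have "\<dots> = (\<integral>\<^sup>+r. ennreal (real DIM('a) * ?V) * (ennreal (indicator {0<..} r * r ^ (DIM('a) - 1)) * f r) \<partial>lborel)"
    by (intro nn_integral_cong, subst nn_integral_cmult)
      (auto simp: V indicator_def ennreal_mult' mult_ac)
  also have "\<dots> = ennreal (real DIM('a) * ?V) * (\<integral>\<^sup>+r. ennreal (indicator {0<..} r * r ^ (DIM('a) - 1)) * f r \<partial>lborel)"
    by (rule nn_integral_cmult) measurable
  finally show ?thesis .
qed

section \<open>The boundary layer of a domain with regular boundary\<close>

lemma emeasure_lborel_translate:
  fixes E :: "'a::euclidean_space set"
  assumes "E \<in> sets borel"
  shows "emeasure lborel {y. y - c \<in> E} = emeasure lborel E"
proof -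
  have "emeasure lborel E = emeasure (distr lborel borel ((+) (- c))) E"
    by (simp add: lborel_distr_plus)
  also have "\<dots> = emeasure lborel ((+) (- c) -` E)"
    using assms by (subst emeasure_distr) auto
  also have "(+) (- c) -` E = {y. y - c \<in> E}"
    by auto
  finally show ?thesis by simp
qed

text \<open>About \<open>1/(3a)\<close> disjoint translates of the slab along \<open>\<nu>\<close> fit into a fixed ball.\<close>

lemma emeasure_graph_slab_le:
  fixes \<gamma> :: "'a::euclidean_space \<Rightarrow> real"
  assumes \<gamma>: "continuous_on UNIV \<gamma>" and \<nu>: "norm \<nu> = 1" and a: "0 < a" "a \<le> 1/6"
  shows "emeasure lborel {y \<in> ball x r. \<bar>\<gamma> (y - (y \<bullet> \<nu>) *\<^sub>R \<nu>) - y \<bullet> \<nu>\<bar> \<le> a}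
     \<le> ennreal (6 * a * measure lborel (ball x (r + 1)))"
proof -
  define E where "E = {y \<in> ball x r. \<bar>\<gamma> (y - (y \<bullet> \<nu>) *\<^sub>R \<nu>) - y \<bullet> \<nu>\<bar> \<le> a}"
  have [measurable]: "\<gamma> \<in> borel_measurable borel"
    using \<gamma> by (rule borel_measurable_continuous_onI)
  have [measurable]: "E \<in> sets borel"
    unfolding E_def ball_def by measurable
  \<comment> \<open>Shifts by \<open>3 * a\<close> exceed the vertical extent \<open>2 * a\<close>
    of the slab, and \<open>M\<close> of them add up to at most 1, whence the ball of radius
    \<open>r + 1\<close>.\<close>
  define M where "M = nat \<lfloor>1 / (3 * a)\<rfloor>"
  have M: "1 / (3 * a) - 1 \<le> real M" "real M \<le> 1 / (3 * a)"
    using a of_int_floor_le[of "1 / (3 * a)"] real_of_int_floor_gt_diff_one[of "1 / (3 * a)"]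
    unfolding M_def by (simp_all add: of_nat_nat)
  \<comment> \<open>Since \<open>a \<le> 1/6\<close>, rounding down loses at most half of
    \<open>1 / (3 * a)\<close>; this is the origin of the factor 6.\<close>
  have "1 \<le> 1 / (6 * a)" using a by (simp add: divide_simps)
  moreover have "1 / (3 * a) = 1 / (6 * a) + 1 / (6 * a)" using a by (simp add: field_simps)
  ultimately have "1 / (6 * a) \<le> real M" using M(1) by linarith
  then have M1: "1 \<le> 6 * a * real M" using a by (simp add: divide_simps mult_ac)
  define F where "F j = {y. y - (3 * a * real j) *\<^sub>R \<nu> \<in> E}" for j :: nat
  have [measurable]: "F j \<in> sets borel" for j
    unfolding F_def by measurable
  have "\<nu> \<bullet> \<nu> = 1" using \<nu> by (simp add: dot_square_norm)
  then have pr: "y - t *\<^sub>R \<nu> - ((y - t *\<^sub>R \<nu>) \<bullet> \<nu>) *\<^sub>R \<nu> = y - (y \<bullet> \<nu>) *\<^sub>R \<nu>" "(y - t *\<^sub>R \<nu>) \<bullet> \<nu> = y \<bullet> \<nu> - t" for y t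
    by (auto simp: inner_diff_left algebra_simps)
  have "disjoint_family_on F {..<M}"
    unfolding disjoint_family_on_def
  proof (intro ballI impI equals0I)
    fix i j y assume ij: "i \<noteq> j" and y: "y \<in> F i \<inter> F j"
    define d where "d = \<gamma> (y - (y \<bullet> \<nu>) *\<^sub>R \<nu>) - y \<bullet> \<nu>"
    have "\<bar>d + 3 * a * real i\<bar> \<le> a" "\<bar>d + 3 * a * real j\<bar> \<le> a"
      using y unfolding F_def E_def d_def Int_iff mem_Collect_eq pr by (auto simp: algebra_simps)
    then have "\<bar>3 * a * real i - 3 * a * real j\<bar> \<le> 2 * a" by linarith
    then have "3 * a * \<bar>real i - real j\<bar> \<le> 2 * a"
      using a by (metis abs_mult abs_of_pos mult_pos_pos right_diff_distrib zero_less_numeral)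
    moreover have "3 * a * 1 \<le> 3 * a * \<bar>real i - real j\<bar>"
      using a ij by (intro mult_left_mono) auto
    ultimately show False using a by linarith
  qed
  then have "(\<Sum>j<M. emeasure lborel (F j)) = emeasure lborel (\<Union>j<M. F j)"
    by (intro sum_emeasure) auto
  also have "\<dots> \<le> emeasure lborel (ball x (r + 1))"
  proof (rule emeasure_mono)
    show "(\<Union>j<M. F j) \<subseteq> ball x (r + 1)"
    proof
      fix y assume "y \<in> (\<Union>j<M. F j)"
      then obtain j where j: "j < M" "y \<in> F j" by auto
      then have "dist x (y - (3 * a * real j) *\<^sub>R \<nu>) < r" by (auto simp: F_def E_def)
      moreover have "dist (y - (3 * a * real j) *\<^sub>R \<nu>) y \<le> 1"
      proof -
        have "3 * a * real j \<le> 3 * a * real M" using j a by simp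
        also have "\<dots> \<le> 1" using M(2) a by (simp add: field_simps)
        finally show ?thesis using \<nu> a by (simp add: dist_norm)
      qed
      ultimately show "y \<in> ball x (r + 1)"
        using dist_triangle[of x y "y - (3 * a * real j) *\<^sub>R \<nu>"] by simp
    qed
  qed simp
  also have "\<dots> = ennreal (measure lborel (ball x (r + 1)))"
    by (rule emeasure_eq_ennreal_measure) (use emeasure_lborel_ball_finite[of x "r + 1"] in auto)
  also have "(\<Sum>j<M. emeasure lborel (F j)) = of_nat M * emeasure lborel E"
    unfolding F_def by (simp add: emeasure_lborel_translate)
  finally have *: "of_nat M * emeasure lborel E \<le> ennreal (measure lborel (ball x (r + 1)))" .
  have "emeasure lborel E = ennreal 1 * emeasure lborel E" by simp
  also have "\<dots> \<le> ennreal (6 * a * real M) * emeasure lborel E"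
    by (intro mult_right_mono ennreal_leI M1) simp
  also have "\<dots> = ennreal (6 * a) * (of_nat M * emeasure lborel E)"
    using a by (simp add: ennreal_mult mult.assoc ennreal_of_nat_eq_real_of_nat)
  also have "\<dots> \<le> ennreal (6 * a) * ennreal (measure lborel (ball x (r + 1)))"
    by (intro mult_left_mono *) simp
  also have "\<dots> = ennreal (6 * a * measure lborel (ball x (r + 1)))"
    using a by (simp add: ennreal_mult)
  finally show ?thesis unfolding E_def .
qed

text \<open>Openness keeps a boundary point out of \<Omega>, hence on or below the graph. If it were
  strictly below, a whole neighbourhood would miss \<Omega>, which is impossible for a point of the
  closure.\<close>

lemma frontier_subset_graph:
  fixes \<Omega> :: "'a::euclidean_space set"
  assumes "open \<Omega>" and \<gamma>: "continuous_on UNIV \<gamma>"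
    and eq: "\<Omega> \<inter> ball x r = {y \<in> ball x r. \<gamma> (y - (y \<bullet> \<nu>) *\<^sub>R \<nu>) < y \<bullet> \<nu>}"
    and p: "p \<in> frontier \<Omega>" "p \<in> ball x r"
  shows "\<gamma> (p - (p \<bullet> \<nu>) *\<^sub>R \<nu>) = p \<bullet> \<nu>"
proof (rule antisym)
  have "p \<notin> \<Omega>"
    using p(1) \<open>open \<Omega>\<close> by (simp add: frontier_def interior_open)
  then show "p \<bullet> \<nu> \<le> \<gamma> (p - (p \<bullet> \<nu>) *\<^sub>R \<nu>)"
    using eq p(2) by (metis (no_types, lifting) IntD1 leI mem_Collect_eq)
  show "\<gamma> (p - (p \<bullet> \<nu>) *\<^sub>R \<nu>) \<le> p \<bullet> \<nu>"
  proof (rule ccontr)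
    assume *: "\<not> ?thesis"
    let ?U = "ball x r \<inter> {y. y \<bullet> \<nu> < \<gamma> (y - (y \<bullet> \<nu>) *\<^sub>R \<nu>)}"
    have "continuous_on UNIV (\<lambda>y. \<gamma> (y - (y \<bullet> \<nu>) *\<^sub>R \<nu>))"
      by (rule continuous_on_compose2[OF \<gamma>]) (auto intro!: continuous_intros)
    then have "open ?U"
      by (intro open_Int open_ball open_Collect_less) (auto intro!: continuous_intros)
    moreover have "?U \<inter> \<Omega> = {}"
    proof (rule equals0I)
      fix y assume y: "y \<in> ?U \<inter> \<Omega>"
      then have "y \<in> \<Omega> \<inter> ball x r" by simp
      then show False using y unfolding eq by auto
    qed
    ultimately have "?U \<inter> closure \<Omega> = {}" using open_Int_closure_eq_empty by blast
    then show False using * p by (auto simp: frontier_def)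
  qed
qed

text \<open>Finitely many graph charts cover the compact boundary, and inside a chart the points
  within \<open>h\<close> of the boundary lie in a vertical slab of half-width proportional to
  \<open>h\<close>.\<close>

lemma emeasure_C2_boundary_nbhd:
  fixes \<Omega> :: "'a::euclidean_space set"
  assumes op: "open \<Omega>" and bd: "bounded \<Omega>" and C2: "C2_boundary \<Omega>" and ne: "frontier \<Omega> \<noteq> {}"
  shows "\<exists>C\<ge>0. \<exists>h0>0. \<forall>h. 0 < h \<longrightarrow> h \<le> h0 \<longrightarrow>
     emeasure lborel {x. infdist x (frontier \<Omega>) \<le> h} \<le> ennreal (C * h)"
proof -
  \<comment> \<open>Asking for a measurable superset \<open>A\<close> spares a discussion of the
    measurability of the local neighbourhood.\<close>
  define Q where "Q x r C h0 \<longleftrightarrow> 0 < r \<and> 0 \<le> C \<and> 0 < h0 \<and> (\<forall>h. 0 < h \<longrightarrow> h \<le> h0 \<longrightarrow>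
      (\<exists>A\<in>sets lborel. {y. \<exists>p\<in>frontier \<Omega> \<inter> ball x r. dist y p \<le> h} \<subseteq> A \<and> emeasure lborel A \<le> ennreal (C * h)))" for x and r C h0 :: real
  have "\<exists>r C h0. Q x r C h0"
    if x: "x \<in> frontier \<Omega>" for x
  proof -
    obtain r \<nu> \<gamma> where r: "r > 0" and \<nu>: "norm \<nu> = 1" and Ck: "Ck 2 \<gamma>"
      and eq: "\<Omega> \<inter> ball x r = {y \<in> ball x r. \<gamma> (y - (y \<bullet> \<nu>) *\<^sub>R \<nu>) < y \<bullet> \<nu>}"
      using C2 x unfolding C2_boundary_def by blast
    have Ck': "Ck (Suc (Suc 0)) \<gamma>" using Ck by (simp only: numeral_2_eq_2)
    then have \<gamma>: "continuous_on UNIV \<gamma>"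
      by (auto simp: continuous_on_eq_continuous_within intro!: differentiable_imp_continuous_within)
    define R where "R = 2 * (norm x + r)"
    obtain L where L: "L \<ge> 0" "\<And>y z. y \<in> cball 0 R \<Longrightarrow> z \<in> cball 0 R \<Longrightarrow> \<bar>\<gamma> y - \<gamma> z\<bar> \<le> L * dist y z"
      using Ck_Suc_lipschitz[OF Ck', of 0 R] by blast
    \<comment> \<open>The projection along \<nu> is taken as 2-Lipschitz, which gives
      \<open>2 * L\<close> for the change of \<gamma>; the extra 1 is the change of height
      \<open>y \<bullet> \<nu>\<close>.\<close>
    define l where "l = 2 * L + 1"
    have l: "l \<ge> 1" using L by (simp add: l_def)
    let ?P = "\<lambda>y. y - (y \<bullet> \<nu>) *\<^sub>R \<nu>"
    have P: "norm (?P y) \<le> 2 * norm y" for y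
    proof -
      have "norm (?P y) \<le> norm y + norm ((y \<bullet> \<nu>) *\<^sub>R \<nu>)" by (rule norm_triangle_ineq4)
      also have "norm ((y \<bullet> \<nu>) *\<^sub>R \<nu>) \<le> norm y"
        using Cauchy_Schwarz_ineq2[of y \<nu>] \<nu> by simp
      finally show ?thesis by simp
    qed
    have dP: "dist (?P y) (?P z) \<le> 2 * dist y z" for y z
      using P[of "y - z"] by (simp add: dist_norm algebra_simps inner_diff_left)
    have PR: "?P y \<in> cball 0 R" if "y \<in> ball x r" for y
    proof -
      have "norm y \<le> norm x + r"
        using that norm_triangle_sub[of y x] by (simp add: dist_norm norm_minus_commute)
      then show ?thesis using P[of y] by (simp add: R_def)
    qed
    define C where "C = 6 * l * measure lborel (ball x (r + 1))"
    \<comment> \<open>With \<open>r / 2\<close>, points within \<open>h\<close> of the half-size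
      ball stay in the chart; with \<open>1 / (6 * l)\<close>, the half-width \<open>l * h\<close>
      is admissible for the slab estimate.\<close>
    define h0 where "h0 = min (r / 2) (1 / (6 * l))"
    have C0: "C \<ge> 0" and h0: "h0 > 0" using l r by (auto simp: C_def h0_def)
    have "\<exists>A\<in>sets lborel. {y. \<exists>p\<in>frontier \<Omega> \<inter> ball x (r/2). dist y p \<le> h} \<subseteq> A \<and> emeasure lborel A \<le> ennreal (C * h)"
      if h: "0 < h" "h \<le> h0" for h
    proof -
      let ?A = "{y \<in> ball x r. \<bar>\<gamma> (?P y) - y \<bullet> \<nu>\<bar> \<le> l * h}"
      have [measurable]: "\<gamma> \<in> borel_measurable borel"
        using \<gamma> by (rule borel_measurable_continuous_onI)
      have "l * h \<le> 1 / 6"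
        using h l by (auto simp: h0_def field_simps)
      then have "emeasure lborel ?A \<le> ennreal (6 * (l * h) * measure lborel (ball x (r + 1)))"
        using h l by (intro emeasure_graph_slab_le[OF \<gamma> \<nu>]) auto
      also have "6 * (l * h) * measure lborel (ball x (r + 1)) = C * h"
        by (simp add: C_def)
      finally have "emeasure lborel ?A \<le> ennreal (C * h)" .
      moreover have "{y. \<exists>p\<in>frontier \<Omega> \<inter> ball x (r/2). dist y p \<le> h} \<subseteq> ?A"
      proof clarsimp
        fix y p assume p: "p \<in> frontier \<Omega>" "dist x p * 2 < r" and yp: "dist y p \<le> h"
        have px: "p \<in> ball x r" using p r by auto
        have yx: "y \<in> ball x r"
          using p h dist_triangle2[of x y p] yp by (auto simp: h0_def)
        have "\<bar>\<gamma> (?P y) - \<gamma> (?P p)\<bar> \<le> L * (2 * dist y p)"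
          using L(2)[OF PR[OF yx] PR[OF px]] mult_left_mono[OF dP L(1), of y p] by linarith
        moreover have "\<bar>p \<bullet> \<nu> - y \<bullet> \<nu>\<bar> \<le> dist y p"
          using Cauchy_Schwarz_ineq2[of "p - y" \<nu>] \<nu> by (simp add: inner_diff_left dist_norm norm_minus_commute)
        ultimately have "\<bar>\<gamma> (?P y) - y \<bullet> \<nu>\<bar> \<le> l * dist y p"
          using frontier_subset_graph[OF op \<gamma> eq p(1) px] by (simp add: l_def algebra_simps)
        also have "\<dots> \<le> l * h" using yp l by simp
        finally show "dist x y < r \<and> \<bar>\<gamma> (?P y) - y \<bullet> \<nu>\<bar> \<le> l * h"
          using yx by simp
      qed
      moreover have "?A \<in> sets lborel" unfolding ball_def by measurable
      ultimately show ?thesis by blast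
    qed
    then have "Q x (r / 2) C h0" using C0 h0 r unfolding Q_def by simp
    then show ?thesis by blast
  qed
  then obtain r C h0 where Q: "\<And>x. x \<in> frontier \<Omega> \<Longrightarrow> Q x (r x) (C x) (h0 x)" by metis
  have rC: "\<And>x. x \<in> frontier \<Omega> \<Longrightarrow> r x > 0" "\<And>x. x \<in> frontier \<Omega> \<Longrightarrow> C x \<ge> 0" "\<And>x. x \<in> frontier \<Omega> \<Longrightarrow> h0 x > 0"
    and loc: "\<And>x h. x \<in> frontier \<Omega> \<Longrightarrow> 0 < h \<Longrightarrow> h \<le> h0 x \<Longrightarrow>
      \<exists>A\<in>sets lborel. {y. \<exists>p\<in>frontier \<Omega> \<inter> ball x (r x). dist y p \<le> h} \<subseteq> A \<and> emeasure lborel A \<le> ennreal (C x * h)"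
    using Q unfolding Q_def by blast+
  have "compact (frontier \<Omega>)" using bd by (rule compact_frontier_bounded)
  moreover have "frontier \<Omega> \<subseteq> (\<Union>x\<in>frontier \<Omega>. ball x (r x))"
    using rC(1) by (meson UN_I centre_in_ball subsetI)
  ultimately obtain D where D: "D \<subseteq> frontier \<Omega>" "finite D" "frontier \<Omega> \<subseteq> (\<Union>x\<in>D. ball x (r x))"
    using compactE_image[of "frontier \<Omega>" "frontier \<Omega>" "\<lambda>x. ball x (r x)"] by (metis open_ball)
  have "D \<noteq> {}" using D(3) ne by auto
  show ?thesis
  proof (rule exI[of _ "\<Sum>x\<in>D. C x"], rule conjI[OF _ exI[of _ "Min (h0 ` D)"]]; (intro conjI allI impI)?)
    show "0 \<le> (\<Sum>x\<in>D. C x)" using rC D by (intro sum_nonneg) auto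
    show "0 < Min (h0 ` D)" using rC D \<open>D \<noteq> {}\<close> by (subst Min_gr_iff) auto
    fix h assume h: "0 < h" "h \<le> Min (h0 ` D)"
    define P where "P x A \<longleftrightarrow> A \<in> sets lborel \<and> {y. \<exists>p\<in>frontier \<Omega> \<inter> ball x (r x). dist y p \<le> h} \<subseteq> A
      \<and> emeasure lborel A \<le> ennreal (C x * h)" for x A
    have P: "\<exists>A. P x A" if x: "x \<in> D" for x
    proof -
      have "Min (h0 ` D) \<le> h0 x" using x D(2) by simp
      then have "h \<le> h0 x" using h(2) by linarith
      moreover have "x \<in> frontier \<Omega>" using x D(1) by blast
      ultimately show ?thesis using loc[of x h] h(1) unfolding P_def by blast
    qed
    define A where "A x = (SOME A. P x A)" for x
    have PA: "P x (A x)" if "x \<in> D" for x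
      unfolding A_def using P[OF that] by (rule someI_ex)
    have A: "A x \<in> sets lborel" "{y. \<exists>p\<in>frontier \<Omega> \<inter> ball x (r x). dist y p \<le> h} \<subseteq> A x"
      "emeasure lborel (A x) \<le> ennreal (C x * h)" if "x \<in> D" for x
      using PA[OF that] unfolding P_def by blast+
    have "{x. infdist x (frontier \<Omega>) \<le> h} \<subseteq> (\<Union>x\<in>D. A x)"
    proof clarsimp
      fix y assume y: "infdist y (frontier \<Omega>) \<le> h"
      obtain p where p: "p \<in> frontier \<Omega>" "infdist y (frontier \<Omega>) = dist y p"
        using infdist_attains_inf[OF frontier_closed ne] by blast
      then obtain x where "x \<in> D" "p \<in> ball x (r x)" using D by blast
      moreover from this have "y \<in> {y. \<exists>p\<in>frontier \<Omega> \<inter> ball x (r x). dist y p \<le> h}"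
        using p y by auto
      ultimately show "\<exists>x\<in>D. y \<in> A x" using A(2)[of x] by blast
    qed
    then have "emeasure lborel {x. infdist x (frontier \<Omega>) \<le> h} \<le> emeasure lborel (\<Union>x\<in>D. A x)"
      using A D by (intro emeasure_mono) auto
    also have "\<dots> \<le> (\<Sum>x\<in>D. emeasure lborel (A x))"
      using A D by (intro emeasure_subadditive_finite) auto
    also have "\<dots> \<le> (\<Sum>x\<in>D. ennreal (C x * h))"
      using A by (intro sum_mono) auto
    also have "\<dots> = ennreal ((\<Sum>x\<in>D. C x) * h)"
      using rC D h by (subst sum_ennreal) (auto simp: sum_distrib_right)
    finally show "emeasure lborel {x. infdist x (frontier \<Omega>) \<le> h} \<le> ennreal ((\<Sum>x\<in>D. C x) * h)" .
  qed
qed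

section \<open>Nonlocal operators with a Levy kernel\<close>

lemma integral_lborel_translate:
  fixes f :: "'a::euclidean_space \<Rightarrow> real"
  assumes [measurable]: "f \<in> borel_measurable borel"
  shows "(LINT x|lborel. f x) = (LINT x|lborel. f (c + x))"
proof -
  have "(LINT x|lborel. f x) = (LINT x|distr lborel borel ((+) c). f x)"
    unfolding lborel_distr_plus ..
  also have "\<dots> = (LINT x|lborel. f (c + x))"
    by (rule integral_distr) auto
  finally show ?thesis .
qed

lemma integrable_lborel_translate:
  fixes f :: "'a::euclidean_space \<Rightarrow> real"
  assumes f: "integrable lborel f"
  shows "integrable lborel (\<lambda>x. f (c + x))"
proof -
  have [measurable]: "f \<in> borel_measurable borel" using f by auto
  have "integrable (distr lborel borel ((+) c)) f"
    using f unfolding lborel_distr_plus .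
  then show "integrable lborel (\<lambda>x. f (c + x))"
    by (subst (asm) integrable_distr_eq) auto
qed

lemma (in pair_sigma_finite) integrable_pair_product:
  fixes f :: "'a \<Rightarrow> real" and g :: "'b \<Rightarrow> real"
  assumes f: "integrable M1 f" and g: "integrable M2 g"
  shows "integrable (M1 \<Otimes>\<^sub>M M2) (\<lambda>(x, y). f x * g y)"
proof (rule Fubini_integrable)
  have [measurable]: "f \<in> borel_measurable M1" "g \<in> borel_measurable M2" using f g by auto
  show "(\<lambda>(x, y). f x * g y) \<in> borel_measurable (M1 \<Otimes>\<^sub>M M2)" by measurable
  show "integrable M1 (\<lambda>x. LINT y|M2. norm (case (x, y) of (x, y) \<Rightarrow> f x * g y))"
    using f by (simp add: abs_mult)
  show "AE x in M1. integrable M2 (\<lambda>y. case (x, y) of (x, y) \<Rightarrow> f x * g y)"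
    using g by simp
qed

section \<open>Integrals of the bump function\<close>

lemma borel_measurable_expinv [measurable]: "expinv n \<in> borel_measurable borel"
proof (rule borel_measurable_continuous_onI)
  show "continuous_on UNIV (expinv n)"
    using DERIV_isCont[OF expinv_has_derivative] by (simp add: continuous_at_imp_continuous_on)
qed

lemma borel_measurable_bump [measurable]:
  assumes [measurable]: "f \<in> borel_measurable M" "g \<in> borel_measurable M"
  shows "(\<lambda>p. bump (f p) r (g p)) \<in> borel_measurable M"
  unfolding bump_def by measurable

definition bmass :: "'a::euclidean_space itself \<Rightarrow> real \<Rightarrow> real" where
  "bmass _ h = (LINT y|lborel. bump (0::'a) h y)"

lemma integrable_bump: "0 < h \<Longrightarrow> integrable lborel (bump (c::'a::euclidean_space) h)"
proof (rule Bochner_Integration.integrable_bound)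
  assume h: "0 < h"
  show "integrable lborel (indicator (ball c h) :: 'a \<Rightarrow> real)"
    using emeasure_lborel_ball_finite[of c h] by (intro integrable_real_indicator) auto
  have "norm (bump c h x) \<le> norm (indicator (ball c h) x :: real)" for x
    using bump_le_1[of c h x] bump_nonneg[of c h x] bump_eq_0[OF h, of x c]
    by (auto simp: indicator_def dist_commute not_less)
  then show "AE x in lborel. norm (bump c h x) \<le> norm (indicator (ball c h) x :: real)" by simp
qed measurable

lemma integral_bump:
  fixes c :: "'a::euclidean_space"
  assumes h: "0 < h"
  shows "(LINT y|lborel. bump c h y) = bmass TYPE('a) h"
proof -
  have "(LINT y|lborel. bump c h y) = (LINT y|lborel. bump c h (c + y))"
    by (rule integral_lborel_translate) measurable
  also have "(\<lambda>y. bump c h (c + y)) = bump 0 h"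
    using bump_translate[of c h _ c] by (auto simp: add.commute)
  finally show ?thesis by (simp add: bmass_def)
qed

lemma bmass_pos:
  assumes h: "0 < h"
  shows "0 < bmass TYPE('a::euclidean_space) h"
proof -
  have "0 \<le> bmass TYPE('a) h" unfolding bmass_def by (intro Bochner_Integration.integral_nonneg) (simp add: bump_nonneg)
  moreover have "bmass TYPE('a) h \<noteq> 0"
  proof
    assume "bmass TYPE('a) h = 0"
    then have "AE y in lborel. bump (0::'a) h y = 0"
      unfolding bmass_def using integral_nonneg_eq_0_iff_AE[OF integrable_bump[OF h, of "0::'a"]]
      by (simp add: bump_nonneg)
    then have "AE y in lborel. y \<notin> ball (0::'a) h"
    proof eventually_elim
      fix y :: 'a assume "bump 0 h y = 0"
      then show "y \<notin> ball 0 h" using bump_pos_iff[OF h, of "0::'a" y] by (auto simp: dist_commute)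
    qed
    then have "emeasure lborel (ball (0::'a) h) = 0"
      by (subst (asm) AE_iff_measurable[of "ball 0 h"]) auto
    moreover have "emeasure lborel (ball (0::'a) h) \<noteq> 0"
      using h content_ball_pos[of h "0::'a"] by (metis enn2real_0 less_irrefl measure_def)
    ultimately show False by simp
  qed
  ultimately show ?thesis by linarith
qed

text \<open>One constant for bounded oscillation and Lipschitz continuity. It makes
  \<open>\<phi> x - \<phi> (x + z)\<close> integrable against a Levy kernel both near the origin and
  at infinity, uniformly in \<open>x\<close>.\<close>

definition minlip :: "real \<Rightarrow> ('a::euclidean_space \<Rightarrow> real) \<Rightarrow> bool" where
  "minlip D \<phi> \<longleftrightarrow> 0 \<le> D \<and> (\<forall>x y. \<bar>\<phi> x - \<phi> y\<bar> \<le> D * min 1 (dist x y))"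

lemma minlip_nonneg: "minlip D \<phi> \<Longrightarrow> 0 \<le> D"
  by (simp add: minlip_def)

lemma minlipD: "minlip D \<phi> \<Longrightarrow> \<bar>\<phi> x - \<phi> y\<bar> \<le> D * min 1 (dist x y)"
  by (simp add: minlip_def)

lemma minlip_bounded:
  assumes "minlip D \<phi>"
  shows "\<bar>\<phi> x\<bar> \<le> \<bar>\<phi> 0\<bar> + D"
proof -
  have "D * min 1 (dist x 0) \<le> D * 1" using minlip_nonneg[OF assms] by (intro mult_left_mono) auto
  then show ?thesis using minlipD[OF assms, of x 0] by linarith
qed

lemma minlip_negative_part:
  assumes "minlip D \<phi>"
  shows "minlip D (\<lambda>x. max 0 (- \<phi> x))"
  unfolding minlip_def
proof (intro conjI allI)
  show "\<bar>max 0 (- \<phi> x) - max 0 (- \<phi> y)\<bar> \<le> D * min 1 (dist x y)" for x y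
    using minlipD[OF assms, of x y] by linarith
qed (rule minlip_nonneg[OF assms])

lemma minlip_shift:
  assumes "minlip D \<phi>"
  shows "\<bar>\<phi> x - \<phi> (x + z)\<bar> \<le> D * min 1 (norm z)" "\<bar>\<phi> x - \<phi> (x - z)\<bar> \<le> D * min 1 (norm z)"
  using minlipD[OF assms, of x "x + z"] minlipD[OF assms, of x "x - z"] by (simp_all add: dist_norm)

lemma minlip_measurable:
  fixes \<phi> :: "'a::euclidean_space \<Rightarrow> real"
  assumes "minlip D \<phi>"
  shows "\<phi> \<in> borel_measurable borel"
proof (rule borel_measurable_continuous_onI)
  have "D-lipschitz_on UNIV \<phi>"
  proof (rule lipschitz_onI)
    fix x y :: 'a
    have "D * min 1 (dist x y) \<le> D * dist x y"
      using minlip_nonneg[OF assms] by (intro mult_left_mono) auto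
    then show "dist (\<phi> x) (\<phi> y) \<le> D * dist x y"
      using minlipD[OF assms, of x y] by (simp add: dist_real_def)
  qed (rule minlip_nonneg[OF assms])
  then show "continuous_on UNIV \<phi>" by (rule lipschitz_on_continuous_on)
qed

lemma minlip_bump: "0 < r \<Longrightarrow> \<exists>D. minlip D (bump c r)"
  using bump_lipschitz[of r c] by (auto simp: minlip_def)

lemma integrable_mult_minlip:
  assumes a: "integrable lborel a" and b: "minlip D b"
  shows "integrable lborel (\<lambda>x. a x * b x)"
proof (rule Bochner_Integration.integrable_bound)
  show "integrable lborel (\<lambda>x. (\<bar>b 0\<bar> + D) * a x)" using a by simp
  have [measurable]: "b \<in> borel_measurable borel" by (rule minlip_measurable[OF b])
  have [measurable]: "a \<in> borel_measurable borel" using a by auto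
  show "(\<lambda>x. a x * b x) \<in> borel_measurable lborel" by measurable
  have "\<bar>b x\<bar> \<le> \<bar>b 0\<bar> + D" for x by (rule minlip_bounded[OF b])
  then have "\<bar>a x\<bar> * \<bar>b x\<bar> \<le> \<bar>a x\<bar> * (\<bar>\<bar>b 0\<bar> + D\<bar>)" for x
    by (intro mult_left_mono) (auto intro: order_trans[OF _ abs_ge_self])
  then show "AE x in lborel. norm (a x * b x) \<le> norm ((\<bar>b 0\<bar> + D) * a x)"
    by (auto simp: abs_mult mult.commute)
qed

text \<open>The case \<open>h = 1\<close> already gives absolute convergence on
  \<open>minlip\<close> functions. The power \<open>h powr - \<beta>\<close> is the price of a
  cutoff that varies on scale \<open>h\<close>; \<beta> < 1 means that a boundary layer of volume
  O(h) can afford it.\<close>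

locale levy_kernel =
  fixes K :: "'a::euclidean_space measure" and C \<beta> :: real
  assumes sets_K [measurable_cong]: "sets K = sets borel"
    and sigma_finite_K: "sigma_finite_measure K"
    and C_nonneg: "0 \<le> C"
    and \<beta>_less_1: "\<beta> < 1"
    and nn_integral_K: "\<And>h. 0 < h \<Longrightarrow> (\<integral>\<^sup>+z. ennreal (min 1 (norm z / h)) \<partial>K) \<le> ennreal (C * h powr - \<beta>)"
begin

sublocale K: sigma_finite_measure K by (rule sigma_finite_K)

sublocale lK: pair_sigma_finite lborel K ..

definition gen :: "('a \<Rightarrow> real) \<Rightarrow> 'a \<Rightarrow> real" where
  "gen \<phi> x = (LINT z|K. \<phi> x - \<phi> (x + z))"

text \<open>The operator of the reflected kernel, which is the formal adjoint of \<open>gen\<close>.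
  Keeping both apart avoids any symmetry argument for \<open>K\<close>.\<close>

definition gen_adj :: "('a \<Rightarrow> real) \<Rightarrow> 'a \<Rightarrow> real" where
  "gen_adj \<phi> x = (LINT z|K. \<phi> x - \<phi> (x - z))"

lemma integrable_min:
  assumes "0 < h"
  shows "integrable K (\<lambda>z. min 1 (norm z / h))" "(LINT z|K. min 1 (norm z / h)) \<le> C * h powr - \<beta>"
proof -
  show *: "integrable K (\<lambda>z. min 1 (norm z / h))"
    using nn_integral_K[OF assms] assms
    by (intro integrableI_nonneg) (auto intro: le_less_trans)
  have "ennreal (LINT z|K. min 1 (norm z / h)) \<le> ennreal (C * h powr - \<beta>)"
    using nn_integral_eq_integral[OF *] nn_integral_K[OF assms] assms by simp
  then show "(LINT z|K. min 1 (norm z / h)) \<le> C * h powr - \<beta>"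
    by (subst (asm) ennreal_le_iff) (use C_nonneg in auto)
qed

lemma integrable_min1: "integrable K (\<lambda>z. min 1 (norm z))"
  using integrable_min(1)[of 1] by simp

lemma integrable_diff:
  assumes "minlip D \<phi>"
  shows "integrable K (\<lambda>z. \<phi> x - \<phi> (x + z))" "integrable K (\<lambda>z. \<phi> x - \<phi> (x - z))"
proof -
  have [measurable]: "\<phi> \<in> borel_measurable borel" by (rule minlip_measurable[OF assms])
  have i: "integrable K (\<lambda>z. D * min 1 (norm z))"
    using integrable_min1 by simp
  show "integrable K (\<lambda>z. \<phi> x - \<phi> (x + z))"
    by (rule Bochner_Integration.integrable_bound[OF i])
      (use minlip_shift[OF assms, of x] minlip_nonneg[OF assms] in auto)
  show "integrable K (\<lambda>z. \<phi> x - \<phi> (x - z))"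
    by (rule Bochner_Integration.integrable_bound[OF i])
      (use minlip_shift[OF assms, of x] minlip_nonneg[OF assms] in auto)
qed

text \<open>For a function that varies by at most 1 and on scale \<open>h\<close>, the integrand is
  dominated by the very quantity that the locale bounds. Applied to \<open>cutoff\<close>, this is
  the error term of the maximum principle.\<close>

lemma gen_abs_le:
  assumes "\<And>x y. \<bar>\<phi> x - \<phi> y\<bar> \<le> min 1 (dist x y / h)" "0 < h" "minlip D \<phi>"
  shows "\<bar>gen \<phi> x\<bar> \<le> C * h powr - \<beta>"
proof -
  have "norm (gen \<phi> x) \<le> (LINT z|K. min 1 (norm z / h))"
    unfolding gen_def
  proof (intro Bochner_Integration.integral_norm_bound_integral integrable_min integrable_diff[OF assms(3)] assms(2))
    show "norm (\<phi> x - \<phi> (x + z)) \<le> min 1 (norm z / h)" for z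
      using assms(1)[of x "x + z"] by (simp add: dist_norm)
  qed
  then show ?thesis using integrable_min(2)[OF assms(2)] by simp
qed

lemma gen_measurable [measurable]:
  assumes "minlip D \<phi>"
  shows "gen \<phi> \<in> borel_measurable borel" "gen_adj \<phi> \<in> borel_measurable borel"
proof -
  have [measurable]: "\<phi> \<in> borel_measurable borel" by (rule minlip_measurable[OF assms])
  show "gen \<phi> \<in> borel_measurable borel" "gen_adj \<phi> \<in> borel_measurable borel"
    unfolding gen_def[abs_def] gen_adj_def[abs_def] by measurable
qed

text \<open>Domination by the product of \<open>\<bar>v x\<bar>\<close> and
  \<open>D * min 1 (norm z)\<close> licenses Fubini even for \<open>v\<close> that is merely
  integrable.\<close>

lemma integrable_pair:
  assumes v: "integrable lborel v" and \<phi>: "minlip D \<phi>"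
  shows "integrable (lborel \<Otimes>\<^sub>M K) (\<lambda>(x, z). v x * (\<phi> x - \<phi> (x + z)))"
    "integrable (lborel \<Otimes>\<^sub>M K) (\<lambda>(x, z). v x * (\<phi> x - \<phi> (x - z)))"
proof -
  have [measurable]: "\<phi> \<in> borel_measurable borel" by (rule minlip_measurable[OF \<phi>])
  have [measurable]: "v \<in> borel_measurable borel" using v by auto
  have i: "integrable (lborel \<Otimes>\<^sub>M K) (\<lambda>(x, z). v x * (D * min 1 (norm z)))"
    using v integrable_min1 by (intro lK.integrable_pair_product) auto
  have le: "\<bar>v x\<bar> * \<bar>\<phi> x - \<phi> (x + z)\<bar> \<le> \<bar>v x\<bar> * (\<bar>D\<bar> * \<bar>min 1 (norm z)\<bar>)"
    "\<bar>v x\<bar> * \<bar>\<phi> x - \<phi> (x - z)\<bar> \<le> \<bar>v x\<bar> * (\<bar>D\<bar> * \<bar>min 1 (norm z)\<bar>)" for x z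
    using minlip_shift[OF \<phi>, of x z] minlip_nonneg[OF \<phi>] by (auto intro!: mult_left_mono)
  show "integrable (lborel \<Otimes>\<^sub>M K) (\<lambda>(x, z). v x * (\<phi> x - \<phi> (x + z)))"
    by (rule Bochner_Integration.integrable_bound[OF i])
      (use le in \<open>auto simp: abs_mult split_beta intro!: AE_I2\<close>)
  show "integrable (lborel \<Otimes>\<^sub>M K) (\<lambda>(x, z). v x * (\<phi> x - \<phi> (x - z)))"
    by (rule Bochner_Integration.integrable_bound[OF i])
      (use le in \<open>auto simp: abs_mult split_beta intro!: AE_I2\<close>)
qed

lemma integral_gen_swap:
  assumes v: "integrable lborel v" and \<phi>: "minlip D \<phi>"
  shows "(LINT x|lborel. v x * gen \<phi> x) = (LINT z|K. LINT x|lborel. v x * (\<phi> x - \<phi> (x + z)))"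
    "(LINT x|lborel. v x * gen_adj \<phi> x) = (LINT z|K. LINT x|lborel. v x * (\<phi> x - \<phi> (x - z)))"
  unfolding gen_def gen_adj_def
  using lK.Fubini_integral[OF integrable_pair(1)[OF assms]] lK.Fubini_integral[OF integrable_pair(2)[OF assms]]
  by simp_all

lemma integrable_mult_gen:
  assumes v: "integrable lborel v" and \<phi>: "minlip D \<phi>"
  shows "integrable lborel (\<lambda>x. v x * gen \<phi> x)" "integrable lborel (\<lambda>x. v x * gen_adj \<phi> x)"
  unfolding gen_def gen_adj_def
  using lK.integrable_fst'[OF integrable_pair(1)[OF assms]] lK.integrable_fst'[OF integrable_pair(2)[OF assms]]
  by simp_all

text \<open>For a fixed jump \<open>z\<close> this is translation invariance of Lebesgue measure;
  Fubini integrates it over \<open>z\<close>. Both functions are integrable and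
  \<open>minlip\<close> so that each side can be exchanged.\<close>

lemma gen_adjoint:
  assumes a: "integrable lborel a" "minlip D a" and b: "integrable lborel b" "minlip D' b"
  shows "(LINT x|lborel. a x * gen b x) = (LINT x|lborel. b x * gen_adj a x)"
proof -
  have "(LINT x|lborel. a x * (b x - b (x + z))) = (LINT x|lborel. b x * (a x - a (x - z)))" for z
  proof -
    have b': "minlip D' (\<lambda>x. b (x + z))"
      using b(2) by (auto simp: minlip_def)
        (metis add_diff_cancel_right' dist_diff(2) dist_add_cancel2)
    have i1: "integrable lborel (\<lambda>x. a x * b x)" "integrable lborel (\<lambda>x. a x * b (x + z))"
      using integrable_mult_minlip[OF a(1)] b(2) b' by auto
    have t: "(LINT x|lborel. a (- z + x) * b (- z + x + z)) = (LINT x|lborel. a x * b (x + z))"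
      "integrable lborel (\<lambda>x. a (- z + x) * b (- z + x + z))"
      using integral_lborel_translate[of "\<lambda>x. a x * b (x + z)" "- z"] i1(2)
        integrable_lborel_translate[OF i1(2), of "- z"] by auto
    then have t': "(LINT x|lborel. b x * a (x - z)) = (LINT x|lborel. a x * b (x + z))"
      "integrable lborel (\<lambda>x. b x * a (x - z))" by (simp_all add: mult.commute)
    show ?thesis
      using i1 t' by (simp add: right_diff_distrib mult.commute[of "b _"])
  qed
  then show ?thesis
    using integral_gen_swap(1)[OF a(1) b(2)] integral_gen_swap(2)[OF b(1) a(2)] by simp
qed

end

section \<open>Distances to the complement and to the boundary; cutoffs\<close>

lemma infdist_complement_eq_frontier:
  fixes \<Omega> :: "'a::euclidean_space set"
  assumes "open \<Omega>" "frontier \<Omega> \<noteq> {}" "x \<in> \<Omega>"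
  shows "infdist x (- \<Omega>) = infdist x (frontier \<Omega>)"
proof (rule antisym)
  have sub: "frontier \<Omega> \<subseteq> - \<Omega>"
    using assms(1) by (auto simp: frontier_def interior_open)
  show "infdist x (- \<Omega>) \<le> infdist x (frontier \<Omega>)"
    using sub assms(2) by (rule infdist_mono)
  have "- \<Omega> \<noteq> {}" using sub assms(2) by auto
  moreover have "closed (- \<Omega>)" using assms(1) by auto
  ultimately obtain p where p: "p \<in> - \<Omega>" "infdist x (- \<Omega>) = dist x p"
    using infdist_attains_inf by blast
  have "closed_segment x p \<inter> frontier \<Omega> \<noteq> {}"
    using p(1) assms(3) by (intro connected_Int_frontier) auto
  then obtain q where q: "q \<in> closed_segment x p" "q \<in> frontier \<Omega>" by auto
  have "infdist x (frontier \<Omega>) \<le> dist x q" using q(2) by (rule infdist_le)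
  also have "\<dots> \<le> dist x p" using q(1) dist_in_closed_segment(1)[OF q(1)] by (simp add: dist_commute)
  finally show "infdist x (frontier \<Omega>) \<le> infdist x (- \<Omega>)" using p(2) by simp
qed

lemma borel_measurable_infdist [measurable]: "(\<lambda>x. infdist x A) \<in> borel_measurable borel"
  by (intro borel_measurable_continuous_onI continuous_intros)

lemma cball_subset_of_infdist_complement:
  assumes "h < infdist x (- \<Omega>)"
  shows "cball x h \<subseteq> \<Omega>"
proof
  fix y assume "y \<in> cball x h"
  then have "dist x y < infdist x (- \<Omega>)" using assms by simp
  then show "y \<in> \<Omega>" using infdist_le[of y "- \<Omega>" x] by fastforce
qed

lemma cball_disjoint_of_infdist_frontier:
  fixes \<Omega> :: "'a::euclidean_space set"
  assumes "h < infdist x (frontier \<Omega>)" "0 \<le> h" "x \<notin> \<Omega>"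
  shows "cball x h \<inter> \<Omega> = {}"
proof (rule ccontr)
  assume "\<not> ?thesis"
  then have "cball x h \<inter> frontier \<Omega> \<noteq> {}"
    using assms centre_in_cball[of x h] by (intro connected_Int_frontier convex_connected) blast+
  then obtain q where "dist x q \<le> h" "q \<in> frontier \<Omega>" by auto
  then show False using infdist_le[of q "frontier \<Omega>" x] assms(1) by linarith
qed

lemma minlip_intro:
  assumes "0 \<le> A" "0 \<le> B" "\<And>x y. \<bar>\<phi> x - \<phi> y\<bar> \<le> A" "\<And>x y. \<bar>\<phi> x - \<phi> y\<bar> \<le> B * dist x y"
  shows "minlip (A + B) \<phi>"
  unfolding minlip_def
proof (intro conjI allI)
  fix x y :: 'a
  show "\<bar>\<phi> x - \<phi> y\<bar> \<le> (A + B) * min 1 (dist x y)"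
  proof (cases "dist x y \<le> 1")
    case True
    have "B * dist x y \<le> (A + B) * dist x y" using assms(1) by (intro mult_right_mono) auto
    then show ?thesis using assms(4)[of x y] True by simp
  next
    case False
    then show ?thesis using assms(2) assms(3)[of x y] by simp
  qed
qed (use assms in simp)

text \<open>Zero up to distance \<open>h\<close> from \<open>A\<close>, one from distance
  \<open>2 * h\<close> on. The dead zone leaves room for a mollifier of radius \<open>h\<close>
  wherever the cutoff is nonzero.\<close>

definition cutoff :: "'a::euclidean_space set \<Rightarrow> real \<Rightarrow> 'a \<Rightarrow> real" where
  "cutoff A h x = min 1 (max 0 (infdist x A / h - 1))"

lemma cutoff_range: "0 \<le> cutoff A h x" "cutoff A h x \<le> 1"
  by (auto simp: cutoff_def)

lemma cutoff_lipschitz: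
  assumes "0 < h"
  shows "\<bar>cutoff A h x - cutoff A h y\<bar> \<le> min 1 (dist x y / h)"
proof -
  have "\<bar>infdist x A / h - infdist y A / h\<bar> \<le> dist x y / h"
    using infdist_triangle_abs[of x A y] assms by (simp add: divide_right_mono flip: diff_divide_distrib)
  then have "\<bar>cutoff A h x - cutoff A h y\<bar> \<le> dist x y / h"
    unfolding cutoff_def by linarith
  moreover have "\<bar>cutoff A h x - cutoff A h y\<bar> \<le> 1"
    using cutoff_range[of A h x] cutoff_range[of A h y] by linarith
  ultimately show ?thesis by simp
qed

lemma minlip_cutoff: "0 < h \<Longrightarrow> minlip (1 + 1 / h) (cutoff A h)"
  using cutoff_lipschitz[of h A] by (intro minlip_intro) auto

lemma cutoff_pos: "0 < h \<Longrightarrow> 0 < cutoff A h x \<Longrightarrow> h < infdist x A"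
  by (auto simp: cutoff_def less_max_iff_disj field_simps)

lemma cutoff_eq_1_iff: "0 < h \<Longrightarrow> cutoff A h x = 1 \<longleftrightarrow> 2 * h \<le> infdist x A"
  by (auto simp: cutoff_def field_simps min_def max_def)

text \<open>The kernel is the bump centred at \<open>x\<close>, so that up to the mass the value at
  \<open>c\<close> is the pairing of \<open>v\<close> with the test function
  \<open>bump c h\<close>.\<close>

definition mollify :: "real \<Rightarrow> ('a::euclidean_space \<Rightarrow> real) \<Rightarrow> 'a \<Rightarrow> real" where
  "mollify h v x = (LINT y|lborel. v y * bump x h y) / bmass TYPE('a) h"

lemma integrable_mult_bump:
  assumes v: "integrable lborel v"
  shows "integrable lborel (\<lambda>y. v y * bump x h y)"
proof (rule Bochner_Integration.integrable_bound[OF v])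
  have [measurable]: "v \<in> borel_measurable borel" using v by auto
  show "(\<lambda>y. v y * bump x h y) \<in> borel_measurable lborel" by measurable
  have "\<bar>v y\<bar> * bump x h y \<le> \<bar>v y\<bar> * 1" for y
    using bump_le_1 by (intro mult_left_mono) auto
  then show "AE y in lborel. norm (v y * bump x h y) \<le> norm (v y)"
    by (simp add: abs_mult bump_nonneg)
qed

lemma integrable_mollify_pair:
  fixes v :: "'a::euclidean_space \<Rightarrow> real"
  assumes v: "integrable lborel v" and h: "0 < h"
  shows "integrable (lborel \<Otimes>\<^sub>M lborel) (\<lambda>(y, x). v y * bump x h y)"
proof (rule lborel_pair.Fubini_integrable)
  have [measurable]: "v \<in> borel_measurable borel" using v by auto
  show "(\<lambda>(y, x). v y * bump x h y) \<in> borel_measurable (lborel \<Otimes>\<^sub>M lborel)" by measurable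
  have "(LINT x|lborel. norm (v y * bump x h y)) = bmass TYPE('a) h * \<bar>v y\<bar>" for y
    using integral_bump[OF h, of y] by (simp add: abs_mult bump_nonneg bump_commute[of _ _ y])
  then show "integrable lborel (\<lambda>y. LINT x|lborel. norm (case (y, x) of (y, x) \<Rightarrow> v y * bump x h y))"
    using v by simp
  show "AE y in lborel. integrable lborel (\<lambda>x. case (y, x) of (y, x) \<Rightarrow> v y * bump x h y)"
  proof (intro AE_I2)
    fix y :: 'a
    have "integrable lborel (\<lambda>x. bump x h y)"
      using integrable_bump[OF h, of y] by (subst bump_commute)
    then show "integrable lborel (\<lambda>x. case (y, x) of (y, x) \<Rightarrow> v y * bump x h y)"
by simp
  qed
qed

lemma integrable_mollify:
  assumes v: "integrable lborel v" and h: "0 < h"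
  shows "integrable lborel (mollify h v)"
  unfolding mollify_def[abs_def]
  using lborel_pair.integrable_snd[of "\<lambda>y x. v y * bump x h y"] integrable_mollify_pair[OF assms]
  by simp

lemma minlip_mollify:
  fixes v :: "'a::euclidean_space \<Rightarrow> real"
  assumes v: "integrable lborel v" and h: "0 < h"
  shows "\<exists>D. minlip D (mollify h v)"
proof -
  let ?m = "bmass TYPE('a) h"
  have m: "?m > 0" by (rule bmass_pos[OF h])
  obtain D where D: "minlip D (bump (0::'a) h)" using minlip_bump[OF h] by blast
  have b: "\<bar>bump x h y - bump x' h y\<bar> \<le> D * min 1 (dist x x')" for x x' y :: 'a
  proof -
    have "bump x h y = bump 0 h (x - y)" for x
      by (simp add: bump_def norm_minus_commute)
    then show ?thesis using minlipD[OF D, of "x - y" "x' - y"] by (simp add: dist_norm)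
  qed
  define A where "A = (LINT y|lborel. \<bar>v y\<bar>) * D / ?m"
  have "0 \<le> A" using m minlip_nonneg[OF D] by (auto simp: A_def)
  moreover have "\<bar>mollify h v x - mollify h v x'\<bar> \<le> A * min 1 (dist x x')" for x x'
  proof -
    have "\<bar>LINT y|lborel. v y * bump x h y - v y * bump x' h y\<bar> \<le> (LINT y|lborel. \<bar>v y\<bar> * (D * min 1 (dist x x')))"
    proof (rule integral_abs_bound_integral)
      show "integrable lborel (\<lambda>y. v y * bump x h y - v y * bump x' h y)"
        using integrable_mult_bump[OF v] by auto
      show "integrable lborel (\<lambda>y. \<bar>v y\<bar> * (D * min 1 (dist x x')))" using v by auto
      fix y
      have "\<bar>v y\<bar> * \<bar>bump x h y - bump x' h y\<bar> \<le> \<bar>v y\<bar> * (D * min 1 (dist x x'))"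
        using b by (intro mult_left_mono) auto
      then show "\<bar>v y * bump x h y - v y * bump x' h y\<bar> \<le> \<bar>v y\<bar> * (D * min 1 (dist x x'))"
        by (simp add: abs_mult flip: right_diff_distrib)
    qed
    moreover have "mollify h v x - mollify h v x' = (LINT y|lborel. v y * bump x h y - v y * bump x' h y) / ?m"
      using integrable_mult_bump[OF v] by (simp add: mollify_def diff_divide_distrib)
    ultimately show ?thesis using m by (simp add: A_def abs_divide divide_simps mult_ac)
  qed
  ultimately show ?thesis unfolding minlip_def by blast
qed

lemma mollify_lower_bound:
  fixes v :: "'a::euclidean_space \<Rightarrow> real"
  assumes v: "integrable lborel v" and h: "0 < h"
    and B: "AE y in lborel. y \<in> cball x h \<longrightarrow> - B \<le> v y"
  shows "- B \<le> mollify h v x"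
proof -
  have "(LINT y|lborel. - B * bump x h y) \<le> (LINT y|lborel. v y * bump x h y)"
  proof (rule integral_mono_AE)
    show "AE y in lborel. - B * bump x h y \<le> v y * bump x h y"
      using B
    proof eventually_elim
      fix y assume *: "y \<in> cball x h \<longrightarrow> - B \<le> v y"
      show "- B * bump x h y \<le> v y * bump x h y"
      proof (cases "y \<in> cball x h")
        case True
        then show ?thesis using * bump_nonneg[of x h y] by (intro mult_right_mono) auto
      next
        case False
        then show ?thesis using bump_eq_0[OF h, of y x] by (simp add: dist_commute)
      qed
    qed
  qed (use integrable_mult_bump[OF v] integrable_bump[OF h] in auto)
  then have "- B * bmass TYPE('a) h \<le> (LINT y|lborel. v y * bump x h y)"
    using integral_bump[OF h, of x] by simp
  then show ?thesis
    using bmass_pos[OF h, where 'a = 'a] by (simp add: mollify_def pos_le_divide_eq)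
qed

text \<open>Fubini moves the mollification onto the Lipschitz factor, whose values it displaces by
  at most \<open>D * h\<close>. So no regularity of \<open>v\<close> is involved.\<close>

lemma integral_mollify_mult:
  fixes v \<zeta> :: "'a::euclidean_space \<Rightarrow> real"
  assumes v: "integrable lborel v" and h: "0 < h" and \<zeta>: "minlip D \<zeta>"
  shows "\<bar>(LINT x|lborel. mollify h v x * \<zeta> x) - (LINT x|lborel. v x * \<zeta> x)\<bar> \<le> (LINT x|lborel. \<bar>v x\<bar>) * (D * h)"
proof -
  let ?m = "bmass TYPE('a) h"
  have m: "?m > 0" by (rule bmass_pos[OF h])
  have [measurable]: "v \<in> borel_measurable borel" using v by auto
  have [measurable]: "\<zeta> \<in> borel_measurable borel" by (rule minlip_measurable[OF \<zeta>])
  have \<zeta>b: "\<bar>\<zeta> x\<bar> \<le> \<bar>\<zeta> 0\<bar> + D" for x by (rule minlip_bounded[OF \<zeta>])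
  have int: "integrable (lborel \<Otimes>\<^sub>M lborel) (\<lambda>(y, x). v y * bump x h y * \<zeta> x)"
  proof (rule Bochner_Integration.integrable_bound)
    show "integrable (lborel \<Otimes>\<^sub>M lborel) (\<lambda>p. (\<bar>\<zeta> 0\<bar> + D) * (case p of (y, x) \<Rightarrow> v y * bump x h y))"
      using integrable_mollify_pair[OF v h] by (rule integrable_mult_right)
    show "(\<lambda>(y, x). v y * bump x h y * \<zeta> x) \<in> borel_measurable (lborel \<Otimes>\<^sub>M lborel)" by measurable
    have "\<bar>v y * bump x h y\<bar> * \<bar>\<zeta> x\<bar> \<le> \<bar>v y * bump x h y\<bar> * (\<bar>\<zeta> 0\<bar> + D)" for x y
      using \<zeta>b by (intro mult_left_mono) auto
    moreover have "\<bar>\<bar>\<zeta> 0\<bar> + D\<bar> = \<bar>\<zeta> 0\<bar> + D" using minlip_nonneg[OF \<zeta>] by auto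
    ultimately show "AE p in lborel \<Otimes>\<^sub>M lborel. norm (case p of (y, x) \<Rightarrow> v y * bump x h y * \<zeta> x)
        \<le> norm ((\<bar>\<zeta> 0\<bar> + D) * (case p of (y, x) \<Rightarrow> v y * bump x h y))"
      by (auto simp: abs_mult mult_ac)
  qed
  have ib: "integrable lborel (\<lambda>x. bump x h y * \<zeta> x)" for y
    using integrable_mult_minlip[OF integrable_bump[OF h] \<zeta>, of y] by (simp add: bump_commute[of _ _ y])
  \<comment> \<open>\<open>k\<close> is the mollified \<zeta>; the symmetry of the bump in its
    centre and argument makes the transfer possible.\<close>
  define k where "k y = (LINT x|lborel. bump x h y * \<zeta> x) / ?m" for y
  have kz: "\<bar>k y - \<zeta> y\<bar> \<le> D * h" for y
  proof -
    have "k y - \<zeta> y = (LINT x|lborel. bump y h x * (\<zeta> x - \<zeta> y)) / ?m"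
      using ib[of y] integrable_bump[OF h, of y] integral_bump[OF h, of y] m
      by (simp add: k_def right_diff_distrib bump_commute[of _ _ y] diff_divide_distrib)
    moreover have "\<bar>LINT x|lborel. bump y h x * (\<zeta> x - \<zeta> y)\<bar> \<le> (LINT x|lborel. bump y h x * (D * h))"
    proof (rule integral_abs_bound_integral)
      show "integrable lborel (\<lambda>x. bump y h x * (\<zeta> x - \<zeta> y))"
        using ib[of y] integrable_bump[OF h, of y] by (simp add: right_diff_distrib bump_commute[of _ _ y])
      show "integrable lborel (\<lambda>x. bump y h x * (D * h))" using integrable_bump[OF h, of y] by auto
      fix x
      show "\<bar>bump y h x * (\<zeta> x - \<zeta> y)\<bar> \<le> bump y h x * (D * h)"
      proof (cases "dist x y < h")
        case True
        have "\<bar>\<zeta> x - \<zeta> y\<bar> \<le> D * min 1 (dist x y)" by (rule minlipD[OF \<zeta>])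
        also have "\<dots> \<le> D * h" using True minlip_nonneg[OF \<zeta>] by (intro mult_left_mono) auto
        finally show ?thesis using bump_nonneg[of y h x] by (simp add: abs_mult mult_left_mono)
      qed (use bump_eq_0[OF h, of x y] in simp)
    qed
    ultimately have "\<bar>k y - \<zeta> y\<bar> * ?m \<le> (D * h) * ?m"
      using m integral_bump[OF h, of y] by (simp add: abs_divide mult_ac)
    then show ?thesis using m by simp
  qed
  have "(LINT x|lborel. mollify h v x * \<zeta> x) = (LINT x|lborel. LINT y|lborel. v y * bump x h y * \<zeta> x) / ?m"
    by (simp add: mollify_def)
  also have "\<dots> = (LINT y|lborel. LINT x|lborel. v y * bump x h y * \<zeta> x) / ?m"
    using lborel_pair.Fubini_integral[OF int] by simp
  also have "\<dots> = (LINT y|lborel. v y * k y)"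
    by (simp add: k_def mult.assoc)
  finally have 1: "(LINT x|lborel. mollify h v x * \<zeta> x) = (LINT y|lborel. v y * k y)" .
  have "integrable lborel (\<lambda>y. (LINT x|lborel. v y * bump x h y * \<zeta> x) / ?m)"
    using lborel_pair.integrable_fst[of "\<lambda>y x. v y * bump x h y * \<zeta> x"] int by simp
  then have 2: "integrable lborel (\<lambda>y. v y * k y)"
    by (simp add: k_def mult.assoc)
  have 3: "integrable lborel (\<lambda>y. v y * \<zeta> y)" by (rule integrable_mult_minlip[OF v \<zeta>])
  have "\<bar>LINT y|lborel. v y * k y - v y * \<zeta> y\<bar> \<le> (LINT y|lborel. \<bar>v y\<bar> * (D * h))"
  proof (rule integral_abs_bound_integral)
    fix y
    have "\<bar>v y\<bar> * \<bar>k y - \<zeta> y\<bar> \<le> \<bar>v y\<bar> * (D * h)" using kz by (intro mult_left_mono) auto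
    then show "\<bar>v y * k y - v y * \<zeta> y\<bar> \<le> \<bar>v y\<bar> * (D * h)"
      by (simp add: abs_mult flip: right_diff_distrib)
  qed (use 2 3 v in auto)
  then show ?thesis using 1 2 3 by simp
qed

section \<open>The maximum principle\<close>

context levy_kernel begin

text \<open>Shifting the argument of the bump by \<open>z\<close> moves its centre to
  \<open>c - z\<close>. Hence pairing \<open>v\<close> with \<open>gen (bump c h)\<close> is a
  positive multiple of the adjoint operator of the mollified function at \<open>c\<close>, and a
  weak inequality becomes a pointwise one.\<close>

lemma gen_adj_mollify_nonneg:
  assumes v: "integrable lborel v" and h: "0 < h"
    and weak: "0 \<le> (LINT x|lborel. v x * gen (bump c h) x)"
  shows "0 \<le> gen_adj (mollify h v) c"
proof -
  let ?m = "bmass TYPE('a) h"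
  obtain D where D: "minlip D (bump c h)" using minlip_bump[OF h] by blast
  have "(LINT x|lborel. v x * gen (bump c h) x) = (LINT z|K. LINT x|lborel. v x * (bump c h x - bump c h (x + z)))"
    by (rule integral_gen_swap(1)[OF v D])
  also have "\<dots> = (LINT z|K. ?m * (mollify h v c - mollify h v (c - z)))"
    using integrable_mult_bump[OF v] bmass_pos[OF h, where 'a = 'a]
    by (simp add: bump_translate right_diff_distrib mollify_def)
  also have "\<dots> = ?m * gen_adj (mollify h v) c"
    by (simp add: gen_adj_def)
  finally show ?thesis using weak bmass_pos[OF h, where 'a = 'a] by (simp add: zero_le_mult_iff)
qed

text \<open>Kato's inequality for jumps: the negative part dominates \<open>- w\<close> everywhere
  and equals it where \<open>w < 0\<close>; elsewhere it sits at its minimum 0.\<close>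

lemma gen_adj_negative_part:
  assumes w: "minlip D w" and "0 \<le> gen_adj w x"
  shows "gen_adj (\<lambda>y. max 0 (- w y)) x \<le> 0"
proof (cases "w x < 0")
  case True
  have n: "minlip D (\<lambda>y. max 0 (- w y))" by (rule minlip_negative_part[OF w])
  have "gen_adj (\<lambda>y. max 0 (- w y)) x \<le> (LINT z|K. - (w x - w (x - z)))"
    unfolding gen_adj_def
    using True by (intro integral_mono integrable_diff[OF n] Bochner_Integration.integrable_minus integrable_diff[OF w]) auto
  also have "\<dots> = - gen_adj w x" unfolding gen_adj_def by (rule Bochner_Integration.integral_minus)
  finally show ?thesis using assms(2) by simp
next
  case False
  then have "max 0 (- w x) = 0" by simp
  moreover have "0 \<le> (LINT z|K. max 0 (- w (x - z)))" by (rule Bochner_Integration.integral_nonneg) simp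
  ultimately show ?thesis unfolding gen_adj_def by simp
qed

text \<open>Let \<open>n\<close> be the negative part of the mollified \<open>v\<close> and \<psi>
  the cutoff. By Kato and duality the integral of \<open>n x * gen \<psi> x\<close> is at most 0.
  Deep inside, \<open>gen \<psi>\<close> is at least the mass of the jumps that must leave \<Omega>;
  in the layer it is bounded below by \<open>- (C * h powr - \<beta>)\<close> while
  \<open>n \<le> B\<close>. So the layer alone pays for the negative mass inside.\<close>

lemma max_principle_shell:
  assumes \<Omega>: "open \<Omega>" "bounded \<Omega>" "\<Omega> \<noteq> {}"
    and v: "integrable lborel v"
    and out: "AE x in lborel. x \<notin> \<Omega> \<longrightarrow> 0 \<le> v x"
    and B: "0 \<le> B" "AE x in lborel. infdist x (frontier \<Omega>) \<le> e \<longrightarrow> - B \<le> v x"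
    and h: "0 < h" "3 * h \<le> e"
    and weak: "\<And>c. cball c h \<subseteq> \<Omega> \<Longrightarrow> 0 \<le> (LINT x|lborel. v x * gen (bump c h) x)"
    and far: "\<And>x z. x \<in> \<Omega> \<Longrightarrow> \<rho> < norm z \<Longrightarrow> x + z \<notin> \<Omega>" "0 < \<rho>"
  shows "measure K {z. \<rho> < norm z} * (LINT x|lborel. indicator {x. 2 * h \<le> infdist x (- \<Omega>)} x * max 0 (- mollify h v x))
    \<le> C * h powr - \<beta> * (B * measure lborel {x. infdist x (frontier \<Omega>) \<le> 2 * h})"
proof -
  let ?F = "frontier \<Omega>"
  have "\<Omega> \<noteq> UNIV" using \<Omega>(2) not_bounded_UNIV by auto
  then have F: "?F \<noteq> {}" using frontier_not_empty \<Omega>(3) by blast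
  have cF: "compact ?F" using \<Omega>(2) by (rule compact_frontier_bounded)
  define w where "w = mollify h v"
  define n where "n x = max 0 (- w x)" for x
  define \<psi> where "\<psi> = cutoff (- \<Omega>) h"
  let ?T = "{x. infdist x ?F \<le> 2 * h}"
  let ?A = "{x. 2 * h \<le> infdist x (- \<Omega>)}"
  let ?\<kappa> = "measure K {z. \<rho> < norm z}"
  obtain D where D: "minlip D w" using minlip_mollify[OF v h(1)] by (auto simp: w_def)
  have nD: "minlip D n" unfolding n_def by (rule minlip_negative_part[OF D])
  have ni: "integrable lborel n"
    unfolding n_def w_def using integrable_mollify[OF v h(1)] by (intro integrable_max) auto
  have \<psi>D: "minlip (1 + 1 / h) \<psi>" unfolding \<psi>_def by (rule minlip_cutoff[OF h(1)])
  have \<psi>0: "\<psi> x = 0" if "x \<notin> \<Omega>" for x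
    using that h(1) by (simp add: \<psi>_def cutoff_def)
  have \<psi>r: "0 \<le> \<psi> x" "\<psi> x \<le> 1" for x by (simp_all add: \<psi>_def cutoff_range)
  have [measurable]: "\<Omega> \<in> sets borel" using \<Omega>(1) by simp
  have [measurable]: "\<psi> \<in> borel_measurable borel" by (rule minlip_measurable[OF \<psi>D])
  have \<psi>i: "integrable lborel \<psi>"
  proof (rule Bochner_Integration.integrable_bound)
    show "integrable lborel (indicator \<Omega> :: 'a \<Rightarrow> real)"
      using emeasure_bounded_finite[OF \<Omega>(2)] by (intro integrable_real_indicator) auto
    show "AE x in lborel. norm (\<psi> x) \<le> norm (indicator \<Omega> x :: real)"
      using \<psi>0 \<psi>r by (auto simp: indicator_def)
  qed measurable
  \<comment> \<open>Where \<psi> is nonzero, the ball of radius \<open>h\<close> lies in \<Omega>,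
    so the bump centred there may be used in \<open>weak\<close>.\<close>
  have neg: "gen_adj n x \<le> 0" if "\<psi> x \<noteq> 0" for x
  proof -
    have "h < infdist x (- \<Omega>)"
      using cutoff_pos[OF h(1), of "- \<Omega>" x] that \<psi>r(1)[of x] unfolding \<psi>_def by linarith
    then have "cball x h \<subseteq> \<Omega>" by (rule cball_subset_of_infdist_complement)
    then have "0 \<le> gen_adj w x"
      unfolding w_def using gen_adj_mollify_nonneg[OF v h(1) weak] by blast
    then show ?thesis unfolding n_def by (rule gen_adj_negative_part[OF D])
  qed
  have "(LINT x|lborel. n x * gen \<psi> x) = (LINT x|lborel. \<psi> x * gen_adj n x)"
    by (rule gen_adjoint[OF ni nD \<psi>i \<psi>D])
  also have "\<dots> \<le> (LINT x|(lborel::'a measure). 0)"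
  proof (intro integral_mono integrable_mult_gen(2)[OF \<psi>i nD])
    fix x show "\<psi> x * gen_adj n x \<le> 0"
      using neg[of x] \<psi>r(1)[of x] by (cases "\<psi> x = 0") (auto simp: mult_le_0_iff)
  qed simp
  finally have le0: "(LINT x|lborel. n x * gen \<psi> x) \<le> 0" by simp
  have fin: "emeasure K {z. \<rho> < norm z} < \<infinity>"
  proof -
    have "emeasure K {z. \<rho> < norm z} = (\<integral>\<^sup>+z. indicator {z. \<rho> < norm z} z \<partial>K)" by simp
    also have "\<dots> \<le> (\<integral>\<^sup>+z. ennreal (min 1 (norm z / \<rho>)) \<partial>K)"
      using far(2) by (intro nn_integral_mono) (auto simp: indicator_def)
    also have "\<dots> < \<infinity>" using nn_integral_K[OF far(2)] by (auto intro: le_less_trans)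
    finally show ?thesis .
  qed
  \<comment> \<open>At a point where \<psi> has its maximal value 1 no jump increases it, and each
    jump longer than \<rho> loses the full value 1.\<close>
  have gen1: "?\<kappa> \<le> gen \<psi> x" if "2 * h \<le> infdist x (- \<Omega>)" for x
  proof -
    have 1: "\<psi> x = 1" using that unfolding \<psi>_def by (simp add: cutoff_eq_1_iff[OF h(1)])
    then have x: "x \<in> \<Omega>" using \<psi>0[of x] by fastforce
    have "(LINT z|K. indicator {z. \<rho> < norm z} z) \<le> gen \<psi> x"
      unfolding gen_def
    proof (intro integral_mono integrable_diff[OF \<psi>D])
      show "integrable K (indicator {z. \<rho> < norm z} :: 'a \<Rightarrow> real)"
        using fin by (intro integrable_real_indicator) auto
      show "indicator {z. \<rho> < norm z} z \<le> \<psi> x - \<psi> (x + z)" for z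
        using 1 \<psi>r(2)[of "x + z"] \<psi>0[OF far(1)[OF x]] by (auto simp: indicator_def)
    qed
    then show ?thesis by simp
  qed
  have gen2: "- (C * h powr - \<beta>) \<le> gen \<psi> x" for x
    using gen_abs_le[OF cutoff_lipschitz[OF h(1)] h(1), of _ _ x] \<psi>D unfolding \<psi>_def by (smt (verit))
  \<comment> \<open>A mollifier of radius \<open>h\<close> centred in the layer of width
    \<open>2 * h\<close> sees only points within \<open>3 * h\<close> of the boundary, where the
    bound \<open>B\<close> holds because \<open>3 * h \<le> e\<close>.\<close>
  have nB: "n x \<le> B" if "x \<in> ?T" for x
  proof -
    have "- B \<le> w x"
      unfolding w_def
    proof (rule mollify_lower_bound[OF v h(1)], use B(2) in eventually_elim)
      fix y assume y: "infdist y ?F \<le> e \<longrightarrow> - B \<le> v y"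
      show "y \<in> cball x h \<longrightarrow> - B \<le> v y"
      proof
        assume "y \<in> cball x h"
        then have "infdist y ?F \<le> 3 * h"
          using infdist_triangle[of y ?F x] that by (simp add: dist_commute)
        then show "- B \<le> v y" using y h(2) by simp
      qed
    qed
    then show ?thesis using B(1) by (simp add: n_def)
  qed
  \<comment> \<open>Such a point is outside \<Omega> and more than \<open>2 * h\<close> from its
    boundary, so the mollifier sees only points where \<open>v\<close> is nonnegative.\<close>
  have n0: "n x = 0" if "x \<notin> ?T" "x \<notin> ?A" for x
  proof -
    have x: "x \<notin> \<Omega>"
      using that infdist_complement_eq_frontier[OF \<Omega>(1) F, of x] by auto
    have disj: "cball x h \<inter> \<Omega> = {}"
      using that x h(1) by (intro cball_disjoint_of_infdist_frontier) auto
    have "- 0 \<le> w x"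
      unfolding w_def
      by (rule mollify_lower_bound[OF v h(1)], use out in eventually_elim) (use disj in auto)
    then show ?thesis by (simp add: n_def)
  qed
  have pw: "?\<kappa> * (indicator ?A x * n x) - C * h powr - \<beta> * (B * indicator ?T x) \<le> n x * gen \<psi> x" for x
  proof -
    have nn: "0 \<le> n x" by (simp add: n_def)
    have CB: "0 \<le> C * h powr - \<beta> * B" using C_nonneg B(1) by simp
    consider "x \<in> ?A" | "x \<notin> ?A" "x \<in> ?T" | "x \<notin> ?A" "x \<notin> ?T" by blast
    then show ?thesis
    proof cases
      case 1
      then have "?\<kappa> * n x \<le> gen \<psi> x * n x" using gen1[of x] nn by (intro mult_right_mono) auto
      moreover have "0 \<le> C * h powr - \<beta> * (B * indicator ?T x)" using C_nonneg B(1) by simp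
      ultimately show ?thesis using 1 by (simp add: mult.commute)
    next
      case 2
      have "n x * - (C * h powr - \<beta>) \<le> n x * gen \<psi> x" using gen2 nn by (rule mult_left_mono)
      moreover have "n x * (C * h powr - \<beta>) \<le> B * (C * h powr - \<beta>)"
        using nB[OF 2(2)] C_nonneg by (intro mult_right_mono) auto
      ultimately show ?thesis using 2 by (simp add: mult_ac)
    next
      case 3
      then show ?thesis using n0 by simp
    qed
  qed
  have mA: "?A \<in> sets borel" by measurable
  have mT: "?T \<in> sets borel" by measurable
  have bT: "bounded ?T"
  proof -
    obtain M where M: "\<And>p. p \<in> ?F \<Longrightarrow> norm p \<le> M" using cF compact_imp_bounded bounded_iff by metis
    show ?thesis
    proof (rule boundedI)
      fix x assume "x \<in> ?T"
      moreover obtain p where "p \<in> ?F" "infdist x ?F = dist x p"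
        using infdist_attains_inf[OF frontier_closed F] by blast
      ultimately show "norm x \<le> M + 2 * h"
        using M[of p] norm_triangle_sub[of x p] by (simp add: dist_norm)
    qed
  qed
  have iA: "integrable lborel (\<lambda>x. indicator ?A x * n x)"
  proof (rule Bochner_Integration.integrable_bound[OF ni])
    have [measurable]: "n \<in> borel_measurable borel" by (rule minlip_measurable[OF nD])
    show "(\<lambda>x. indicator ?A x * n x) \<in> borel_measurable lborel" using mA by measurable
  qed (auto simp: indicator_def)
  have iT: "integrable lborel (indicator ?T :: 'a \<Rightarrow> real)"
    using emeasure_bounded_finite[OF bT] mT by (intro integrable_real_indicator) auto
  have "(LINT x|lborel. ?\<kappa> * (indicator ?A x * n x) - C * h powr - \<beta> * (B * indicator ?T x)) \<le> (LINT x|lborel. n x * gen \<psi> x)"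
    using pw iA iT by (intro integral_mono integrable_mult_gen(1)[OF ni \<psi>D]) auto
  also have "(LINT x|lborel. ?\<kappa> * (indicator ?A x * n x) - C * h powr - \<beta> * (B * indicator ?T x))
    = ?\<kappa> * (LINT x|lborel. indicator ?A x * n x) - C * h powr - \<beta> * (B * measure lborel ?T)"
    using iA iT by simp
  finally show ?thesis using le0 unfolding n_def w_def by linarith
qed

end

text \<open>Test against Lipschitz approximations of the indicator of a compact subset of the negativity set.\<close>

lemma AE_nonneg_of_test:
  fixes v :: "'a::euclidean_space \<Rightarrow> real"
  assumes v: "integrable lborel v" and \<Omega>: "open \<Omega>" "\<Omega> \<noteq> UNIV"
    and test: "\<And>\<zeta> D t. minlip D \<zeta> \<Longrightarrow> (\<And>x. 0 \<le> \<zeta> x \<and> \<zeta> x \<le> 1) \<Longrightarrow> 0 < t \<Longrightarrow>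
      (\<And>x. \<zeta> x \<noteq> 0 \<Longrightarrow> t \<le> infdist x (- \<Omega>)) \<Longrightarrow> 0 \<le> (LINT x|lborel. v x * \<zeta> x)"
  shows "AE x in lborel. x \<in> \<Omega> \<longrightarrow> 0 \<le> v x"
proof -
  have [measurable]: "v \<in> borel_measurable borel" using v by auto
  have [measurable]: "\<Omega> \<in> sets borel" using \<Omega> by simp
  define N where "N = {x \<in> \<Omega>. v x < 0}"
  have N: "N \<in> sets borel" unfolding N_def by measurable
  have null: "emeasure lborel T = 0" if T: "compact T" "T \<subseteq> N" for T
  proof (cases "T = {}")
    case False
    have Tm [measurable]: "T \<in> sets borel" using T(1) by (simp add: borel_compact)
    have TO: "T \<inter> - \<Omega> = {}" using T(2) by (auto simp: N_def)
    obtain d where d: "d > 0" "\<And>x y. x \<in> T \<Longrightarrow> y \<in> - \<Omega> \<Longrightarrow> d \<le> dist x y"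
      using separate_compact_closed[OF T(1) closed_Compl[OF \<Omega>(1)] TO] by blast
    define \<zeta> where "\<zeta> n x = max 0 (1 - real (Suc n) * infdist x T)" for n x
    have lip: "minlip (1 + real (Suc n)) (\<zeta> n)" for n
    proof (rule minlip_intro)
      fix x y
      have "\<bar>real (Suc n) * infdist x T - real (Suc n) * infdist y T\<bar> \<le> real (Suc n) * dist x y"
        using infdist_triangle_abs[of x T y] by (simp add: abs_mult mult_left_mono flip: right_diff_distrib)
      then show "\<bar>\<zeta> n x - \<zeta> n y\<bar> \<le> real (Suc n) * dist x y"
        unfolding \<zeta>_def by linarith
      have "0 \<le> real (Suc n) * infdist z T" for z by (simp add: infdist_nonneg)
      then show "\<bar>\<zeta> n x - \<zeta> n y\<bar> \<le> 1" unfolding \<zeta>_def by (smt (verit))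
    qed auto
    have r: "0 \<le> \<zeta> n x \<and> \<zeta> n x \<le> 1" for n x
      by (auto simp: \<zeta>_def infdist_nonneg)
    \<comment> \<open>\<open>d\<close> separates \<open>T\<close> from the complement. Once the
      support of \<open>\<zeta> n\<close> is within \<open>d / 2\<close> of \<open>T\<close>, it
      keeps distance \<open>d / 2\<close> from the complement and \<open>test\<close>
      applies.\<close>
    have nn: "0 \<le> (LINT x|lborel. v x * \<zeta> n x)" if n: "2 / d < real (Suc n)" for n
    proof (rule test[OF lip r, of "d / 2"])
      show "0 < d / 2" using d by simp
      fix x assume "\<zeta> n x \<noteq> 0"
      then have "real (Suc n) * infdist x T < 1" by (auto simp: \<zeta>_def max_def split: if_splits)
      then have "infdist x T < 1 / real (Suc n)" by (simp add: field_simps)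
      also have "\<dots> < d / 2" using n d by (simp add: field_simps)
      finally have x: "infdist x T < d / 2" .
      obtain p where p: "p \<in> T" "infdist x T = dist x p"
        using infdist_attains_inf[of T x] T(1) False compact_imp_closed by blast
      obtain q where q: "q \<in> - \<Omega>" "infdist x (- \<Omega>) = dist x q"
        using infdist_attains_inf[of "- \<Omega>" x] \<Omega> by auto
      have "d \<le> dist p q" using d(2) p q by blast
      also have "\<dots> \<le> dist x p + dist x q" by (rule dist_triangle3)
      finally show "d / 2 \<le> infdist x (- \<Omega>)" using x p q by simp
    qed
    have lim: "(\<lambda>n. LINT x|lborel. v x * \<zeta> n x) \<longlonglongrightarrow> (LINT x|lborel. v x * indicator T x)"
    proof (rule integral_dominated_convergence)
      show "integrable lborel (\<lambda>x. \<bar>v x\<bar>)" using v by simp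
      show "(\<lambda>x. v x * \<zeta> n x) \<in> borel_measurable lborel" for n
        using minlip_measurable[OF lip[of n]] by simp
      show "AE x in lborel. norm (v x * \<zeta> n x) \<le> \<bar>v x\<bar>" for n
        using r by (auto simp: abs_mult intro!: mult_left_le)
      show "AE x in lborel. (\<lambda>n. v x * \<zeta> n x) \<longlonglongrightarrow> v x * indicator T x"
      proof (intro AE_I2 tendsto_intros)
        fix x
        show "(\<lambda>n. \<zeta> n x) \<longlonglongrightarrow> indicator T x"
        proof (cases "x \<in> T")
          case True
          then show ?thesis by (simp add: \<zeta>_def)
        next
          case x: False
          then have pos: "0 < infdist x T"
            using in_closed_iff_infdist_zero[of T x] T(1) False infdist_nonneg[of x T] compact_imp_closed by force
          obtain m :: nat where m: "1 / infdist x T < real m" using reals_Archimedean2 by blast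
          have "\<zeta> n x = 0" if "n \<ge> m" for n
          proof -
            have "1 / infdist x T < real (Suc n)" using m that by linarith
            then show ?thesis using pos by (simp add: \<zeta>_def field_simps)
          qed
          then have "\<forall>\<^sub>F n in sequentially. \<zeta> n x = 0" by (auto simp: eventually_sequentially)
          then show ?thesis using x by (simp add: tendsto_eventually)
        qed
      qed
    qed measurable
    obtain m :: nat where m: "2 / d < real m" using reals_Archimedean2 by blast
    \<comment> \<open>The limit is nonnegative, yet \<open>v < 0\<close> on \<open>T\<close>; both
      can hold only if \<open>T\<close> is null.\<close>
    have "0 \<le> (LINT x|lborel. v x * indicator T x)"
    proof (rule tendsto_lowerbound[OF lim])
      show "\<forall>\<^sub>F n in sequentially. 0 \<le> (LINT x|lborel. v x * \<zeta> n x)"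
        unfolding eventually_sequentially
      proof (intro exI[of _ m] allI impI nn)
        show "2 / d < real (Suc n)" if "m \<le> n" for n using m that by linarith
      qed
    qed simp
    moreover have le: "v x * indicator T x \<le> 0" for x
      using T(2) by (auto simp: N_def indicator_def)
    moreover have iT: "integrable lborel (\<lambda>x. v x * indicator T x)"
      using integrable_mult_indicator[OF _ v, of T] by (simp add: mult.commute)
    moreover have "0 \<le> (LINT x|lborel. - (v x * indicator T x))"
      using le by (intro Bochner_Integration.integral_nonneg) auto
    ultimately have "(LINT x|lborel. - (v x * indicator T x)) = 0" by simp
    then have "AE x in lborel. - (v x * indicator T x) = 0"
      using iT le by (subst (asm) integral_nonneg_eq_0_iff_AE) auto
    then have "AE x in lborel. x \<notin> T"
      by eventually_elim (use T(2) in \<open>auto simp: N_def indicator_def split: if_splits\<close>)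
    then show ?thesis by (subst (asm) AE_iff_measurable[of T]) auto
  qed simp
  have null': "emeasure lborel T = 0" if T: "closed T" "T \<subseteq> N" for T
  proof -
    have "emeasure lborel (\<Union>n. T \<inter> cball 0 (real n)) = 0"
      using T null[of "T \<inter> cball 0 (real _)"]
      by (intro emeasure_UN_eq_0) (auto simp: borel_closed closed_Int_compact)
    moreover have "(\<Union>n. T \<inter> cball 0 (real n)) = T"
      using real_arch_simple by auto
    ultimately show ?thesis by simp
  qed
  \<comment> \<open>Inner regularity: closed subsets of \<open>N\<close> are null and exhaust its
    measure.\<close>
  have "emeasure lborel N \<le> ennreal e" if e: "0 < e" for e
  proof -
    obtain T where T: "closed T" "T \<subseteq> N" "N - T \<in> lmeasurable" "emeasure lebesgue (N - T) < ennreal e"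
      using sets_lebesgue_inner_closed[of N e] N e by auto
    have Tm: "T \<in> sets borel" using T(1) by simp
    have "emeasure lborel N = emeasure lborel T + emeasure lborel (N - T)"
      using N Tm T(2) by (subst plus_emeasure) (auto intro: arg_cong[of _ _ "emeasure lborel"])
    also have "\<dots> = emeasure lebesgue (N - T)"
      using null'[OF T(1,2)] N Tm by (simp add: emeasure_completion)
    finally show ?thesis using T(4) by simp
  qed
  then have "emeasure lborel N = 0"
    by (metis ennreal_0 ennreal_le_epsilon le_zero_eq add.left_neutral ennreal_zero_neq_top)
  then have "AE x in lborel. x \<notin> N"
    using N by (intro AE_not_in) (auto simp: null_sets_def)
  then show ?thesis by eventually_elim (auto simp: N_def)
qed

context levy_kernel begin

text \<open>The unknown \<open>B\<close> appears only in front of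
  \<open>h powr (1 - \<beta>)\<close>: the layer has volume O(h) and the cutoff costs
  \<open>h powr - \<beta>\<close>. Letting \<open>h\<close> tend to 0 removes it, so a bound of any
  size near the boundary is good enough.\<close>

lemma max_principle:
  assumes \<Omega>: "open \<Omega>" "bounded \<Omega>" "\<Omega> \<noteq> {}"
    and v: "integrable lborel v"
    and out: "AE x in lborel. x \<notin> \<Omega> \<longrightarrow> 0 \<le> v x"
    and U: "open U" "frontier \<Omega> \<subseteq> U" "AE x in lborel. x \<in> U \<longrightarrow> - B \<le> v x"
    and weak: "\<And>c h. 0 < h \<Longrightarrow> cball c h \<subseteq> \<Omega> \<Longrightarrow> 0 \<le> (LINT x|lborel. v x * gen (bump c h) x)"
    and shell: "0 \<le> C'" "0 < h0"
      "\<And>h. 0 < h \<Longrightarrow> h \<le> h0 \<Longrightarrow> emeasure lborel {x. infdist x (frontier \<Omega>) \<le> h} \<le> ennreal (C' * h)"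
    and pos: "\<And>\<rho>. 0 < \<rho> \<Longrightarrow> 0 < measure K {z. \<rho> < norm z}"
  shows "AE x in lborel. 0 \<le> v x"
proof -
  let ?F = "frontier \<Omega>"
  have U\<Omega>: "\<Omega> \<noteq> UNIV" using \<Omega>(2) not_bounded_UNIV by auto
  then have F: "?F \<noteq> {}" using frontier_not_empty \<Omega>(3) by blast
  obtain e where e: "e > 0" "(\<Union>x\<in>?F. cball x e) \<subseteq> U"
    using compact_subset_open_imp_cball_epsilon_subset[OF compact_frontier_bounded[OF \<Omega>(2)] U(1,2)] by blast
  define B' where "B' = max B 0"
  have B': "0 \<le> B'" "AE x in lborel. infdist x ?F \<le> e \<longrightarrow> - B' \<le> v x"
  proof -
    show "AE x in lborel. infdist x ?F \<le> e \<longrightarrow> - B' \<le> v x"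
      using U(3)
    proof eventually_elim
      fix x assume *: "x \<in> U \<longrightarrow> - B \<le> v x"
      show "infdist x ?F \<le> e \<longrightarrow> - B' \<le> v x"
      proof
        assume x: "infdist x ?F \<le> e"
        obtain p where p: "p \<in> ?F" "infdist x ?F = dist x p"
          using infdist_attains_inf[OF frontier_closed F] by blast
        then have "x \<in> cball p e" using x by (simp add: dist_commute)
        then have "x \<in> U" using e(2) p(1) by blast
        then show "- B' \<le> v x" using * by (simp add: B'_def)
      qed
    qed
  qed (simp add: B'_def)
  obtain M where M: "0 < M" "\<And>x. x \<in> \<Omega> \<Longrightarrow> norm x \<le> M"
    using \<Omega>(2) bounded_pos by blast
  \<comment> \<open>The diameter of \<Omega> is at most \<open>2 * M\<close>, so longer jumps always
    leave \<Omega>.\<close>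
  define \<rho> where "\<rho> = 2 * M"
  have far: "x + z \<notin> \<Omega>" if "x \<in> \<Omega>" "\<rho> < norm z" for x z
    using M(2)[OF that(1)] M(2)[of "x + z"] that(2) norm_triangle_ineq4[of "x + z" x] by (auto simp: \<rho>_def)
  have \<rho>: "0 < \<rho>" using M by (simp add: \<rho>_def)
  define \<kappa> where "\<kappa> = measure K {z. \<rho> < norm z}"
  have \<kappa>: "0 < \<kappa>" using pos[OF \<rho>] by (simp add: \<kappa>_def)
  have "AE x in lborel. x \<in> \<Omega> \<longrightarrow> 0 \<le> v x"
  proof (rule AE_nonneg_of_test[OF v \<Omega>(1) U\<Omega>])
    fix \<zeta> :: "'a \<Rightarrow> real" and D t :: real
    assume \<zeta>: "minlip D \<zeta>" "\<And>x. 0 \<le> \<zeta> x \<and> \<zeta> x \<le> 1" and t: "0 < t" "\<And>x. \<zeta> x \<noteq> 0 \<Longrightarrow> t \<le> infdist x (- \<Omega>)"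
    define a where "a = (LINT x|lborel. \<bar>v x\<bar>) * D"
    define b where "b = C * B' * C' * 2 / \<kappa>"
    \<comment> \<open>In turn: \<open>3 * h \<le> e\<close> for the bound near the boundary,
      \<open>2 * h \<le> t\<close> so that \<zeta> lives in the deep set,
      \<open>2 * h \<le> h0\<close> for the volume of the layer.\<close>
    define h1 where "h1 = min (e / 3) (min (t / 2) (h0 / 2))"
    have h1: "0 < h1" using e t shell by (simp add: h1_def)
    have bound: "- (a * h + b * h powr (1 - \<beta>)) \<le> (LINT x|lborel. v x * \<zeta> x)" if h: "0 < h" "h < h1" for h
    proof -
      let ?w = "mollify h v"
      let ?A = "{x. 2 * h \<le> infdist x (- \<Omega>)}"
      let ?T = "{x. infdist x ?F \<le> 2 * h}"
      have [measurable]: "\<zeta> \<in> borel_measurable borel" by (rule minlip_measurable[OF \<zeta>(1)])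
      have wi: "integrable lborel ?w" by (rule integrable_mollify[OF v h(1)])
      then have [measurable]: "?w \<in> borel_measurable borel" by auto
      have "emeasure lborel ?T \<le> ennreal (C' * (2 * h))"
        using h by (intro shell) (auto simp: h1_def)
      then have T: "measure lborel ?T \<le> C' * (2 * h)"
        using shell(1) h(1) by (metis enn2real_leI measure_def mult_nonneg_nonneg less_imp_le zero_le_numeral)
      have "\<kappa> * (LINT x|lborel. indicator ?A x * max 0 (- ?w x)) \<le> C * h powr - \<beta> * (B' * measure lborel ?T)"
        unfolding \<kappa>_def
      proof (rule max_principle_shell[OF \<Omega> v out B' h(1)])
        show "3 * h \<le> e" using h by (simp add: h1_def)
        show "0 \<le> (LINT x|lborel. v x * gen (bump c h) x)" if "cball c h \<subseteq> \<Omega>" for c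
          using weak[OF h(1) that] .
      qed (use far \<rho> in auto)
      also have "\<dots> \<le> C * h powr - \<beta> * (B' * (C' * (2 * h)))"
        using T C_nonneg B'(1) by (intro mult_left_mono) auto
      also have "\<dots> = C * B' * C' * 2 * h powr (1 - \<beta>)"
        using h(1) by (simp add: powr_diff powr_minus divide_inverse)
      finally have "(LINT x|lborel. indicator ?A x * max 0 (- ?w x)) \<le> b * h powr (1 - \<beta>)"
        using \<kappa> by (simp add: b_def field_simps)
      moreover have "- (LINT x|lborel. indicator ?A x * max 0 (- ?w x)) \<le> (LINT x|lborel. ?w x * \<zeta> x)"
      proof -
        have i: "integrable lborel (\<lambda>x. indicator ?A x * max 0 (- ?w x))"
          by (rule Bochner_Integration.integrable_bound[OF wi]) (auto simp: indicator_def)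
        have "(LINT x|lborel. - (indicator ?A x * max 0 (- ?w x))) \<le> (LINT x|lborel. ?w x * \<zeta> x)"
        proof (intro integral_mono)
          show "integrable lborel (\<lambda>x. - (indicator ?A x * max 0 (- ?w x)))" using i by simp
          show "integrable lborel (\<lambda>x. ?w x * \<zeta> x)" by (rule integrable_mult_minlip[OF wi \<zeta>(1)])
          fix x
          show "- (indicator ?A x * max 0 (- ?w x)) \<le> ?w x * \<zeta> x"
          proof (cases "\<zeta> x = 0")
            case True
            then show ?thesis by (auto simp: indicator_def)
          next
            case False
            have x: "x \<in> ?A" using t(2)[OF False] h by (simp add: h1_def)
            have "- max 0 (- ?w x) * 1 \<le> - max 0 (- ?w x) * \<zeta> x"
              using \<zeta>(2)[of x] by (intro mult_left_mono_neg) auto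
            also have "\<dots> \<le> ?w x * \<zeta> x" using \<zeta>(2)[of x] by (intro mult_right_mono) auto
            finally show ?thesis using x by simp
          qed
        qed
        then show ?thesis by simp
      qed
      moreover have "\<bar>(LINT x|lborel. ?w x * \<zeta> x) - (LINT x|lborel. v x * \<zeta> x)\<bar> \<le> a * h"
        using integral_mollify_mult[OF v h(1) \<zeta>(1)] by (simp add: a_def mult.assoc)
      ultimately show ?thesis by linarith
    qed
    have lim: "((\<lambda>h. - (a * h + b * h powr (1 - \<beta>))) \<longlongrightarrow> 0) (at_right 0)"
    proof -
      have "((\<lambda>h. - (a * h + b * h powr (1 - \<beta>))) \<longlongrightarrow> - (a * 0 + b * 0 powr (1 - \<beta>))) (at_right 0)"
        using \<beta>_less_1
        by (intro tendsto_intros tendsto_powr') (auto intro: eventually_at_right_less[THEN eventually_mono])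
      then show ?thesis by simp
    qed
    show "0 \<le> (LINT x|lborel. v x * \<zeta> x)"
    proof (rule tendsto_upperbound[OF lim])
      show "\<forall>\<^sub>F h in at_right 0. - (a * h + b * h powr (1 - \<beta>)) \<le> (LINT x|lborel. v x * \<zeta> x)"
        using bound h1 unfolding eventually_at_right_field by blast
    qed simp
  qed
  with out show ?thesis by eventually_elim blast
qed

end

section \<open>The kernel of the fractional Laplacian\<close>

text \<open>The normalising constant \<open>cNs\<close> is left out: a positive factor affects
  neither harmonicity nor signs, and the dependence of the masses on \<open>s\<close> becomes
  explicit.\<close>

definition frac_kernel :: "real \<Rightarrow> 'a::euclidean_space measure" where
  "frac_kernel s = density lborel (\<lambda>z. ennreal (norm z powr - (real DIM('a) + 2 * s)))"

text \<open>The area of the unit sphere, obtained from the volume of the ball as in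
  \<open>sph_mean\<close>.\<close>

definition sphere_area :: "'a::euclidean_space itself \<Rightarrow> real" where
  "sphere_area _ = real DIM('a) * measure lborel (ball (0::'a) 1)"

lemma sphere_area_pos: "0 < sphere_area TYPE('a::euclidean_space)"
  using content_ball_pos[of 1 "0::'a"] by (simp add: sphere_area_def)

lemma sets_frac_kernel [measurable_cong]: "sets (frac_kernel s) = sets borel"
  by (simp add: frac_kernel_def)

lemma nn_integral_frac_kernel:
  fixes f :: "real \<Rightarrow> ennreal"
  assumes [measurable]: "f \<in> borel_measurable borel"
  shows "(\<integral>\<^sup>+z. f (norm z) \<partial>(frac_kernel s :: 'a::euclidean_space measure)) =
    ennreal (sphere_area TYPE('a)) * (\<integral>\<^sup>+r. ennreal (indicator {0<..} r * r powr (- 1 - 2 * s)) * f r \<partial>lborel)"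
proof -
  let ?K = "frac_kernel s :: 'a measure"
  let ?S = "sphere_area TYPE('a)"
  let ?p = "- (real DIM('a) + 2 * s)"
  have "(\<integral>\<^sup>+z. f (norm z) \<partial>?K) = (\<integral>\<^sup>+z. ennreal (norm z powr ?p) * f (norm (z::'a)) \<partial>lborel)"
    unfolding frac_kernel_def by (rule nn_integral_density) measurable
  also have "\<dots> = ennreal (?S) * (\<integral>\<^sup>+r. ennreal (indicator {0<..} r * r ^ (DIM('a) - 1)) * (ennreal (r powr ?p) * f r) \<partial>lborel)"
    unfolding sphere_area_def by (rule nn_integral_radial) measurable
  also have "(\<integral>\<^sup>+r. ennreal (indicator {0<..} r * r ^ (DIM('a) - 1)) * (ennreal (r powr ?p) * f r) \<partial>lborel)
     = (\<integral>\<^sup>+r. ennreal (indicator {0<..} r * r powr (- 1 - 2 * s)) * f r \<partial>lborel)"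
  proof (rule nn_integral_cong, rule ennreal_mult_assoc)
    fix r :: real
    show "indicator {0<..} r * r ^ (DIM('a) - 1) * r powr ?p = indicator {0<..} r * r powr (- 1 - 2 * s)"
    proof (cases "0 < r")
      case True
      have "r ^ (DIM('a) - 1) * r powr ?p = r powr (real (DIM('a) - 1) + ?p)"
        using True by (simp only: powr_realpow[symmetric] powr_add)
      also have "real (DIM('a) - 1) + ?p = - 1 - 2 * s"
        by (simp add: of_nat_diff Suc_leI)
      finally show ?thesis using True by simp
    qed simp
  qed (simp add: indicator_def)
  finally show ?thesis .
qed

text \<open>The radial density \<open>r powr (- 1 - 2 * s)\<close> is barely integrable at infinity.
  The resulting factor \<open>1 / (2 * s)\<close> is the origin of the scale 1/s in all later
  estimates.\<close>

lemma emeasure_frac_kernel_outside: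
  assumes "0 < s" "0 < \<rho>"
  shows "emeasure (frac_kernel s :: 'a::euclidean_space measure) {z. \<rho> < norm z} = ennreal (sphere_area TYPE('a) * (\<rho> powr (- 2 * s) / (2 * s)))"
proof -
  let ?K = "frac_kernel s :: 'a measure"
  let ?S = "sphere_area TYPE('a)"
  have "emeasure ?K {z. \<rho> < norm z} = (\<integral>\<^sup>+z. indicator {z. \<rho> < norm z} z \<partial>?K)"
    by (rule nn_integral_indicator[symmetric]) measurable
  also have "\<dots> = (\<integral>\<^sup>+z. indicator {\<rho><..} (norm z) \<partial>?K)"
    by (intro nn_integral_cong) (auto simp: indicator_def)
  also have "\<dots> = ennreal (?S) * (\<integral>\<^sup>+r. ennreal (indicator {0<..} r * r powr (- 1 - 2 * s)) * indicator {\<rho><..} r \<partial>lborel)"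
    by (rule nn_integral_frac_kernel) measurable
  also have "(\<integral>\<^sup>+r. ennreal (indicator {0<..} r * r powr (- 1 - 2 * s)) * indicator {\<rho><..} r \<partial>lborel)
    = (\<integral>\<^sup>+r. ennreal (indicator {\<rho>..} r * r powr (- 1 - 2 * s)) \<partial>lborel)"
    by (rule nn_integral_cong_AE, use AE_lborel_singleton[of \<rho>] in eventually_elim)
      (use assms in \<open>auto simp: indicator_def\<close>)
  also have "\<dots> = ennreal (\<rho> powr (- 2 * s) / (2 * s))"
    using assms by (subst nn_integral_powr_to_inf) (auto simp: divide_simps)
  also have "ennreal (?S) * \<dots> = ennreal (?S * (\<rho> powr (- 2 * s) / (2 * s)))"
    using sphere_area_pos[where 'a = 'a] by (intro ennreal_mult'[symmetric]) simp
  finally show ?thesis .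
qed

text \<open>The factor \<open>norm z\<close> softens the density to \<open>r powr (- 2 * s)\<close>,
  integrable at 0 because \<open>2 * s < 1\<close>. For fixed \<rho> the moment stays bounded as
  \<open>s\<close> tends to 0, in contrast to the mass outside.\<close>

lemma nn_integral_frac_kernel_inside:
  assumes "s < 1 / 2" "0 < \<rho>"
  shows "(\<integral>\<^sup>+z. ennreal (indicator {..\<rho>} (norm z) * norm z) \<partial>(frac_kernel s :: 'a::euclidean_space measure))
    = ennreal (sphere_area TYPE('a) * (\<rho> powr (1 - 2 * s) / (1 - 2 * s)))"
proof -
  let ?K = "frac_kernel s :: 'a measure"
  let ?S = "sphere_area TYPE('a)"
  have "(\<integral>\<^sup>+z. ennreal (indicator {..\<rho>} (norm z) * norm z) \<partial>?K)
    = ennreal (?S) * (\<integral>\<^sup>+r. ennreal (indicator {0<..} r * r powr (- 1 - 2 * s)) * ennreal (indicator {..\<rho>} r * r) \<partial>lborel)"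
    by (rule nn_integral_frac_kernel) measurable
  also have "(\<integral>\<^sup>+r. ennreal (indicator {0<..} r * r powr (- 1 - 2 * s)) * ennreal (indicator {..\<rho>} r * r) \<partial>lborel)
    = (\<integral>\<^sup>+r. ennreal (if r \<in> {0..\<rho>} then r powr (- 2 * s) else 0) \<partial>lborel)"
  proof (rule nn_integral_cong_AE, use AE_lborel_singleton[of 0] in eventually_elim)
    fix r :: real assume r: "r \<noteq> 0"
    have "r powr (- 1 - 2 * s) * r = r powr (- 2 * s)" if "0 < r"
    proof -
      have "r powr (- 1 - 2 * s) * r powr 1 = r powr (- 2 * s)"
        by (subst powr_add[symmetric]) simp
      then show ?thesis using that by simp
    qed
    then show "ennreal (indicator {0<..} r * r powr (- 1 - 2 * s)) * ennreal (indicator {..\<rho>} r * r)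
        = ennreal (if r \<in> {0..\<rho>} then r powr (- 2 * s) else 0)"
      using r by (auto simp: indicator_def simp flip: ennreal_mult')
  qed
  also have "\<dots> = ennreal (\<rho> powr (- 2 * s + 1) / (- 2 * s + 1))"
  proof (rule nn_integral_has_integral_lborel)
    show "((\<lambda>r. if r \<in> {0..\<rho>} then r powr (- 2 * s) else 0) has_integral \<rho> powr (- 2 * s + 1) / (- 2 * s + 1)) UNIV"
      using assms by (subst has_integral_restrict_UNIV) (intro has_integral_powr_from_0; simp)
  qed auto
  also have "ennreal (?S) * \<dots> = ennreal (?S * (\<rho> powr (- 2 * s + 1) / (- 2 * s + 1)))"
    using sphere_area_pos[where 'a = 'a] by (intro ennreal_mult'[symmetric]) simp
  finally show ?thesis by simp
qed

text \<open>Splitting \<open>min 1 (norm z / h)\<close> at \<open>norm z = h\<close> leaves the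
  outer mass and the inner first moment divided by \<open>h\<close>, both homogeneous of degree
  \<open>- 2 * s\<close> in \<open>h\<close>.\<close>

lemma levy_kernel_frac_kernel:
  assumes s: "0 < s" "s < 1 / 2"
  shows "levy_kernel (frac_kernel s :: 'a::euclidean_space measure)
    (sphere_area TYPE('a) * (1 / (2 * s) + 1 / (1 - 2 * s))) (2 * s)"
proof
  let ?S = "sphere_area TYPE('a)"
  let ?K = "frac_kernel s :: 'a measure"
  show "sets ?K = sets borel" by (rule sets_frac_kernel)
  have "sigma_finite_measure ?K"
    unfolding frac_kernel_def
    by (subst sigma_finite_measure.sigma_finite_iff_density_finite[OF sigma_finite_lborel]) auto
  then show "\<exists>A. countable A \<and> A \<subseteq> sets ?K \<and> \<Union> A = space ?K \<and> (\<forall>a\<in>A. emeasure ?K a \<noteq> \<infinity>)"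
    by (rule sigma_finite_measure.sigma_finite_countable)
  show "0 \<le> ?S * (1 / (2 * s) + 1 / (1 - 2 * s))"
    using s sphere_area_pos[where 'a = 'a] by simp
  show "2 * s < 1" using s by simp
  fix h :: real assume h: "0 < h"
  have "(\<integral>\<^sup>+z. ennreal (min 1 (norm z / h)) \<partial>?K)
    = (\<integral>\<^sup>+z. indicator {z. h < norm z} z + ennreal (1 / h) * ennreal (indicator {..h} (norm z) * norm z) \<partial>?K)"
    using h by (intro nn_integral_cong) (auto simp: indicator_def min_def divide_simps simp flip: ennreal_mult')
  also have "\<dots> = (\<integral>\<^sup>+z. indicator {z. h < norm z} z \<partial>?K) + (\<integral>\<^sup>+z. ennreal (1 / h) * ennreal (indicator {..h} (norm z) * norm z) \<partial>?K)"
    by (rule nn_integral_add) measurable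
  also have "(\<integral>\<^sup>+z. indicator {z. h < norm z} z \<partial>?K) = ennreal (?S * (h powr (- 2 * s) / (2 * s)))"
    using emeasure_frac_kernel_outside[OF s(1) h, where 'a = 'a] by (subst nn_integral_indicator) auto
  also have "(\<integral>\<^sup>+z. ennreal (1 / h) * ennreal (indicator {..h} (norm z) * norm z) \<partial>?K)
    = ennreal (1 / h) * ennreal (?S * (h powr (1 - 2 * s) / (1 - 2 * s)))"
    by (subst nn_integral_cmult) (use nn_integral_frac_kernel_inside[OF s(2) h, where 'a = 'a] in auto)
  also have "ennreal (?S * (h powr (- 2 * s) / (2 * s))) + \<dots>
     = ennreal (?S * (h powr (- 2 * s) / (2 * s)) + 1 / h * (?S * (h powr (1 - 2 * s) / (1 - 2 * s))))"
    using h s sphere_area_pos[where 'a = 'a] by (simp add: ennreal_mult'[symmetric] ennreal_plus[symmetric] del: ennreal_plus)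
  also have "?S * (h powr (- 2 * s) / (2 * s)) + 1 / h * (?S * (h powr (1 - 2 * s) / (1 - 2 * s)))
     = ?S * (1 / (2 * s) + 1 / (1 - 2 * s)) * h powr - (2 * s)"
  proof -
    have "h powr (1 - 2 * s) = h powr 1 * h powr (- 2 * s)"
      by (subst powr_add[symmetric]) simp
    then show ?thesis using h by (simp add: distrib_left distrib_right mult_ac)
  qed
  finally show "(\<integral>\<^sup>+z. ennreal (min 1 (norm z / h)) \<partial>?K) \<le> ennreal (?S * (1 / (2 * s) + 1 / (1 - 2 * s)) * h powr - (2 * s))"
    by simp
qed

lemma integral_frac_kernel:
  fixes f :: "'a::euclidean_space \<Rightarrow> real"
  assumes [measurable]: "f \<in> borel_measurable borel"
  shows "(LINT z|frac_kernel s. f z) = (LINT z|lborel. norm z powr - (real DIM('a) + 2 * s) * f z)"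
  unfolding frac_kernel_def by (subst integral_density) auto

text \<open>The increments of a \<open>minlip\<close> function are absolutely integrable against the
  kernel, so dominated convergence removes the truncation. \<open>Lim\<close> in the definition of
  \<open>fraclap\<close> is then a genuine limit.\<close>

lemma fraclap_eq_gen:
  fixes \<phi> :: "'a::euclidean_space \<Rightarrow> real"
  assumes s: "0 < s" "s < 1 / 2" and \<phi>: "minlip D \<phi>"
  shows "fraclap s \<phi> x = cNs DIM('a) s * levy_kernel.gen (frac_kernel s) \<phi> x"
proof -
  interpret levy_kernel "frac_kernel s :: 'a measure" "sphere_area TYPE('a) * (1 / (2 * s) + 1 / (1 - 2 * s))" "2 * s"
    using s by (rule levy_kernel_frac_kernel)
  let ?K = "frac_kernel s :: 'a measure" and ?p = "real DIM('a) + 2 * s"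
  have [measurable]: "\<phi> \<in> borel_measurable borel" by (rule minlip_measurable[OF \<phi>])
  have eq: "(LINT y:{y. \<epsilon> < dist x y}|lebesgue. (\<phi> x - \<phi> y) / dist x y powr ?p)
      = (LINT z|?K. indicator {z. \<epsilon> < norm z} z * (\<phi> x - \<phi> (x + z)))" for \<epsilon>
  proof -
    have "(LINT y:{y. \<epsilon> < dist x y}|lebesgue. (\<phi> x - \<phi> y) / dist x y powr ?p)
      = (LINT y|lborel. indicator {y. \<epsilon> < dist x y} y *\<^sub>R ((\<phi> x - \<phi> y) / dist x y powr ?p))"
      unfolding set_lebesgue_integral_def by (rule integral_completion) measurable
    also have "\<dots> = (LINT z|lborel. indicator {y. \<epsilon> < dist x y} (x + z) *\<^sub>R ((\<phi> x - \<phi> (x + z)) / dist x (x + z) powr ?p))"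
      by (rule integral_lborel_translate) measurable
    also have "\<dots> = (LINT z|lborel. norm z powr - ?p * (indicator {z. \<epsilon> < norm z} z * (\<phi> x - \<phi> (x + z))))"
      unfolding powr_minus by (intro Bochner_Integration.integral_cong) (auto simp: indicator_def dist_norm divide_inverse)
    also have "\<dots> = (LINT z|?K. indicator {z. \<epsilon> < norm z} z * (\<phi> x - \<phi> (x + z)))"
      by (rule integral_frac_kernel[symmetric]) measurable
    finally show ?thesis .
  qed
  have "((\<lambda>\<epsilon>. LINT z|?K. indicator {z. \<epsilon> < norm z} z * (\<phi> x - \<phi> (x + z))) \<longlongrightarrow> gen \<phi> x) (at_right 0)"
  proof (rule tendsto_at_right_sequentially[of 0 1])
    fix S :: "nat \<Rightarrow> real" assume S: "\<And>n. 0 < S n" "S \<longlonglongrightarrow> 0"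
    show "(\<lambda>n. LINT z|?K. indicator {z. S n < norm z} z * (\<phi> x - \<phi> (x + z))) \<longlonglongrightarrow> gen \<phi> x"
      unfolding gen_def
    proof (rule integral_dominated_convergence)
      show "integrable ?K (\<lambda>z. \<bar>\<phi> x - \<phi> (x + z)\<bar>)" using integrable_diff(1)[OF \<phi>] by simp
      show "AE z in ?K. (\<lambda>n. indicator {z. S n < norm z} z * (\<phi> x - \<phi> (x + z))) \<longlonglongrightarrow> \<phi> x - \<phi> (x + z)"
      proof (intro AE_I2)
        fix z :: 'a
        show "(\<lambda>n. indicator {z. S n < norm z} z * (\<phi> x - \<phi> (x + z))) \<longlonglongrightarrow> \<phi> x - \<phi> (x + z)"
        proof (cases "z = 0")
          case False
          then have "\<forall>\<^sub>F n in sequentially. S n < norm z" using S(2) by (intro order_tendstoD) auto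
          then have "\<forall>\<^sub>F n in sequentially. indicator {z. S n < norm z} z * (\<phi> x - \<phi> (x + z)) = \<phi> x - \<phi> (x + z)"
            by eventually_elim simp
          then show ?thesis by (rule tendsto_eventually)
        qed simp
      qed
    qed (auto simp: indicator_def)
  qed simp
  then have "Lim (at_right 0) (\<lambda>\<epsilon>. LINT y:{y. \<epsilon> < dist x y}|lebesgue. (\<phi> x - \<phi> y) / dist x y powr ?p) = gen \<phi> x"
    unfolding eq by (intro tendsto_Lim) auto
  then show ?thesis by (simp add: fraclap_def)
qed

lemma cNs_pos:
  assumes "0 < s" "s < 1"
  shows "0 < cNs N s"
  unfolding cNs_def using assms
  by (intro mult_pos_pos divide_pos_pos Gamma_real_pos) (auto intro: add_nonneg_pos)

section \<open>Decay of the far field\<close>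

lemma dyadic_cover:
  assumes "0 < R0"
  shows "{R0..} \<subseteq> (\<Union>k. {2 ^ k * R0 .. 2 * (2 ^ k * R0 :: real)})"
proof
  fix r :: real assume r: "r \<in> {R0..}"
  obtain n :: nat where n: "r / R0 < 2 ^ n"
    using real_arch_pow[of 2] by auto
  define k where "k = (LEAST n. r / R0 < 2 ^ n)"
  have k: "r / R0 < 2 ^ k" unfolding k_def by (rule LeastI[of _ n]) (rule n)
  then have "k \<noteq> 0" using r assms by (cases "k = 0") (auto simp: field_simps)
  then obtain j where j: "k = Suc j" by (cases k) auto
  have "\<not> r / R0 < 2 ^ j" using not_less_Least[of j "\<lambda>n. r / R0 < 2 ^ n"] j unfolding k_def by simp
  then have "r \<in> {2 ^ j * R0 .. 2 * (2 ^ j * R0)}"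
    using k assms j by (auto simp: field_simps)
  then show "r \<in> (\<Union>k. {2 ^ k * R0 .. 2 * (2 ^ k * R0)})" by blast
qed

text \<open>\<open>2 powr (- 2 * s)\<close> is the ratio of the dyadic geometric series, whose sum
  is thereby at most \<open>2 / s\<close>. The reason is ln 4 \<ge> 1, which gives
  \<open>4 powr s \<ge> 1 + s\<close>.\<close>

lemma half_le_one_minus_two_powr:
  assumes "0 < s" "s \<le> (1::real)"
  shows "s / 2 \<le> 1 - 2 powr (- 2 * s)"
proof -
  have "exp 1 \<le> (4::real)" using exp_le by linarith
  then have "1 \<le> ln (4::real)" by (subst ln_ge_iff) auto
  then have "s * 1 \<le> s * ln 4" using assms by (intro mult_left_mono) auto
  then have "1 + s \<le> exp (s * ln 4)" using exp_ge_add_one_self[of "s * ln 4"] by linarith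
  also have "\<dots> = 4 powr s" by (simp add: powr_def)
  also have "\<dots> = 2 powr (2 * s)" using powr_powr[of 2 2 s] by simp
  finally have "2 powr (- 2 * s) \<le> 1 / (1 + s)"
    using assms by (simp add: powr_minus divide_simps)
  moreover have "s / 2 \<le> 1 - 1 / (1 + s)" using assms by (simp add: divide_simps)
  ultimately show ?thesis by linarith
qed

text \<open>On a block [\<rho>, 2\<rho>] the part of \<open>m\<close> below \<delta> and the part
  above it each contribute at most \<open>\<delta> * \<rho>\<close>. With the weight at most
  \<open>\<rho> powr (- 1 - 2 * s)\<close> a block costs
  \<open>2 * \<delta> * \<rho> powr (- 2 * s)\<close>, and the blocks form a geometric
  series.\<close>

lemma dyadic_tail_bound:
  fixes m :: "real \<Rightarrow> real"
  assumes [measurable]: "m \<in> borel_measurable borel" and m0: "\<And>r. 0 \<le> m r"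
    and \<delta>: "0 < \<delta>" and R0: "1 \<le> R0" and s: "0 < s" "s < 1"
    and decay: "\<And>\<rho>. R0 \<le> \<rho> \<Longrightarrow> (\<integral>\<^sup>+r. ennreal (indicator {\<rho>..2 * \<rho>} r * indicator {r. \<delta> \<le> m r} r * m r) \<partial>lborel) \<le> ennreal (\<delta> * \<rho>)"
  shows "(\<integral>\<^sup>+r. ennreal (indicator {R0..} r * r powr (- 1 - 2 * s) * m r) \<partial>lborel) \<le> ennreal (4 * \<delta> / s)"
proof -
  let ?I = "\<lambda>k. {2 ^ k * R0 .. 2 * (2 ^ k * R0)}"
  let ?D = "\<lambda>\<rho> r. ennreal (indicator {\<rho>..2 * \<rho>} r * indicator {r. \<delta> \<le> m r} r * m r)"
  let ?P = "\<lambda>k r. ennreal (indicator (?I k) r * r powr (- 1 - 2 * s) * m r)"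
  let ?T = "\<lambda>R r. ennreal (indicator {R..} r * r powr (- 1 - 2 * s) * m r)"
  let ?Q = "\<lambda>\<rho> r. ennreal (indicator {\<rho>..2 * \<rho>} r * r powr (- 1 - 2 * s) * m r)"
  let ?q = "2 powr (- 2 * s)"
  have piece: "(\<integral>\<^sup>+r. ?P k r \<partial>lborel) \<le> ennreal (2 * \<delta> * ?q ^ k)" for k
  proof -
    define \<rho> where "\<rho> = 2 ^ k * R0"
    have p1: "(1::real) \<le> 2 ^ k" by simp
    have \<rho>: "R0 \<le> \<rho>" "0 < \<rho>" "2 ^ k \<le> \<rho>"
      using R0 p1 mult_right_mono[OF p1, of R0] mult_left_mono[OF R0, of "2 ^ k"] by (auto simp: \<rho>_def)
    let ?c = "\<rho> powr (- 1 - 2 * s)"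
    have "(\<integral>\<^sup>+r. ?Q \<rho> r \<partial>lborel)
      \<le> (\<integral>\<^sup>+r. ennreal ?c * (ennreal \<delta> * indicator {\<rho>..2 * \<rho>} r + ?D \<rho> r) \<partial>lborel)"
    proof (rule nn_integral_mono)
      fix r :: real
      show "?Q \<rho> r
        \<le> ennreal ?c * (ennreal \<delta> * indicator {\<rho>..2 * \<rho>} r + ?D \<rho> r)"
      proof (cases "r \<in> {\<rho>..2 * \<rho>}")
        case True
        have 1: "r powr (- 1 - 2 * s) \<le> ?c"
          using True \<rho> s by (intro powr_mono2') auto
        have 2: "m r \<le> \<delta> + indicator {r. \<delta> \<le> m r} r * m r"
          using \<delta> by (auto simp: indicator_def)
        have "r powr (- 1 - 2 * s) * m r \<le> ?c * (\<delta> + indicator {r. \<delta> \<le> m r} r * m r)"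
          using 1 2 m0 by (intro mult_mono) auto
        then have "ennreal (r powr (- 1 - 2 * s) * m r) \<le> ennreal (?c * (\<delta> + indicator {r. \<delta> \<le> m r} r * m r))"
          by (rule ennreal_leI)
        also have "\<dots> = ennreal ?c * (ennreal \<delta> + ennreal (indicator {r. \<delta> \<le> m r} r * m r))"
          using \<delta> m0[of r] by (subst ennreal_mult) (auto simp: ennreal_plus)
        finally show ?thesis using True by simp
      qed simp
    qed
    also have "\<dots> = ennreal ?c * (\<integral>\<^sup>+r. (ennreal \<delta> * indicator {\<rho>..2 * \<rho>} r + ?D \<rho> r) \<partial>lborel)"
      by (rule nn_integral_cmult) measurable
    also have "\<dots> = ennreal ?c * (ennreal \<delta> * ennreal \<rho> + (\<integral>\<^sup>+r. ?D \<rho> r \<partial>lborel))"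
      using \<rho>(2) by (subst nn_integral_add) (auto simp: nn_integral_cmult_indicator)
    also have "\<dots> \<le> ennreal ?c * (ennreal \<delta> * ennreal \<rho> + ennreal (\<delta> * \<rho>))"
      by (intro mult_left_mono add_left_mono decay \<rho>) simp
    also have "\<dots> = ennreal (?c * (\<delta> * \<rho> + \<delta> * \<rho>))"
      using \<delta> \<rho> by (simp add: ennreal_mult'[symmetric] ennreal_plus[symmetric] del: ennreal_plus)
    also have "?c * (\<delta> * \<rho> + \<delta> * \<rho>) = 2 * \<delta> * \<rho> powr (- 2 * s)"
      using \<rho> by (simp add: powr_diff powr_minus field_simps)
    also have "ennreal (2 * \<delta> * \<rho> powr (- 2 * s)) \<le> ennreal (2 * \<delta> * ?q ^ k)"
    proof (intro ennreal_leI mult_left_mono)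
      have "\<rho> powr (- 2 * s) \<le> (2 ^ k) powr (- 2 * s)"
        using \<rho> s by (intro powr_mono2') auto
      also have "\<dots> = ?q ^ k"
        by (simp add: powr_realpow[symmetric] powr_powr mult_ac)
      finally show "\<rho> powr (- 2 * s) \<le> ?q ^ k" .
    qed (use \<delta> in simp)
    finally show ?thesis by (simp add: \<rho>_def)
  qed
  have q: "0 \<le> ?q" "?q < 1" using s by (auto simp: powr_less_one)
  have sums: "(\<lambda>k. 2 * \<delta> * ?q ^ k) sums (2 * \<delta> * (1 / (1 - ?q)))"
    using q by (intro sums_mult geometric_sums) auto
  have "(\<integral>\<^sup>+r. ?T R0 r \<partial>lborel)
    \<le> (\<integral>\<^sup>+r. (\<Sum>k. ?P k r) \<partial>lborel)"
  proof (rule nn_integral_mono)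
    fix r :: real
    show "?T R0 r \<le> (\<Sum>k. ?P k r)"
    proof (cases "r \<in> {R0..}")
      case True
      then obtain k where k: "r \<in> ?I k" using dyadic_cover[of R0] R0 by fastforce
      have "?T R0 r = (\<Sum>k\<in>{k}. ?P k r)"
        using True k by simp
      also have "\<dots> \<le> (\<Sum>k. ?P k r)"
        by (rule sum_le_suminf) auto
      finally show ?thesis .
    qed simp
  qed
  also have "\<dots> = (\<Sum>k. \<integral>\<^sup>+r. ?P k r \<partial>lborel)"
    by (rule nn_integral_suminf) measurable
  also have "\<dots> \<le> (\<Sum>k. ennreal (2 * \<delta> * ?q ^ k))"
    by (intro suminf_le piece) auto
  also have "\<dots> = ennreal (2 * \<delta> * (1 / (1 - ?q)))"
    using sums \<delta> by (intro suminf_ennreal_eq) auto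
  also have "\<dots> \<le> ennreal (4 * \<delta> / s)"
  proof (rule ennreal_leI)
    have "s / 2 \<le> 1 - ?q" using s by (intro half_le_one_minus_two_powr) auto
    then have "1 / (1 - ?q) \<le> 1 / (s / 2)" using s by (intro divide_left_mono) auto
    then have "2 * \<delta> * (1 / (1 - ?q)) \<le> 2 * \<delta> * (1 / (s / 2))" using \<delta> by (intro mult_left_mono) auto
    then show "2 * \<delta> * (1 / (1 - ?q)) \<le> 4 * \<delta> / s" by simp
  qed
  finally show ?thesis .
qed

text \<open>A bounded range of radii contributes a constant, negligible against 1/s, so only the
  tail beyond a radius depending on \<delta> has to be small.\<close>

lemma radial_decay:
  fixes m :: "real \<Rightarrow> real"
  assumes [measurable]: "m \<in> borel_measurable borel" and m0: "\<And>r. 0 \<le> m r"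
    and R: "1 \<le> R"
    and loc: "\<And>\<rho>. \<exists>M. AE r in lborel. R \<le> r \<longrightarrow> r \<le> \<rho> \<longrightarrow> m r \<le> M"
    and decay: "\<And>\<delta>. 0 < \<delta> \<Longrightarrow> \<exists>R0\<ge>R. \<forall>\<rho>\<ge>R0. (\<integral>\<^sup>+r. ennreal (indicator {\<rho>..2 * \<rho>} r * indicator {r. \<delta> \<le> m r} r * m r) \<partial>lborel) \<le> ennreal (\<delta> * \<rho>)"
    and \<eta>: "0 < \<eta>"
  shows "\<exists>s0>0. \<forall>s. 0 < s \<longrightarrow> s < s0 \<longrightarrow>
    (\<integral>\<^sup>+r. ennreal (indicator {R..} r * r powr (- 1 - 2 * s) * m r) \<partial>lborel) \<le> ennreal (\<eta> / s)"
proof -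
  let ?T = "\<lambda>s R r. ennreal (indicator {R..} r * r powr (- 1 - 2 * s) * m r)"
  \<comment> \<open>The tail costs \<open>4 * \<delta> / s\<close>, half of the budget;
    \<open>s0\<close> is chosen so that the range from \<open>R\<close> to \<open>R0\<close> fits
    into the other half.\<close>
  define \<delta> where "\<delta> = \<eta> / 8"
  have \<delta>: "0 < \<delta>" using \<eta> by (simp add: \<delta>_def)
  obtain R0 where R0: "R \<le> R0" and dec: "\<And>\<rho>. R0 \<le> \<rho> \<Longrightarrow> (\<integral>\<^sup>+r. ennreal (indicator {\<rho>..2 * \<rho>} r * indicator {r. \<delta> \<le> m r} r * m r) \<partial>lborel) \<le> ennreal (\<delta> * \<rho>)"
    using decay[OF \<delta>] by blast
  obtain M' where M': "AE r in lborel. R \<le> r \<longrightarrow> r \<le> R0 \<longrightarrow> m r \<le> M'" using loc by blast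
  define M where "M = max M' 0"
  have M: "AE r in lborel. R \<le> r \<longrightarrow> r \<le> R0 \<longrightarrow> m r \<le> M" "0 \<le> M"
    using M' by (auto simp: M_def le_max_iff_disj)
  define s0 where "s0 = min 1 (\<eta> / (2 * (M * R0 + 1)))"
  have MR: "0 \<le> M * R0" using M R R0 by simp
  have s0: "0 < s0" using \<eta> MR by (simp add: s0_def)
  show ?thesis
  proof (intro exI[of _ s0] conjI allI impI s0)
    fix s assume s: "0 < s" "s < s0"
    have "(\<integral>\<^sup>+r. ?T s R r \<partial>lborel)
      \<le> (\<integral>\<^sup>+r. ennreal M * indicator {R..R0} r + ?T s R0 r \<partial>lborel)"
    proof (rule nn_integral_mono_AE, use M(1) in eventually_elim)
      fix r :: real assume m: "R \<le> r \<longrightarrow> r \<le> R0 \<longrightarrow> m r \<le> M"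
      show "?T s R r
        \<le> ennreal M * indicator {R..R0} r + ?T s R0 r"
      proof (cases "r \<in> {R..R0}")
        case True
        have "r powr (- 1 - 2 * s) \<le> 1 powr (- 1 - 2 * s)"
          using True R s by (intro powr_mono2') auto
        then have "r powr (- 1 - 2 * s) * m r \<le> 1 * M" using m True m0 by (intro mult_mono) auto
        then have "ennreal (r powr (- 1 - 2 * s) * m r) \<le> ennreal M" by (simp add: ennreal_leI)
        also have "\<dots> \<le> ennreal M + ?T s R0 r" by simp
        finally show ?thesis using True by simp
      qed (auto simp: indicator_def)
    qed
    also have "\<dots> = ennreal M * ennreal (R0 - R) + (\<integral>\<^sup>+r. ?T s R0 r \<partial>lborel)"
      using R0 by (subst nn_integral_add) (auto simp: nn_integral_cmult_indicator)
    also have "\<dots> \<le> ennreal M * ennreal (R0 - R) + ennreal (4 * \<delta> / s)"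
      using R R0 s dec by (intro add_left_mono dyadic_tail_bound m0 \<delta>) (auto simp: s0_def)
    also have "\<dots> = ennreal (M * (R0 - R) + 4 * \<delta> / s)"
      using M R0 \<delta> s by (simp add: ennreal_mult'[symmetric] ennreal_plus[symmetric] del: ennreal_plus)
    also have "\<dots> \<le> ennreal (\<eta> / s)"
    proof (rule ennreal_leI)
      have "s * (2 * (M * R0 + 1)) \<le> \<eta>"
        using s MR by (auto simp: s0_def pos_less_divide_eq)
      moreover have "s * (M * (R0 - R)) \<le> s * (M * R0 + 1)"
        using s M(2) R by (intro mult_left_mono) (auto simp: algebra_simps intro: add_increasing2 mult_nonneg_nonneg)
      ultimately have "s * (M * (R0 - R)) \<le> \<eta> / 2" by (simp add: algebra_simps)
      then have "M * (R0 - R) \<le> (\<eta> / 2) / s" using s by (simp add: field_simps)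
      then show "M * (R0 - R) + 4 * \<delta> / s \<le> \<eta> / s" by (simp add: \<delta>_def field_simps)
    qed
    finally show "(\<integral>\<^sup>+r. ?T s R r \<partial>lborel) \<le> ennreal (\<eta> / s)" .
  qed
qed

section \<open>Borel representatives and spherical means\<close>

lemma lebesgue_transfer:
  fixes f f' :: "'a::euclidean_space \<Rightarrow> real"
  assumes f': "f' \<in> borel_measurable borel" and ae: "AE x in lborel. f x = f' x"
  shows "f \<in> borel_measurable lebesgue" "integral\<^sup>L lebesgue f = integral\<^sup>L lborel f'"
    "integrable lebesgue f \<longleftrightarrow> integrable lborel f'"
proof -
  have m': "f' \<in> borel_measurable lebesgue" using f' by (simp add: measurable_completion)
  have ae': "AE x in lebesgue. f' x = f x" using ae by (intro AE_completion) (auto elim: eventually_mono)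
  show m: "f \<in> borel_measurable lebesgue" by (rule borel_measurable_AE[OF m' ae'])
  have "integral\<^sup>L lebesgue f = integral\<^sup>L lebesgue f'"
    using ae' by (intro integral_cong_AE m m') (auto elim: eventually_mono)
  also have "\<dots> = integral\<^sup>L lborel f'" using f' by (intro integral_completion) simp
  finally show "integral\<^sup>L lebesgue f = integral\<^sup>L lborel f'" .
  have "integrable lebesgue f \<longleftrightarrow> integrable lebesgue f'"
    using ae' by (intro integrable_cong_AE m m') (auto elim: eventually_mono)
  also have "\<dots> \<longleftrightarrow> integrable lborel f'" using f' by (intro integrable_completion) simp
  finally show "integrable lebesgue f \<longleftrightarrow> integrable lborel f'" .
qed

text \<open>If \<open>f\<close> is not integrable, its Bochner integral is 0 by convention and the
  bound is trivial. This covers radii for which a Lebesgue measurable function has a non-measurable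
  trace on the sphere.\<close>

lemma abs_integral_le_nn_integral:
  fixes f :: "'a \<Rightarrow> real"
  assumes "(\<integral>\<^sup>+x. ennreal \<bar>f x\<bar> \<partial>M) \<le> ennreal c" "0 \<le> c"
  shows "\<bar>integral\<^sup>L M f\<bar> \<le> c"
proof (cases "integrable M f")
  case True
  have "ennreal (norm (integral\<^sup>L M f)) \<le> (\<integral>\<^sup>+x. ennreal (norm (f x)) \<partial>M)"
    by (rule integral_norm_bound_ennreal[OF True])
  then have "ennreal \<bar>integral\<^sup>L M f\<bar> \<le> ennreal c" using assms(1) by simp
  then show ?thesis using assms(2) by (simp add: ennreal_le_iff)
qed (use assms in \<open>simp add: not_integrable_integral_eq\<close>)

lemma powr_neg_lipschitz:
  fixes a b c p :: real
  assumes "0 < c" "c \<le> a" "c \<le> b" "0 \<le> p"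
  shows "\<bar>a powr - p - b powr - p\<bar> \<le> p * c powr (- p - 1) * \<bar>a - b\<bar>"
proof -
  have "norm (a powr - p - b powr - p) \<le> (p * c powr (- p - 1)) * norm (a - b)"
  proof (rule field_differentiable_bound[of "{c..}"])
    show "((\<lambda>x. x powr - p) has_field_derivative (- p * x powr (- p - 1))) (at x within {c..})" if "x \<in> {c..}" for x
      using that assms by (auto intro!: derivative_eq_intros)
    show "norm (- p * x powr (- p - 1)) \<le> p * c powr (- p - 1)" if "x \<in> {c..}" for x
      using that assms by (auto simp: abs_mult intro!: mult_left_mono powr_mono2')
  qed (use assms in auto)
  then show ?thesis by simp
qed

text \<open>The counterpart of \<open>sph_mean\<close> over \<open>lborel\<close>. For Borel
  \<open>g\<close> it is Borel measurable in \<open>r\<close>, so it can itself be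
  integrated.\<close>

definition radial_mean :: "('a::euclidean_space \<Rightarrow> real) \<Rightarrow> real \<Rightarrow> real" where
  "radial_mean g r = (LINT x|lborel. indicator (ball 0 1) x * g ((r / norm x) *\<^sub>R x)) / measure lborel (ball (0::'a) 1)"

lemma borel_measurable_radial_mean [measurable]:
  assumes [measurable]: "g \<in> borel_measurable borel"
  shows "radial_mean g \<in> borel_measurable borel"
  unfolding radial_mean_def[abs_def] by measurable

lemma AE_sph_mean_eq:
  fixes g0 gb :: "'a::euclidean_space \<Rightarrow> real"
  assumes [measurable]: "gb \<in> borel_measurable borel" and ae: "AE x in lborel. g0 x = gb x"
  shows "AE r in lborel. 0 < r \<longrightarrow> sph_mean g0 r = radial_mean gb r"
  using AE_polar[OF ae]
proof eventually_elim
  fix r :: real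
  assume *: "0 < r \<longrightarrow> (AE x in lborel. x \<in> ball 0 1 \<longrightarrow> g0 ((r / norm x) *\<^sub>R x) = gb ((r / norm x) *\<^sub>R x))"
  show "0 < r \<longrightarrow> sph_mean g0 r = radial_mean gb r"
  proof
    assume "0 < r"
    with * have "AE x in lborel. x \<in> ball 0 1 \<longrightarrow> g0 ((r / norm x) *\<^sub>R x) = gb ((r / norm x) *\<^sub>R x)" by simp
    then have "AE x in lborel. indicator (ball 0 1) x * g0 ((r / norm x) *\<^sub>R x) = indicator (ball 0 1) x * gb ((r / norm x) *\<^sub>R x)"
      by eventually_elim (auto simp: indicator_def)
    then have "integral\<^sup>L lebesgue (\<lambda>x. indicator (ball 0 1) x * g0 ((r / norm x) *\<^sub>R x))
      = integral\<^sup>L lborel (\<lambda>x. indicator (ball 0 1) x * gb ((r / norm x) *\<^sub>R x))"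
      by (intro lebesgue_transfer(2)) measurable
    then show "sph_mean g0 r = radial_mean gb r"
      by (simp add: sph_mean_def radial_mean_def set_lebesgue_integral_def)
  qed
qed

lemma abs_sph_mean_le:
  fixes g0 :: "'a::euclidean_space \<Rightarrow> real"
  assumes M: "\<And>x. norm x \<le> \<rho> \<Longrightarrow> \<bar>g0 x\<bar> \<le> M" and r: "0 < r" "r \<le> \<rho>"
  shows "\<bar>sph_mean g0 r\<bar> \<le> M"
proof -
  let ?V = "measure lborel (ball (0::'a) 1)"
  have V: "0 < ?V" using content_ball_pos[of 1 "0::'a"] by simp
  have M0: "0 \<le> M" using M[of 0] r by fastforce
  have n: "norm ((r / norm x) *\<^sub>R x) \<le> \<rho>" for x :: 'a
    using r by (cases "x = 0") auto
  have "\<bar>LINT x|lebesgue. indicator (ball 0 1) x * g0 ((r / norm x) *\<^sub>R x)\<bar> \<le> M * ?V"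
  proof (rule abs_integral_le_nn_integral)
    have "(\<integral>\<^sup>+x. ennreal \<bar>indicator (ball 0 1) x * g0 ((r / norm x) *\<^sub>R x)\<bar> \<partial>lebesgue)
      \<le> (\<integral>\<^sup>+x. ennreal M * indicator (ball 0 1) (x::'a) \<partial>lebesgue)"
      using M[OF n] by (intro nn_integral_mono) (auto simp: indicator_def intro: ennreal_leI)
    also have "\<dots> = ennreal M * emeasure lebesgue (ball (0::'a) 1)"
      by (rule nn_integral_cmult_indicator) auto
    also have "emeasure lebesgue (ball (0::'a) 1) = ennreal ?V"
      using emeasure_lborel_ball_finite[of "0::'a" 1] by (subst emeasure_completion) (auto intro: emeasure_eq_ennreal_measure)
    also have "ennreal M * ennreal ?V = ennreal (M * ?V)" using M0 by (rule ennreal_mult'[symmetric])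
    finally show "(\<integral>\<^sup>+x. ennreal \<bar>indicator (ball 0 1) x * g0 ((r / norm x) *\<^sub>R x)\<bar> \<partial>lebesgue) \<le> ennreal (M * ?V)" .
  qed (use M0 in simp)
  then show ?thesis using V by (simp add: sph_mean_def set_lebesgue_integral_def abs_divide divide_simps)
qed

text \<open>The weight is constant on spheres and leaves the inner integral, so the cancellations of
  \<open>gb\<close> within a sphere survive: only its mean remains.\<close>

lemma integral_radial_weight:
  fixes gb :: "'a::euclidean_space \<Rightarrow> real"
  assumes [measurable]: "gb \<in> borel_measurable borel" and R: "0 < R"
    and int: "integrable lborel (\<lambda>x. indicator {x. R \<le> norm x} x * (gb x * norm x powr - (real DIM('a) + 2 * s)))"
  shows "(LINT x|lborel. indicator {x. R \<le> norm x} x * (gb x * norm x powr - (real DIM('a) + 2 * s)))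
    = sphere_area TYPE('a) * (LINT r|lborel. indicator {R..} r * r powr (- 1 - 2 * s) * radial_mean gb r)"
proof -
  let ?V = "measure lborel (ball (0::'a) 1)" and ?p = "real DIM('a) + 2 * s"
  have V: "0 < ?V" using content_ball_pos[of 1 "0::'a"] by simp
  let ?G = "\<lambda>x. indicator {x. R \<le> norm x} x * (gb x * norm x powr - ?p)"
  have "(LINT x|lborel. ?G x) = (LINT r|lborel. indicator {0<..} r * (real DIM('a) * r ^ (DIM('a) - 1)) *
     (LINT x|lborel. indicator (ball 0 1) x * ?G ((r / norm x) *\<^sub>R x)))"
    by (rule integral_polar[OF int])
  also have "\<dots> = (LINT r|lborel. sphere_area TYPE('a) * (indicator {R..} r * r powr (- 1 - 2 * s) * radial_mean gb r))"
  proof (rule Bochner_Integration.integral_cong[OF refl])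
    fix r :: real
    show "indicator {0<..} r * (real DIM('a) * r ^ (DIM('a) - 1)) *
       (LINT x|lborel. indicator (ball 0 1) x * ?G ((r / norm x) *\<^sub>R x))
      = sphere_area TYPE('a) * (indicator {R..} r * r powr (- 1 - 2 * s) * radial_mean gb r)"
    proof (cases "0 < r")
      case True
      have "(LINT x|lborel. indicator (ball 0 1) x * ?G ((r / norm x) *\<^sub>R x))
        = (LINT x|lborel. (indicator {R..} r * r powr - ?p) * (indicator (ball 0 1) x * gb ((r / norm x) *\<^sub>R x)))"
      proof (rule integral_cong_AE)
        show "AE x in lborel. indicator (ball 0 1) x * ?G ((r / norm x) *\<^sub>R x)
          = (indicator {R..} r * r powr - ?p) * (indicator (ball 0 1) x * gb ((r / norm x) *\<^sub>R x))"
          using AE_lborel_nonzero by eventually_elim (use True in \<open>auto simp: indicator_def\<close>)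
      qed measurable
      also have "\<dots> = indicator {R..} r * r powr - ?p * (?V * radial_mean gb r)"
        using V by (simp add: radial_mean_def)
      finally have e: "(LINT x|lborel. indicator (ball 0 1) x * ?G ((r / norm x) *\<^sub>R x))
        = indicator {R..} r * r powr - ?p * (?V * radial_mean gb r)" .
      have "r ^ (DIM('a) - 1) * r powr - ?p = r powr (real (DIM('a) - 1) + - ?p)"
        using True by (simp only: powr_realpow[symmetric] powr_add)
      also have "real (DIM('a) - 1) + - ?p = - 1 - 2 * s"
        by (simp add: of_nat_diff Suc_leI)
      finally have pw: "r powr (- 1 - 2 * s) = r ^ (DIM('a) - 1) * r powr - ?p" ..
      show ?thesis
        unfolding e pw sphere_area_def using True by simp
    next
      case False
      then show ?thesis using R by (simp add: indicator_def)
    qed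
  qed
  also have "\<dots> = sphere_area TYPE('a) * (LINT r|lborel. indicator {R..} r * r powr (- 1 - 2 * s) * radial_mean gb r)"
    by simp
  finally show ?thesis .
qed

lemma sph_mean_decay_transfer:
  fixes g0 gb :: "'a::euclidean_space \<Rightarrow> real"
  assumes [measurable]: "gb \<in> borel_measurable borel" and ae: "AE x in lborel. g0 x = gb x"
    and loc: "\<And>\<rho>. \<exists>M. \<forall>x. norm x \<le> \<rho> \<longrightarrow> \<bar>g0 x\<bar> \<le> M"
    and decay: "(\<lambda>R. LINT r:{r \<in> {R..2*R}. \<bar>sph_mean g0 r\<bar> \<ge> \<delta>}|lebesgue. \<bar>sph_mean g0 r\<bar>) \<in> o(\<lambda>R. R)"
    and \<delta>: "0 < \<delta>" and R: "0 < R"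
  shows "\<exists>R0\<ge>R. \<forall>\<rho>\<ge>R0. (\<integral>\<^sup>+r. ennreal (indicator {\<rho>..2 * \<rho>} r * indicator {r. \<delta> \<le> \<bar>radial_mean gb r\<bar>} r * \<bar>radial_mean gb r\<bar>) \<partial>lborel) \<le> ennreal (\<delta> * \<rho>)"
proof -
  have AEeq: "AE r in lborel. 0 < r \<longrightarrow> sph_mean g0 r = radial_mean gb r"
    by (rule AE_sph_mean_eq[OF assms(1) ae])
  let ?m = "\<lambda>r. \<bar>radial_mean gb r\<bar>"
  have "\<forall>\<^sub>F R in at_top. norm (LINT r:{r \<in> {R..2*R}. \<bar>sph_mean g0 r\<bar> \<ge> \<delta>}|lebesgue. \<bar>sph_mean g0 r\<bar>) \<le> \<delta> * norm R"
    by (rule landau_o.smallD[OF decay \<delta>])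
  then obtain R1 where R1: "\<And>\<rho>. R1 \<le> \<rho> \<Longrightarrow>
      \<bar>LINT r:{r \<in> {\<rho>..2*\<rho>}. \<bar>sph_mean g0 r\<bar> \<ge> \<delta>}|lebesgue. \<bar>sph_mean g0 r\<bar>\<bar> \<le> \<delta> * \<bar>\<rho>\<bar>"
    unfolding eventually_at_top_linorder by auto
  show ?thesis
  proof (intro exI[of _ "max R R1"] conjI allI impI)
    fix \<rho> assume "max R R1 \<le> \<rho>"
    then have \<rho>: "0 < \<rho>" "R1 \<le> \<rho>" using R by auto
    let ?f = "\<lambda>r. indicator {\<rho>..2 * \<rho>} r * indicator {r. \<delta> \<le> ?m r} r * ?m r"
    have "AE r in lborel. indicator {r \<in> {\<rho>..2*\<rho>}. \<bar>sph_mean g0 r\<bar> \<ge> \<delta>} r *\<^sub>R \<bar>sph_mean g0 r\<bar> = ?f r"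
      using AEeq
    proof eventually_elim
      fix r :: real assume "0 < r \<longrightarrow> sph_mean g0 r = radial_mean gb r"
      then show "indicator {r \<in> {\<rho>..2*\<rho>}. \<bar>sph_mean g0 r\<bar> \<ge> \<delta>} r *\<^sub>R \<bar>sph_mean g0 r\<bar> = ?f r"
        using \<rho>(1) by (cases "0 < r") (auto simp: indicator_def)
    qed
    then have "(LINT r:{r \<in> {\<rho>..2*\<rho>}. \<bar>sph_mean g0 r\<bar> \<ge> \<delta>}|lebesgue. \<bar>sph_mean g0 r\<bar>) = integral\<^sup>L lborel ?f"
      unfolding set_lebesgue_integral_def by (intro lebesgue_transfer(2)) measurable
    then have le: "integral\<^sup>L lborel ?f \<le> \<delta> * \<rho>" using R1[OF \<rho>(2)] \<rho>(1) by simp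
    obtain M where M: "\<And>x. norm x \<le> 2 * \<rho> \<Longrightarrow> \<bar>g0 x\<bar> \<le> M" using loc by blast
    \<comment> \<open>Without integrability the Bochner integral would be 0 and the bound
      \<open>le\<close> would say nothing about the nonnegative integral. Local boundedness of
      \<open>g0\<close> excludes this.\<close>
    have i: "integrable lborel ?f"
    proof (rule Bochner_Integration.integrable_bound)
      have "integrable lborel (indicator {\<rho>..2 * \<rho>} :: real \<Rightarrow> real)"
        by (intro integrable_real_indicator) (auto simp: emeasure_lborel_Icc_eq)
      then show "integrable lborel (\<lambda>r. indicator {\<rho>..2 * \<rho>} r * M)" by simp
      show "AE r in lborel. norm (?f r) \<le> norm (indicator {\<rho>..2 * \<rho>} r * M)"
        using AEeq
      proof eventually_elim
        fix r :: real assume *: "0 < r \<longrightarrow> sph_mean g0 r = radial_mean gb r"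
        show "norm (?f r) \<le> norm (indicator {\<rho>..2 * \<rho>} r * M)"
          using abs_sph_mean_le[of "2 * \<rho>" g0 M r, OF M] * \<rho>(1) by (auto simp: indicator_def)
      qed
    qed measurable
    have "(\<integral>\<^sup>+r. ennreal (?f r) \<partial>lborel) = ennreal (integral\<^sup>L lborel ?f)"
      by (rule nn_integral_eq_integral[OF i]) auto
    also have "\<dots> \<le> ennreal (\<delta> * \<rho>)" using le by (rule ennreal_leI)
    finally show "(\<integral>\<^sup>+r. ennreal (?f r) \<partial>lborel) \<le> ennreal (\<delta> * \<rho>)" .
  qed simp
qed

section \<open>The kernel with shifted centre\<close>

lemma norm_shift_ge_half:
  fixes x y :: "'a::euclidean_space"
  assumes "R \<le> norm x" "norm y \<le> R / 2"
  shows "norm x / 2 \<le> norm (x - y)"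
  using norm_triangle_ineq2[of x y] assms by linarith

text \<open>For \<open>norm x \<ge> 1\<close> one has
  \<open>norm x / 2 \<ge> (1 + norm x) / 4\<close>; hence shifted kernels are dominated by the
  weight of L^1_s.\<close>

lemma powr_weight_le:
  fixes x :: "'a::euclidean_space"
  assumes "1 \<le> norm x" "norm x / 2 \<le> t" "0 \<le> p"
  shows "t powr - p \<le> 4 powr p * (1 + norm x) powr - p"
proof -
  have "t powr - p \<le> ((1 + norm x) / 4) powr - p"
    using assms by (intro powr_mono2') auto
  also have "\<dots> = 4 powr p * (1 + norm x) powr - p"
    by (simp add: powr_divide powr_minus divide_simps)
  finally show ?thesis .
qed

lemma integrable_far_field:
  fixes gb :: "'a::euclidean_space \<Rightarrow> real"
  assumes [measurable]: "gb \<in> borel_measurable borel" and R: "1 \<le> R" and y: "norm y \<le> R / 2" and s: "0 < s"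
    and int: "integrable lborel (\<lambda>x. \<bar>gb x\<bar> * (1 + norm x) powr - (real DIM('a) + 2 * s))"
  shows "integrable lborel (\<lambda>x. indicator {x. R \<le> norm x} x * (gb x * norm (x - y) powr - (real DIM('a) + 2 * s)))"
proof (rule Bochner_Integration.integrable_bound)
  let ?p = "real DIM('a) + 2 * s"
  show "integrable lborel (\<lambda>x. 4 powr ?p * (\<bar>gb x\<bar> * (1 + norm x) powr - ?p))" using int by simp
  have "\<bar>gb x\<bar> * norm (x - y) powr - ?p \<le> \<bar>gb x\<bar> * (4 powr ?p * (1 + norm x) powr - ?p)" if "R \<le> norm x" for x
    using that R s norm_shift_ge_half[OF that y] by (intro mult_left_mono powr_weight_le) auto
  then show "AE x in lborel. norm (indicator {x. R \<le> norm x} x * (gb x * norm (x - y) powr - ?p))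
      \<le> norm (4 powr ?p * (\<bar>gb x\<bar> * (1 + norm x) powr - ?p))"
    by (auto simp: indicator_def abs_mult mult_ac intro!: AE_I2)
qed measurable

text \<open>With centre 0 the kernel is radial, only spherical means enter, and
  \<open>radial_decay\<close> applies. Moving the centre to \<open>y\<close> changes the integral by
  an amount bounded independently of \<open>s\<close> and \<open>y\<close>, which \<eta> / s absorbs
  for small \<open>s\<close>.\<close>

lemma far_field_decay:
  fixes g0 gb :: "'a::euclidean_space \<Rightarrow> real"
  assumes gb [measurable]: "gb \<in> borel_measurable borel" and ae: "AE x in lborel. g0 x = gb x"
    and loc: "\<And>\<rho>. \<exists>M. \<forall>x. norm x \<le> \<rho> \<longrightarrow> \<bar>g0 x\<bar> \<le> M"
    and decay: "\<And>\<delta>. 0 < \<delta> \<Longrightarrow> (\<lambda>R. LINT r:{r \<in> {R..2*R}. \<bar>sph_mean g0 r\<bar> \<ge> \<delta>}|lebesgue. \<bar>sph_mean g0 r\<bar>) \<in> o(\<lambda>R. R)"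
    and int: "\<And>s. 0 < s \<Longrightarrow> s < 1 \<Longrightarrow> integrable lborel (\<lambda>x. \<bar>gb x\<bar> * (1 + norm x) powr - (real DIM('a) + 2 * s))"
    and R: "1 \<le> R" and \<eta>: "0 < \<eta>"
  shows "\<exists>s0>0. \<forall>s. 0 < s \<longrightarrow> s < s0 \<longrightarrow> (\<forall>y. norm y \<le> R / 2 \<longrightarrow>
    \<bar>LINT x|lborel. indicator {x. R \<le> norm x} x * (gb x * norm (x - y) powr - (real DIM('a) + 2 * s))\<bar> \<le> \<eta> / s)"
proof -
  let ?\<sigma> = "sphere_area TYPE('a)" and ?N = "real DIM('a)"
  have \<sigma>: "0 < ?\<sigma>" by (rule sphere_area_pos)
  have AEeq: "AE r in lborel. 0 < r \<longrightarrow> sph_mean g0 r = radial_mean gb r"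
    by (rule AE_sph_mean_eq[OF gb ae])
  \<comment> \<open>The divisor \<open>2 * ?\<sigma>\<close> anticipates the sphere area that
    \<open>integral_radial_weight\<close> restores and reserves half of the budget for the
    shift.\<close>
  have "\<exists>s1>0. \<forall>s. 0 < s \<longrightarrow> s < s1 \<longrightarrow>
    (\<integral>\<^sup>+r. ennreal (indicator {R..} r * r powr (- 1 - 2 * s) * \<bar>radial_mean gb r\<bar>) \<partial>lborel) \<le> ennreal (\<eta> / (2 * ?\<sigma>) / s)"
  proof (rule radial_decay[OF _ _ R])
    show "\<exists>M. AE r in lborel. R \<le> r \<longrightarrow> r \<le> \<rho> \<longrightarrow> \<bar>radial_mean gb r\<bar> \<le> M" for \<rho>
    proof -
      obtain M where M: "\<And>x. norm x \<le> \<rho> \<Longrightarrow> \<bar>g0 x\<bar> \<le> M" using loc by blast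
      have "AE r in lborel. R \<le> r \<longrightarrow> r \<le> \<rho> \<longrightarrow> \<bar>radial_mean gb r\<bar> \<le> M"
        using AEeq
      proof eventually_elim
        fix r assume "0 < r \<longrightarrow> sph_mean g0 r = radial_mean gb r"
        then show "R \<le> r \<longrightarrow> r \<le> \<rho> \<longrightarrow> \<bar>radial_mean gb r\<bar> \<le> M"
          using abs_sph_mean_le[of \<rho> g0 M r, OF M] R by auto
      qed
      then show ?thesis ..
    qed
    show "\<exists>R0\<ge>R. \<forall>\<rho>\<ge>R0. (\<integral>\<^sup>+r. ennreal (indicator {\<rho>..2 * \<rho>} r * indicator {r. \<delta> \<le> \<bar>radial_mean gb r\<bar>} r * \<bar>radial_mean gb r\<bar>) \<partial>lborel) \<le> ennreal (\<delta> * \<rho>)"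
      if "0 < \<delta>" for \<delta>
      using R by (intro sph_mean_decay_transfer[OF gb ae loc decay] that) auto
  qed (use \<eta> \<sigma> in auto)
  then obtain s1 where s1: "0 < s1" and radial: "\<And>s. 0 < s \<Longrightarrow> s < s1 \<Longrightarrow>
    (\<integral>\<^sup>+r. ennreal (indicator {R..} r * r powr (- 1 - 2 * s) * \<bar>radial_mean gb r\<bar>) \<partial>lborel) \<le> ennreal (\<eta> / (2 * ?\<sigma>) / s)"
    by blast
  \<comment> \<open>The exponent s = 1/2 gives the weight of order N + 1, which dominates the kernel
    difference for all small \<open>s\<close> simultaneously.\<close>
  have "integrable lborel (\<lambda>x. \<bar>gb x\<bar> * (1 + norm x) powr - (?N + 2 * (1 / 2)))" by (rule int) auto
  then have intA: "integrable lborel (\<lambda>x. \<bar>gb x\<bar> * (1 + norm x) powr - (?N + 1))" by simp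
  define A where "A = (LINT x|lborel. \<bar>gb x\<bar> * (1 + norm x) powr - (?N + 1))"
  have A: "0 \<le> A" unfolding A_def by (intro Bochner_Integration.integral_nonneg) simp
  \<comment> \<open>Mean value bound with exponent at most N + 1, the factor
    \<open>4 powr (?N + 2)\<close> from passing to the weight, and the displacement
    \<open>norm y \<le> R / 2\<close>.\<close>
  define c where "c = (?N + 1) * 4 powr (?N + 2) * (R / 2)"
  have c: "0 \<le> c" using R by (simp add: c_def)
  define s0 where "s0 = min (min s1 (1 / 2)) (\<eta> / (2 * (c * A + 1)))"
  have cA: "0 \<le> c * A" using c A by simp
  have s0: "0 < s0" using s1 \<eta> cA by (simp add: s0_def)
  show ?thesis
  proof (intro exI[of _ s0] conjI allI impI s0)
    fix s and y :: 'a assume s: "0 < s" "s < s0" and y: "norm y \<le> R / 2"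
    have s': "s < s1" "s < 1 / 2" "s < 1" "s < \<eta> / (2 * (c * A + 1))" using s by (auto simp: s0_def)
    let ?p = "?N + 2 * s"
    let ?I = "indicator {x::'a. R \<le> norm x}"
  let ?f = "\<lambda>y x. ?I x * (gb x * norm (x - y) powr - ?p)"
  let ?h = "\<lambda>x. ?I x * (gb x * norm x powr - ?p)"
  let ?d = "\<lambda>y x. norm (x - y) powr - ?p - norm x powr - ?p"
  let ?w = "\<lambda>x. (1 + norm x) powr - (?N + 1)"
    have i0: "integrable lborel (\<lambda>x. ?I x * (gb x * norm (x - 0) powr - ?p))"
      using R by (intro integrable_far_field[OF gb R _ s(1) int] s s') auto
    have iy: "integrable lborel (\<lambda>x. ?f y x)"
      by (intro integrable_far_field[OF gb R y s(1) int] s s')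
    have T0: "\<bar>LINT x|lborel. ?h x\<bar> \<le> \<eta> / 2 / s"
    proof -
      have "(LINT x|lborel. ?h x)
          = ?\<sigma> * (LINT r|lborel. indicator {R..} r * r powr (- 1 - 2 * s) * radial_mean gb r)"
        using i0 R by (intro integral_radial_weight gb) auto
      moreover have "\<bar>LINT r|lborel. indicator {R..} r * r powr (- 1 - 2 * s) * radial_mean gb r\<bar> \<le> \<eta> / (2 * ?\<sigma>) / s"
        using radial[OF s(1) s'(1)] \<eta> \<sigma> s
        by (intro abs_integral_le_nn_integral) (auto simp: abs_mult)
      ultimately have "\<bar>LINT x|lborel. ?h x\<bar> \<le> ?\<sigma> * (\<eta> / (2 * ?\<sigma>) / s)"
        using \<sigma> by (simp add: abs_mult del: times_divide_eq_right)
      then show ?thesis using \<sigma> by simp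
    qed
    have pw: "\<bar>?d y x\<bar> \<le> c * ?w x" if x: "R \<le> norm x" for x
    proof -
      have nx: "1 \<le> norm x" using x R by simp
      have "\<bar>?d y x\<bar> \<le> ?p * (norm x / 2) powr (- ?p - 1) * \<bar>norm (x - y) - norm x\<bar>"
        using nx s norm_shift_ge_half[OF x y] by (intro powr_neg_lipschitz) auto
      also have "\<dots> \<le> (?N + 1) * (4 powr (?N + 2) * ?w x) * (R / 2)"
      proof (intro mult_mono)
        have "(norm x / 2) powr (- ?p - 1) = (norm x / 2) powr - (?p + 1)" by simp
        also have "\<dots> \<le> 4 powr (?p + 1) * (1 + norm x) powr - (?p + 1)"
          using nx s by (intro powr_weight_le) auto
        also have "\<dots> \<le> 4 powr (?N + 2) * ?w x"
          using s s' by (intro mult_mono powr_mono) auto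
        finally show "(norm x / 2) powr (- ?p - 1) \<le> 4 powr (?N + 2) * ?w x" .
        have "\<bar>norm (x - y) - norm x\<bar> \<le> norm y"
          using norm_triangle_ineq3[of "x - y" x] by simp
        then show "\<bar>norm (x - y) - norm x\<bar> \<le> R / 2" using y by simp
      qed (use s s' in auto)
      finally show ?thesis by (simp add: c_def mult_ac)
    qed
    have "\<bar>LINT x|lborel. ?f y x - ?h x\<bar>
      \<le> (LINT x|lborel. c * (\<bar>gb x\<bar> * ?w x))"
    proof (rule integral_abs_bound_integral)
      show "integrable lborel (\<lambda>x. ?f y x - ?h x)"
        using iy i0 by simp
      show "integrable lborel (\<lambda>x. c * (\<bar>gb x\<bar> * ?w x))" using intA by simp
      fix x :: 'a
      show "\<bar>?f y x - ?h x\<bar> \<le> c * (\<bar>gb x\<bar> * ?w x)"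
      proof (cases "R \<le> norm x")
        case True
        have "\<bar>gb x\<bar> * \<bar>?d y x\<bar> \<le> \<bar>gb x\<bar> * (c * ?w x)"
          using pw[OF True] by (intro mult_left_mono) auto
        then have "\<bar>gb x * (?d y x)\<bar> \<le> \<bar>gb x\<bar> * (c * ?w x)"
          unfolding abs_mult .
        then show ?thesis using True by (simp only: right_diff_distrib) (simp add: mult_ac)
      qed (use c in \<open>simp add: indicator_def\<close>)
    qed
    also have "\<dots> = c * A" by (simp add: A_def)
    finally have "\<bar>(LINT x|lborel. ?f y x) - (LINT x|lborel. ?h x)\<bar> \<le> c * A"
      using iy i0 by simp
    moreover have "c * A \<le> \<eta> / 2 / s"
    proof -
      have "s * (2 * (c * A + 1)) \<le> \<eta>" using s'(4) cA by (simp add: pos_less_divide_eq)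
      then have "s * (c * A) \<le> \<eta> / 2" using s by (simp add: algebra_simps)
      then show ?thesis using s by (simp add: field_simps)
    qed
    moreover have "\<eta> / 2 / s + \<eta> / 2 / s = \<eta> / s" by simp
    ultimately show "\<bar>LINT x|lborel. ?f y x\<bar> \<le> \<eta> / s"
      using T0 by linarith
  qed
qed

section \<open>Comparison with the barrier\<close>

text \<open>Off the support of the bump, \<open>gen\<close> is minus the integral of the bump
  against the kernel, so Fubini converts the far part of the function into a density
  \<open>F\<close> inside. The gap between the radii \<open>R / 2\<close> and \<open>R\<close> keeps
  the kernel away from its singularity.\<close>

lemma far_field_duality:
  fixes gb :: "'a::euclidean_space \<Rightarrow> real"
  assumes s: "0 < s" "s < 1 / 2" and gb [measurable]: "gb \<in> borel_measurable borel" and R: "1 \<le> R"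
    and h: "0 < h" "cball c h \<subseteq> cball 0 (R / 2)"
    and int: "integrable lborel (\<lambda>x. \<bar>gb x\<bar> * (1 + norm x) powr - (real DIM('a) + 2 * s))"
  defines "F \<equiv> \<lambda>y. LINT x|lborel. indicator {x. R \<le> norm x} x * (gb x * norm (x - y) powr - (real DIM('a) + 2 * s))"
  shows "(LINT x|lborel. indicator {x. R \<le> norm x} x * gb x * levy_kernel.gen (frac_kernel s) (bump c h) x)
      = - (LINT y|lborel. bump c h y * F y)"
    and "integrable lborel (\<lambda>x. indicator {x. R \<le> norm x} x * gb x * levy_kernel.gen (frac_kernel s) (bump c h) x)"
    and "integrable lborel (\<lambda>y. bump c h y * F y)"
proof -
  interpret levy_kernel "frac_kernel s :: 'a measure" "sphere_area TYPE('a) * (1 / (2 * s) + 1 / (1 - 2 * s))" "2 * s"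
    using s by (rule levy_kernel_frac_kernel)
  let ?p = "real DIM('a) + 2 * s"
  let ?I = "indicator {x::'a. R \<le> norm x} :: 'a \<Rightarrow> real"
  let ?\<phi> = "bump c h"
  let ?f = "\<lambda>x y. ?I x * gb x * ?\<phi> y * norm (x - y) powr - ?p"
  have supp: "norm y \<le> R / 2" if "?\<phi> y \<noteq> 0" for y
  proof -
    have "y \<in> cball c h" using that bump_eq_0[OF h(1), of y c] by (cases "h \<le> dist y c") (auto simp: dist_commute)
    then show ?thesis using h(2) by auto
  qed
  have int2: "integrable (lborel \<Otimes>\<^sub>M lborel) (\<lambda>(x, y). ?f x y)"
  proof (rule Bochner_Integration.integrable_bound)
    show "integrable (lborel \<Otimes>\<^sub>M lborel) (\<lambda>(x, y). (4 powr ?p * (\<bar>gb x\<bar> * (1 + norm x) powr - ?p)) * ?\<phi> y)"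
      using int integrable_bump[OF h(1)] by (intro lborel_pair.integrable_pair_product) auto
    have "\<bar>?f x y\<bar> \<le> 4 powr ?p * (\<bar>gb x\<bar> * (1 + norm x) powr - ?p) * ?\<phi> y" for x y
    proof (cases "R \<le> norm x \<and> ?\<phi> y \<noteq> 0")
      case True
      have "norm (x - y) powr - ?p \<le> 4 powr ?p * (1 + norm x) powr - ?p"
        using True R s norm_shift_ge_half[of R x y] supp[of y] by (intro powr_weight_le) auto
      then have "(\<bar>gb x\<bar> * ?\<phi> y) * norm (x - y) powr - ?p \<le> (\<bar>gb x\<bar> * ?\<phi> y) * (4 powr ?p * (1 + norm x) powr - ?p)"
        by (intro mult_left_mono) (auto simp: bump_nonneg)
      then show ?thesis using True by (simp add: abs_mult bump_nonneg mult_ac)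
    qed (auto simp: indicator_def bump_nonneg)
    then show "AE q in lborel \<Otimes>\<^sub>M lborel. norm (case q of (x, y) \<Rightarrow> ?f x y)
      \<le> norm (case q of (x, y) \<Rightarrow> 4 powr ?p * (\<bar>gb x\<bar> * (1 + norm x) powr - ?p) * ?\<phi> y)"
      by (auto intro!: AE_I2 intro: order_trans[OF _ abs_ge_self])
  qed measurable
  obtain D where D: "minlip D ?\<phi>" using minlip_bump[OF h(1)] by blast
  have gen: "?I x * gb x * gen ?\<phi> x = (LINT y|lborel. - (?f x y))" for x
  proof (cases "R \<le> norm x")
    case True
    then have "?\<phi> x = 0" using supp[of x] R by force
    then have "gen ?\<phi> x = (LINT z|frac_kernel s. - ?\<phi> (x + z))" by (simp add: gen_def)
    also have "\<dots> = (LINT z|lborel. norm z powr - ?p * - ?\<phi> (x + z))"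
      by (rule integral_frac_kernel) measurable
    also have "\<dots> = (LINT z|lborel. norm ((x + z) - x) powr - ?p * - ?\<phi> (x + z))" by simp
    also have "\<dots> = (LINT y|lborel. norm (y - x) powr - ?p * - ?\<phi> y)"
      by (rule integral_lborel_translate[symmetric]) measurable
    finally have g: "gen ?\<phi> x = (LINT y|lborel. norm (y - x) powr - ?p * - ?\<phi> y)" .
    have "?I x * gb x * gen ?\<phi> x = (LINT y|lborel. ?I x * gb x * (norm (y - x) powr - ?p * - ?\<phi> y))"
      unfolding g by simp
    then show ?thesis by (simp add: norm_minus_commute mult_ac)
  qed simp
  have int2': "integrable (lborel \<Otimes>\<^sub>M lborel) (\<lambda>(x, y). - (?f x y))"
    using Bochner_Integration.integrable_minus[OF int2]
    by (rule back_subst[where P = "integrable (lborel \<Otimes>\<^sub>M lborel)"]) auto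
  have F: "(LINT x|lborel. - (?f x y)) = - (?\<phi> y * F y)" for y
  proof -
    have "(LINT x|lborel. - (?f x y))
      = (LINT x|lborel. - ?\<phi> y * (?I x * (gb x * norm (x - y) powr - ?p)))"
      by (simp add: mult_ac)
    also have "\<dots> = - ?\<phi> y * F y" unfolding F_def by (rule integral_mult_right_zero)
    finally show ?thesis by simp
  qed
  show "(LINT x|lborel. ?I x * gb x * gen ?\<phi> x) = - (LINT y|lborel. ?\<phi> y * F y)"
    unfolding gen using lborel_pair.Fubini_integral[OF int2'] unfolding F by simp
  show "integrable lborel (\<lambda>x. ?I x * gb x * gen ?\<phi> x)"
    unfolding gen using lborel_pair.integrable_fst[OF int2'] by simp
  have "integrable lborel (\<lambda>y. - (?\<phi> y * F y))"
    using lborel_pair.integrable_snd[OF int2'] unfolding F by simp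
  then show "integrable lborel (\<lambda>y. ?\<phi> y * F y)" by simp
qed

text \<open>Cutting \<open>ub\<close> off at radius \<open>R\<close> produces the integrable
  function that \<open>max_principle\<close> requires; the discarded part reappears as
  \<open>F\<close>, and \<open>super\<close> says that \<open>W\<close> outweighs it. The two signs
  of \<sigma> give the two-sided bound.\<close>

lemma AE_upper_barrier:
  fixes u W ub gb :: "'a::euclidean_space \<Rightarrow> real" and \<Omega> :: "'a set"
  assumes \<Omega>: "open \<Omega>" "bounded \<Omega>" "\<Omega> \<noteq> {}" "\<And>x. x \<in> \<Omega> \<Longrightarrow> norm x \<le> R / 2" and R: "1 \<le> R"
    and s: "0 < s" "s < 1 / 2"
    and ub [measurable]: "ub \<in> borel_measurable borel"
    and intu: "integrable lborel (\<lambda>x. \<bar>ub x\<bar> * (1 + norm x) powr - (real DIM('a) + 2 * s))"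
    and harm: "\<And>c h. 0 < h \<Longrightarrow> cball c h \<subseteq> \<Omega> \<Longrightarrow> (LINT x|lborel. ub x * levy_kernel.gen (frac_kernel s) (bump c h) x) = 0"
    and gb [measurable]: "gb \<in> borel_measurable borel" and ubgb: "AE x in lborel. x \<notin> \<Omega> \<longrightarrow> ub x = gb x"
    and W: "minlip D W" "integrable lborel W" "\<And>x. 0 \<le> W x"
    and Wg: "AE x in lborel. x \<notin> \<Omega> \<longrightarrow> norm x \<le> R \<longrightarrow> \<bar>gb x\<bar> \<le> W x"
    and U: "open U" "frontier \<Omega> \<subseteq> U" "AE x in lborel. x \<in> U \<longrightarrow> \<bar>ub x\<bar> \<le> B"
    and shell: "0 \<le> C'" "0 < h0"
      "\<And>h. 0 < h \<Longrightarrow> h \<le> h0 \<Longrightarrow> emeasure lborel {x. infdist x (frontier \<Omega>) \<le> h} \<le> ennreal (C' * h)"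
    and super: "\<And>y. y \<in> \<Omega> \<Longrightarrow> \<bar>LINT x|lborel. indicator {x. R \<le> norm x} x * (gb x * norm (x - y) powr - (real DIM('a) + 2 * s))\<bar>
      \<le> levy_kernel.gen_adj (frac_kernel s) W y"
    and \<sigma>: "\<bar>\<sigma>\<bar> = (1::real)"
  shows "AE x in lborel. x \<in> \<Omega> \<longrightarrow> \<sigma> * ub x \<le> W x"
proof -
  interpret levy_kernel "frac_kernel s :: 'a measure" "sphere_area TYPE('a) * (1 / (2 * s) + 1 / (1 - 2 * s))" "2 * s"
    using s by (rule levy_kernel_frac_kernel)
  let ?p = "real DIM('a) + 2 * s"
  let ?I = "indicator {x::'a. R \<le> norm x} :: 'a \<Rightarrow> real"
  define F where "F y = (LINT x|lborel. ?I x * (gb x * norm (x - y) powr - ?p))" for y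
  define near where "near x = indicator {x. norm x < R} x * ub x" for x
  have near_m [measurable]: "near \<in> borel_measurable borel" unfolding near_def[abs_def] by measurable
  have near_i: "integrable lborel near"
  proof (rule Bochner_Integration.integrable_bound)
    show "integrable lborel (\<lambda>x. (1 + R) powr ?p * (\<bar>ub x\<bar> * (1 + norm x) powr - ?p))" using intu by simp
    have "\<bar>near x\<bar> \<le> (1 + R) powr ?p * (\<bar>ub x\<bar> * (1 + norm x) powr - ?p)" for x
    proof (cases "norm x < R")
      case True
      have "(1 + R) powr - ?p \<le> (1 + norm x) powr - ?p"
        using True s by (intro powr_mono2') (auto intro: add_pos_nonneg)
      then have "\<bar>ub x\<bar> * ((1 + R) powr ?p * (1 + R) powr - ?p) \<le> \<bar>ub x\<bar> * ((1 + R) powr ?p * (1 + norm x) powr - ?p)"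
        by (intro mult_left_mono) auto
      moreover have "(1 + R) powr ?p * (1 + R) powr - ?p = 1"
        using R by (subst powr_add[symmetric]) simp
      ultimately show ?thesis using True by (simp add: near_def mult_ac)
    qed (simp add: near_def)
    then show "AE x in lborel. norm (near x) \<le> norm ((1 + R) powr ?p * (\<bar>ub x\<bar> * (1 + norm x) powr - ?p))"
      by (auto intro!: AE_I2 intro: order_trans[OF _ abs_ge_self])
  qed measurable
  have far_ae: "AE x in lborel. ?I x * ub x = ?I x * gb x"
    using ubgb
  proof eventually_elim
    fix x assume *: "x \<notin> \<Omega> \<longrightarrow> ub x = gb x"
    show "?I x * ub x = ?I x * gb x"
      using * \<Omega>(4)[of x] R by (cases "R \<le> norm x") (auto simp: indicator_def)
  qed
  have intg: "integrable lborel (\<lambda>x. \<bar>?I x * gb x\<bar> * (1 + norm x) powr - ?p)"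
  proof (rule Bochner_Integration.integrable_bound[OF intu])
    show "AE x in lborel. norm (\<bar>?I x * gb x\<bar> * (1 + norm x) powr - ?p) \<le> norm (\<bar>ub x\<bar> * (1 + norm x) powr - ?p)"
      using far_ae by eventually_elim (auto simp: indicator_def split: if_splits)
  qed measurable
  let ?v = "\<lambda>x. W x - \<sigma> * near x"
  have "AE x in lborel. 0 \<le> ?v x"
  proof (rule max_principle[OF \<Omega>(1-3)])
    show vi: "integrable lborel ?v" using W(2) near_i by simp
    show "AE x in lborel. x \<notin> \<Omega> \<longrightarrow> 0 \<le> ?v x"
      using ubgb Wg
    proof eventually_elim
      fix x assume *: "x \<notin> \<Omega> \<longrightarrow> ub x = gb x" "x \<notin> \<Omega> \<longrightarrow> norm x \<le> R \<longrightarrow> \<bar>gb x\<bar> \<le> W x"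
      show "x \<notin> \<Omega> \<longrightarrow> 0 \<le> ?v x"
      proof
        assume x: "x \<notin> \<Omega>"
        show "0 \<le> ?v x"
        proof (cases "norm x < R")
          case True
          have "\<sigma> * ub x \<le> \<bar>\<sigma> * ub x\<bar>" by simp
          also have "\<dots> = \<bar>gb x\<bar>" using * x \<sigma> by (simp add: abs_mult)
          also have "\<dots> \<le> W x" using * x True by simp
          finally show ?thesis using True by (simp add: near_def)
        qed (use W(3) in \<open>simp add: near_def\<close>)
      qed
    qed
    show "AE x in lborel. x \<in> U \<longrightarrow> - \<bar>B\<bar> \<le> ?v x"
      using U(3)
    proof eventually_elim
      fix x assume *: "x \<in> U \<longrightarrow> \<bar>ub x\<bar> \<le> B"
      show "x \<in> U \<longrightarrow> - \<bar>B\<bar> \<le> ?v x"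
      proof
        assume "x \<in> U"
        have "\<sigma> * near x \<le> \<bar>\<sigma> * near x\<bar>" by simp
        also have "\<dots> \<le> \<bar>ub x\<bar>" using \<sigma> by (simp add: abs_mult near_def indicator_def)
        also have "\<dots> \<le> \<bar>B\<bar>" using * \<open>x \<in> U\<close> by simp
        finally show "- \<bar>B\<bar> \<le> ?v x" using W(3)[of x] by simp
      qed
    qed
    show "0 < measure (frac_kernel s :: 'a measure) {z. \<rho> < norm z}" if "0 < \<rho>" for \<rho>
      using emeasure_frac_kernel_outside[OF s(1) that, where 'a = 'a] sphere_area_pos[where 'a = 'a] s that
      by (simp add: measure_def)
    fix c h assume h: "0 < h" and sub: "cball c h \<subseteq> \<Omega>"
    let ?\<phi> = "bump c h"
    obtain D' where D': "minlip D' ?\<phi>" using minlip_bump[OF h] by blast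
    have \<phi>i: "integrable lborel ?\<phi>" by (rule integrable_bump[OF h])
    have sub': "cball c h \<subseteq> cball 0 (R / 2)" using sub \<Omega>(4) by auto
    \<comment> \<open>Weighted integrability is inherited from \<open>ub\<close>, hence available
      for \<open>gb\<close> only after truncation to \<open>norm x \<ge> R\<close>. Duality is
      applied to the truncated function, and idempotence of the indicator restores the original
      form.\<close>
    have I2: "?I x * (?I x * gb x) = ?I x * gb x" "?I x * ((?I x * gb x) * t) = ?I x * (gb x * t)" for x t
      by (auto simp: indicator_def)
    note dual = far_field_duality[OF s _ R h sub' intg, simplified I2, folded F_def]
    have d1: "(LINT x|lborel. ?I x * gb x * gen ?\<phi> x) = - (LINT y|lborel. ?\<phi> y * F y)"
      and d2: "integrable lborel (\<lambda>x. ?I x * gb x * gen ?\<phi> x)"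
      and d3: "integrable lborel (\<lambda>y. ?\<phi> y * F y)"
      by (intro dual; measurable)+
    have n1: "integrable lborel (\<lambda>x. near x * gen ?\<phi> x)" by (rule integrable_mult_gen(1)[OF near_i D'])
    have [measurable]: "gen ?\<phi> \<in> borel_measurable borel" by (rule gen_measurable(1)[OF D'])
    have "0 = (LINT x|lborel. ub x * gen ?\<phi> x)" using harm[OF h sub] by simp
    also have "\<dots> = (LINT x|lborel. near x * gen ?\<phi> x + ?I x * gb x * gen ?\<phi> x)"
    proof (rule integral_cong_AE)
      show "AE x in lborel. ub x * gen ?\<phi> x = near x * gen ?\<phi> x + ?I x * gb x * gen ?\<phi> x"
        using far_ae
      proof eventually_elim
        fix x assume *: "?I x * ub x = ?I x * gb x"
        have "ub x = near x + ?I x * ub x" by (auto simp: near_def indicator_def)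
        then show "ub x * gen ?\<phi> x = near x * gen ?\<phi> x + ?I x * gb x * gen ?\<phi> x"
          using * by (metis distrib_right)
      qed
    qed measurable
    also have "\<dots> = (LINT x|lborel. near x * gen ?\<phi> x) - (LINT y|lborel. ?\<phi> y * F y)"
      using n1 d2 d1 by simp
    finally have n2: "(LINT x|lborel. near x * gen ?\<phi> x) = (LINT y|lborel. ?\<phi> y * F y)" by simp
    have w1: "integrable lborel (\<lambda>x. W x * gen ?\<phi> x)" by (rule integrable_mult_gen(1)[OF W(2) D'])
    have w2: "(LINT x|lborel. W x * gen ?\<phi> x) = (LINT y|lborel. ?\<phi> y * gen_adj W y)"
      by (rule gen_adjoint[OF W(2,1) \<phi>i D'])
    have w3: "integrable lborel (\<lambda>y. ?\<phi> y * gen_adj W y)" by (rule integrable_mult_gen(2)[OF \<phi>i W(1)])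
    have "0 \<le> (LINT y|lborel. ?\<phi> y * gen_adj W y - \<sigma> * (?\<phi> y * F y))"
    proof (rule Bochner_Integration.integral_nonneg)
      fix y :: 'a
      show "0 \<le> ?\<phi> y * gen_adj W y - \<sigma> * (?\<phi> y * F y)"
      proof (cases "?\<phi> y = 0")
        case False
        then have "y \<in> \<Omega>" using sub bump_eq_0[OF h, of y c] by (force simp: dist_commute)
        then have "\<bar>F y\<bar> \<le> gen_adj W y" unfolding F_def by (rule super)
        moreover have "\<sigma> * F y \<le> \<bar>F y\<bar>" using abs_ge_self[of "\<sigma> * F y"] \<sigma> by (simp add: abs_mult)
        ultimately have "?\<phi> y * (\<sigma> * F y) \<le> ?\<phi> y * gen_adj W y"
          using bump_nonneg[of c h y] by (intro mult_left_mono) auto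
        then show ?thesis by (simp add: mult_ac)
      qed simp
    qed
    also have "\<dots> = (LINT x|lborel. W x * gen ?\<phi> x) - \<sigma> * (LINT x|lborel. near x * gen ?\<phi> x)"
      using w2 w3 d3 n2 by simp
    also have "\<dots> = (LINT x|lborel. ?v x * gen ?\<phi> x)"
      using w1 n1 by (simp add: left_diff_distrib mult.assoc)
    finally show "0 \<le> (LINT x|lborel. ?v x * gen ?\<phi> x)" .
  qed (use U shell in auto)
  then show ?thesis
  proof eventually_elim
    fix x assume *: "0 \<le> ?v x"
    show "x \<in> \<Omega> \<longrightarrow> \<sigma> * ub x \<le> W x"
      using * \<Omega>(4)[of x] R by (auto simp: near_def indicator_def split: if_splits)
  qed
qed

text \<open>A plateau of height \<open>K\<close> that falls linearly to 0 between the radii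
  \<open>R\<close> and \<open>2 * R\<close>, minus a trough inside \<Omega> that reaches the level
  \<eta> at depth \<open>d\<close> from the boundary. Both pieces are Lipschitz, which suffices for
  \<open>gen_adj\<close>.\<close>

definition barrier :: "'a::euclidean_space set \<Rightarrow> real \<Rightarrow> real \<Rightarrow> real \<Rightarrow> real \<Rightarrow> 'a \<Rightarrow> real" where
  "barrier \<Omega> R K \<eta> d x = K * max 0 (min 1 (2 - norm x / R)) - (K - \<eta>) * min 1 (infdist x (- \<Omega>) / d)"

context
  fixes \<Omega> :: "'a::euclidean_space set" and R K \<eta> d :: real
  assumes \<Omega>R: "\<And>x. x \<in> \<Omega> \<Longrightarrow> norm x \<le> R / 2" and R: "1 \<le> R" and \<eta>: "0 < \<eta>" "\<eta> \<le> K" and d: "0 < d"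
begin

lemma barrier_outside: "x \<notin> \<Omega> \<Longrightarrow> barrier \<Omega> R K \<eta> d x = K * max 0 (min 1 (2 - norm x / R))"
  by (simp add: barrier_def)

lemma barrier_inside: "x \<in> \<Omega> \<Longrightarrow> barrier \<Omega> R K \<eta> d x = K - (K - \<eta>) * min 1 (infdist x (- \<Omega>) / d)"
proof -
  assume "x \<in> \<Omega>"
  then have "norm x / R \<le> 1" using \<Omega>R[of x] R by (simp add: field_simps)
  then have "max 0 (min 1 (2 - norm x / R)) = 1" by simp
  then show ?thesis by (simp add: barrier_def)
qed

lemma barrier_inside_bounds:
  assumes "x \<in> \<Omega>"
  shows "\<eta> \<le> barrier \<Omega> R K \<eta> d x" "barrier \<Omega> R K \<eta> d x \<le> K"
proof -
  define m where "m = min 1 (infdist x (- \<Omega>) / d)"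
  have m: "0 \<le> m" "m \<le> 1" using d by (auto simp: m_def infdist_nonneg)
  have "(K - \<eta>) * m \<le> (K - \<eta>) * 1" using \<eta> m by (intro mult_left_mono) auto
  moreover have "0 \<le> (K - \<eta>) * m" using \<eta> m by simp
  moreover have "barrier \<Omega> R K \<eta> d x = K - (K - \<eta>) * m"
    using barrier_inside[OF assms] by (simp add: m_def)
  ultimately show "\<eta> \<le> barrier \<Omega> R K \<eta> d x" "barrier \<Omega> R K \<eta> d x \<le> K" by simp_all
qed

lemma barrier_deep: "x \<in> \<Omega> \<Longrightarrow> d \<le> infdist x (- \<Omega>) \<Longrightarrow> barrier \<Omega> R K \<eta> d x = \<eta>"
  using d by (simp add: barrier_inside min_def)

lemma barrier_near: "x \<notin> \<Omega> \<Longrightarrow> norm x \<le> R \<Longrightarrow> barrier \<Omega> R K \<eta> d x = K"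
  using R by (simp add: barrier_outside field_simps)

lemma barrier_far: "2 * R \<le> norm x \<Longrightarrow> barrier \<Omega> R K \<eta> d x = 0"
proof -
  assume x: "2 * R \<le> norm x"
  then have "x \<notin> \<Omega>" using \<Omega>R[of x] R by auto
  moreover have "2 - norm x / R \<le> 0" using x R by (simp add: field_simps)
  ultimately show ?thesis by (simp add: barrier_outside)
qed

lemma barrier_range: "0 \<le> barrier \<Omega> R K \<eta> d x" "barrier \<Omega> R K \<eta> d x \<le> K"
proof -
  have "0 \<le> barrier \<Omega> R K \<eta> d x \<and> barrier \<Omega> R K \<eta> d x \<le> K"
  proof (cases "x \<in> \<Omega>")
    case True
    then show ?thesis using barrier_inside_bounds[OF True] \<eta> by linarith
  next
    case False
    have "K * max 0 (min 1 (2 - norm x / R)) \<le> K * 1" using \<eta> by (intro mult_left_mono) auto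
    then show ?thesis using False \<eta> by (simp add: barrier_outside)
  qed
  then show "0 \<le> barrier \<Omega> R K \<eta> d x" "barrier \<Omega> R K \<eta> d x \<le> K" by auto
qed

lemma barrier_lipschitz: "\<bar>barrier \<Omega> R K \<eta> d x - barrier \<Omega> R K \<eta> d y\<bar> \<le> (K + K / d) * dist x y"
proof -
  let ?a = "\<lambda>x. max 0 (min 1 (2 - norm x / R))"
  let ?b = "\<lambda>x. min 1 (infdist x (- \<Omega>) / d)"
  have "\<bar>norm x / R - norm y / R\<bar> \<le> dist x y / R"
    using norm_triangle_ineq3[of x y] R by (simp add: dist_norm divide_right_mono flip: diff_divide_distrib)
  also have "\<dots> \<le> dist x y / 1" using R by (intro divide_left_mono) auto
  finally have "\<bar>?a x - ?a y\<bar> \<le> dist x y"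
    by linarith
  then have 1: "K * \<bar>?a x - ?a y\<bar> \<le> K * dist x y"
    using \<eta> by (intro mult_left_mono) auto
  have "\<bar>infdist x (- \<Omega>) / d - infdist y (- \<Omega>) / d\<bar> \<le> dist x y / d"
    using infdist_triangle_abs[of x "- \<Omega>" y] d by (simp add: divide_right_mono flip: diff_divide_distrib)
  then have "\<bar>?b x - ?b y\<bar> \<le> dist x y / d"
    by linarith
  then have 2: "(K - \<eta>) * \<bar>?b x - ?b y\<bar> \<le> K * (dist x y / d)"
    using \<eta> d by (intro mult_mono) auto
  have "barrier \<Omega> R K \<eta> d x - barrier \<Omega> R K \<eta> d y
    = K * (?a x - ?a y)
      - (K - \<eta>) * (?b x - ?b y)"
    unfolding barrier_def by (simp only: right_diff_distrib)
  also have "\<bar>\<dots>\<bar> \<le> \<bar>K * (?a x - ?a y)\<bar>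
      + \<bar>(K - \<eta>) * (?b x - ?b y)\<bar>"
    by (rule abs_triangle_ineq4)
  also have "\<dots> \<le> K * dist x y + K * (dist x y / d)"
  proof (rule add_mono)
    show "\<bar>K * (?a x - ?a y)\<bar> \<le> K * dist x y"
      unfolding abs_mult using 1 \<eta> by (simp only: abs_of_pos order.strict_trans2)
    show "\<bar>(K - \<eta>) * (?b x - ?b y)\<bar> \<le> K * (dist x y / d)"
      unfolding abs_mult using 2 \<eta> by (simp only: abs_of_nonneg diff_ge_0_iff_ge)
  qed
  finally show ?thesis by (simp add: distrib_right)
qed

lemma minlip_barrier: "minlip (K + (K + K / d)) (barrier \<Omega> R K \<eta> d)"
proof (rule minlip_intro)
  show "\<bar>barrier \<Omega> R K \<eta> d x - barrier \<Omega> R K \<eta> d y\<bar> \<le> K" for x y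
    using barrier_range[of x] barrier_range[of y] by linarith
qed (use \<eta> d barrier_lipschitz in auto)

lemma integrable_barrier: "integrable lborel (barrier \<Omega> R K \<eta> d)"
proof (rule Bochner_Integration.integrable_bound)
  have "emeasure lborel (cball (0::'a) (2 * R)) < \<infinity>"
    by (rule emeasure_bounded_finite) simp
  then have "integrable lborel (indicator (cball 0 (2 * R)) :: 'a \<Rightarrow> real)"
    by (intro integrable_real_indicator) auto
  then show "integrable lborel (\<lambda>x::'a. K * indicator (cball 0 (2 * R)) x)" by simp
  show "barrier \<Omega> R K \<eta> d \<in> borel_measurable lborel" using minlip_measurable[OF minlip_barrier] by simp
  have "\<bar>barrier \<Omega> R K \<eta> d x\<bar> \<le> \<bar>K * indicator (cball 0 (2 * R)) x\<bar>" for x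
    using barrier_range[of x] barrier_far[of x] by (cases "norm x \<le> 2 * R") auto
  then show "AE x in lborel. norm (barrier \<Omega> R K \<eta> d x) \<le> norm (K * indicator (cball 0 (2 * R)) x)" by simp
qed

text \<open>From a point of norm at most \<open>R / 2\<close>, a jump longer than
  \<open>3 * R\<close> lands beyond \<open>2 * R\<close>, where the barrier is 0, and gains at least
  \<eta>. A shorter jump costs at most the Lipschitz constant times its length.\<close>

lemma gen_adj_barrier_ge:
  assumes s: "0 < s" "s < 1 / 2" and y: "y \<in> \<Omega>"
  shows "\<eta> * (sphere_area TYPE('a) * ((3 * R) powr (- 2 * s) / (2 * s)))
      - (K + K / d) * (sphere_area TYPE('a) * ((3 * R) powr (1 - 2 * s) / (1 - 2 * s)))
    \<le> levy_kernel.gen_adj (frac_kernel s) (barrier \<Omega> R K \<eta> d) y"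
proof -
  interpret levy_kernel "frac_kernel s :: 'a measure" "sphere_area TYPE('a) * (1 / (2 * s) + 1 / (1 - 2 * s))" "2 * s"
    using s by (rule levy_kernel_frac_kernel)
  let ?S = "sphere_area TYPE('a)"
  let ?K = "frac_kernel s :: 'a measure" and ?b = "barrier \<Omega> R K \<eta> d"
  have R3: "0 < 3 * R" using R by simp
  have S: "0 < ?S" by (rule sphere_area_pos)
  note em = emeasure_frac_kernel_outside[OF s(1) R3, where 'a = 'a]
  have i1: "integrable ?K (indicator {z. 3 * R < norm z} :: 'a \<Rightarrow> real)"
    using em by (intro integrable_real_indicator) auto
  have v1: "(LINT z|?K. indicator {z. 3 * R < norm z} z) = ?S * ((3 * R) powr (- 2 * s) / (2 * s))"
    using em S s by (simp add: measure_def)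
  note nn = nn_integral_frac_kernel_inside[OF s(2) R3, where 'a = 'a]
  have i2: "integrable ?K (\<lambda>z. indicator {..3 * R} (norm z) * norm z)"
    using nn by (intro integrableI_nonneg) auto
  have v2: "(LINT z|?K. indicator {..3 * R} (norm z) * norm z) = ?S * ((3 * R) powr (1 - 2 * s) / (1 - 2 * s))"
    using nn S s by (subst integral_eq_nn_integral) auto
  have "(LINT z|?K. \<eta> * indicator {z. 3 * R < norm z} z - (K + K / d) * (indicator {..3 * R} (norm z) * norm z)) \<le> gen_adj ?b y"
    unfolding gen_adj_def
  proof (intro integral_mono integrable_diff(2)[OF minlip_barrier])
    show "integrable ?K (\<lambda>z. \<eta> * indicator {z. 3 * R < norm z} z - (K + K / d) * (indicator {..3 * R} (norm z) * norm z))"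
      using i1 i2 by auto
    fix z :: 'a
    show "\<eta> * indicator {z. 3 * R < norm z} z - (K + K / d) * (indicator {..3 * R} (norm z) * norm z) \<le> ?b y - ?b (y - z)"
    proof (cases "3 * R < norm z")
      case True
      have "norm z \<le> norm (y - z) + norm y"
        using norm_triangle_ineq2[of z y] by (simp add: norm_minus_commute)
      then have "2 * R \<le> norm (y - z)" using True \<Omega>R[OF y] R by linarith
      then show ?thesis using True barrier_far barrier_inside_bounds(1)[OF y] by simp
    next
      case False
      then show ?thesis using barrier_lipschitz[of y "y - z"] by (simp add: dist_norm)
    qed
  qed
  then show ?thesis using i1 i2 v1 v2 by simp
qed

text \<open>The long jumps yield about \<eta> times the sphere area over \<open>2 * s\<close>. One
  half is given up in bounding \<open>(3 * R) powr (- 2 * s)\<close> by 1/2, and half of the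
  remainder pays for the short jumps, which explains the 8.\<close>

lemma gen_adj_barrier_eventually:
  "\<exists>s1>0. \<forall>s. 0 < s \<longrightarrow> s < s1 \<longrightarrow> (\<forall>y\<in>\<Omega>. \<eta> * sphere_area TYPE('a) / 8 / s
     \<le> levy_kernel.gen_adj (frac_kernel s) (barrier \<Omega> R K \<eta> d) y)"
proof -
  let ?S = "sphere_area TYPE('a)"
  have S: "0 < ?S" by (rule sphere_area_pos)
  define L where "L = K + K / d"
  have L: "0 \<le> L" using \<eta> d by (simp add: L_def)
  have "((\<lambda>s. (3 * R) powr (- 2 * s)) \<longlongrightarrow> (3 * R) powr (- 2 * 0)) (at_right 0)"
    using R by (intro tendsto_intros) auto
  then have "\<forall>\<^sub>F s in at_right 0. 1 / 2 < (3 * R) powr (- 2 * s)"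
    using R by (intro order_tendstoD(1)) auto
  then obtain b where b: "b > 0" "\<And>s. 0 < s \<Longrightarrow> s < b \<Longrightarrow> 1 / 2 < (3 * R) powr (- 2 * s)"
    unfolding eventually_at_right_field by auto
  have LR: "0 \<le> L * R" using L R by simp
  \<comment> \<open>With \<open>s < 1 / 4\<close> the denominator \<open>1 - 2 * s\<close> exceeds
    1/2, so the short jumps cost at most \<open>6 * (L * R)\<close> sphere areas; 48 = 6 * 8 keeps
    this below \<open>\<eta> / 8 / s\<close>.\<close>
  define s1 where "s1 = min b (min (1 / 4) (\<eta> / (48 * (L * R) + 1)))"
  have s1: "0 < s1" using b \<eta> LR by (simp add: s1_def)
  show ?thesis
  proof (intro exI[of _ s1] conjI allI impI ballI s1)
    fix s y assume s: "0 < s" "s < s1" and y: "y \<in> \<Omega>"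
    have s': "s < b" "s < 1 / 4" "s < 1 / 2" "s < \<eta> / (48 * (L * R) + 1)" using s by (auto simp: s1_def)
    have "s * (48 * (L * R) + 1) \<le> \<eta>" using s'(4) LR by (simp add: pos_less_divide_eq)
    then have "6 * (L * R) * s \<le> \<eta> / 8" using s by (simp add: algebra_simps)
    then have e1: "6 * (L * R) \<le> \<eta> / 8 / s" using s by (simp add: pos_le_divide_eq)
    have 1: "\<eta> * (?S * ((1 / 2) / (2 * s))) \<le> \<eta> * (?S * ((3 * R) powr (- 2 * s) / (2 * s)))"
      using b(2)[OF s(1) s'(1)] s S \<eta> by (intro mult_left_mono divide_right_mono) auto
    have 2: "L * (?S * ((3 * R) powr (1 - 2 * s) / (1 - 2 * s))) \<le> L * (?S * ((3 * R) powr 1 / (1 / 2)))"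
      using s s' S L R by (intro mult_left_mono frac_le powr_mono) auto
    have 3: "?S * (6 * (L * R)) \<le> ?S * (\<eta> / 8 / s)" using e1 S by (intro mult_left_mono) auto
    have "\<eta> * ?S / 8 / s = ?S * (\<eta> / 8 / s) + ?S * (\<eta> / 8 / s) - ?S * (\<eta> / 8 / s)" by simp
    also have "\<dots> \<le> ?S * (\<eta> / 8 / s) + ?S * (\<eta> / 8 / s) - ?S * (6 * (L * R))"
      using 3 by (intro diff_mono) auto
    also have "?S * (\<eta> / 8 / s) + ?S * (\<eta> / 8 / s) = \<eta> * (?S * ((1 / 2) / (2 * s)))" using s by (simp add: field_simps)
    also have "?S * (6 * (L * R)) = L * (?S * ((3 * R) powr 1 / (1 / 2)))" using R by simp
    also have "\<eta> * (?S * ((1 / 2) / (2 * s))) - L * (?S * ((3 * R) powr 1 / (1 / 2)))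
      \<le> \<eta> * (?S * ((3 * R) powr (- 2 * s) / (2 * s))) - L * (?S * ((3 * R) powr (1 - 2 * s) / (1 - 2 * s)))"
      by (rule diff_mono[OF 1 2])
    also have "\<dots> \<le> levy_kernel.gen_adj (frac_kernel s) (barrier \<Omega> R K \<eta> d) y"
      unfolding L_def by (rule gen_adj_barrier_ge[OF s(1) s'(3) y])
    finally show "\<eta> * ?S / 8 / s \<le> levy_kernel.gen_adj (frac_kernel s) (barrier \<Omega> R K \<eta> d) y" .
  qed
qed

end

text \<open>All constants of the barrier are fixed before \<open>s\<close>. Only then is
  \<open>s\<close> made so small that the margin \<theta> / s by which the barrier is a
  supersolution dominates the far field; the conclusion holds because the weighted barrier is at
  most \<eta> throughout \<Omega>.\<close>

theorem theorem4p2: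
  fixes \<Omega> :: "'a::euclidean_space set" and g :: "'a \<Rightarrow> real" and u :: "real \<Rightarrow> 'a \<Rightarrow> real"
  assumes "DIM('a) \<ge> 2"
    and "open \<Omega>" and "connected \<Omega>" and "bounded \<Omega>" and "C2_boundary \<Omega>"
    and g_loc: "\<And>B. bounded B \<Longrightarrow> bounded (g ` (B - \<Omega>))"
    and g_L1s: "\<And>s. 0 < s \<Longrightarrow> s < 1 \<Longrightarrow> L1s s (\<lambda>x. if x \<in> \<Omega> then 0 else g x)"
    and decay: "\<And>\<delta>. \<delta> > 0 \<Longrightarrow>
       (\<lambda>R. LINT r:{r \<in> {R..2*R}. \<bar>sph_mean (\<lambda>x. if x \<in> \<Omega> then 0 else g x) r\<bar> \<ge> \<delta>}|lebesgue.
              \<bar>sph_mean (\<lambda>x. if x \<in> \<Omega> then 0 else g x) r\<bar>) \<in> o(\<lambda>R. R)"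
    and u_harm: "\<And>s. 0 < s \<Longrightarrow> s < 1 \<Longrightarrow> s_harmonic s \<Omega> (u s)"
    and u_bdd: "\<And>s. 0 < s \<Longrightarrow> s < 1 \<Longrightarrow>
       \<exists>U C. open U \<and> frontier \<Omega> \<subseteq> U \<and> (AE x in lebesgue. x \<in> U \<longrightarrow> \<bar>u s x\<bar> \<le> C)"
    and u_ext: "\<And>s x. 0 < s \<Longrightarrow> s < 1 \<Longrightarrow> x \<notin> \<Omega> \<Longrightarrow> u s x = g x"
  shows "\<forall>\<epsilon>>0. \<forall>\<eta>>0. eventually (\<lambda>s. AE x in lebesgue. x \<in> \<Omega> \<longrightarrow>
            infdist x (frontier \<Omega>) powr \<epsilon> * \<bar>u s x\<bar> \<le> \<eta>) (at_right 0)"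
proof (cases "\<Omega> = {}")
  case False
  note op = \<open>open \<Omega>\<close> and bd = \<open>bounded \<Omega>\<close>
  have "\<Omega> \<noteq> UNIV" using bd not_bounded_UNIV by auto
  then have F: "frontier \<Omega> \<noteq> {}" using frontier_not_empty False by blast
  obtain C' h0 where shell: "0 \<le> C'" "0 < h0"
    "\<And>h. 0 < h \<Longrightarrow> h \<le> h0 \<Longrightarrow> emeasure lborel {x. infdist x (frontier \<Omega>) \<le> h} \<le> ennreal (C' * h)"
    using emeasure_C2_boundary_nbhd[OF op bd \<open>C2_boundary \<Omega>\<close> F] by blast
  obtain M where M: "0 < M" "\<And>x. x \<in> \<Omega> \<Longrightarrow> norm x \<le> M" using bd bounded_pos by blast
  \<comment> \<open>This puts \<Omega> into the ball of radius \<open>R / 2\<close> and gives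
    \<open>R \<ge> 1\<close>, as the far field estimates require.\<close>
  define R where "R = 2 * M + 1"
  have \<Omega>R: "norm x \<le> R / 2" if "x \<in> \<Omega>" for x
    using M(2)[OF that] by (auto simp: R_def)
  have R: "1 \<le> R" using M(1) by (simp add: R_def)
  define g0 where "g0 x = (if x \<in> \<Omega> then 0 else g x)" for x
  have loc: "\<exists>M. \<forall>x. norm x \<le> \<rho> \<longrightarrow> \<bar>g0 x\<bar> \<le> M" for \<rho>
  proof -
    have "bounded (g ` (cball 0 \<rho> - \<Omega>))" by (rule g_loc) simp
    then obtain M where "\<forall>x\<in>cball 0 \<rho> - \<Omega>. \<bar>g x\<bar> \<le> M" by (auto simp: bounded_iff)
    then have "\<bar>g0 x\<bar> \<le> max M 0" if "norm x \<le> \<rho>" for x using that by (auto simp: g0_def le_max_iff_disj)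
    then show ?thesis by blast
  qed
  have L1g0: "L1s s g0" if "0 < s" "s < 1" for s
    using g_L1s[OF that] unfolding g0_def .
  have "g0 \<in> borel_measurable lebesgue" using L1g0[of "1/2"] by (simp add: L1s_def)
  then obtain gb where gb [measurable]: "gb \<in> borel_measurable borel" and gbae: "AE x in lborel. g0 x = gb x"
    using completion_ex_borel_measurable_real[of g0 lborel] by auto
  have intgb: "integrable lborel (\<lambda>x. \<bar>gb x\<bar> * (1 + norm x) powr - (real DIM('a) + 2 * s))" if "0 < s" "s < 1" for s
  proof -
    have "integrable lebesgue (\<lambda>x. \<bar>g0 x\<bar> * (1 + norm x) powr - (real DIM('a) + 2 * s))"
      using L1g0[OF that] by (simp add: L1s_def)
    then show ?thesis
      by (subst (asm) lebesgue_transfer(3)[where f' = "\<lambda>x. \<bar>gb x\<bar> * (1 + norm x) powr - (real DIM('a) + 2 * s)"])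
        (use gbae in \<open>auto elim: eventually_mono\<close>)
  qed
  obtain K0 where K0: "\<And>x. norm x \<le> R \<Longrightarrow> \<bar>g0 x\<bar> \<le> K0" using loc by blast
  show ?thesis
  proof (intro allI impI)
    fix \<epsilon> \<eta> :: real assume \<epsilon>: "0 < \<epsilon>" and \<eta>: "0 < \<eta>"
    \<comment> \<open>The distance to the boundary is at most \<open>R\<close> in \<Omega>, so the
      level \<eta>' of the barrier in the deep part becomes at most \<eta> after weighting.\<close>
    define \<eta>' where "\<eta>' = \<eta> / R powr \<epsilon>"
    have \<eta>': "0 < \<eta>'" using \<eta> R by (simp add: \<eta>'_def)
    define K where "K = max K0 \<eta>'"
    have K: "\<eta>' \<le> K" "K0 \<le> K" "0 < K" using \<eta>' by (auto simp: K_def)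
    \<comment> \<open>The width at which the weight exactly compensates the full height:
      \<open>d powr \<epsilon> * K = \<eta>\<close>.\<close>
    define d where "d = (\<eta> / K) powr (1 / \<epsilon>)"
    have d: "0 < d" using \<eta> K by (simp add: d_def)
    have dK: "d powr \<epsilon> * K = \<eta>" using \<eta> K \<epsilon> by (simp add: d_def powr_powr)
    let ?W = "barrier \<Omega> R K \<eta>' d"
  let ?\<delta> = "\<lambda>x. infdist x (frontier \<Omega>) powr \<epsilon>"
    note bar = \<Omega>R R \<eta>' K(1) d
    have weighted: "?\<delta> x * ?W x \<le> \<eta>" if x: "x \<in> \<Omega>" for x
    proof (cases "d \<le> infdist x (- \<Omega>)")
      case True
      obtain p where p: "p \<in> frontier \<Omega>" using F by blast
      have "closure \<Omega> \<subseteq> cball 0 (R / 2)" by (rule closure_minimal) (use \<Omega>R in auto)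
      then have "frontier \<Omega> \<subseteq> cball 0 (R / 2)" by (auto simp: frontier_def)
      then have "norm p \<le> R / 2" using p by auto
      then have "dist x p \<le> R" using \<Omega>R[OF x] norm_triangle_ineq4[of x p] by (simp add: dist_norm)
      then have "infdist x (frontier \<Omega>) \<le> R" using infdist_le[OF p, of x] by linarith
      then have "?\<delta> x \<le> R powr \<epsilon>"
        using \<epsilon> by (intro powr_mono2) (auto simp: infdist_nonneg)
      then have "?\<delta> x * \<eta>' \<le> R powr \<epsilon> * \<eta>'"
        using \<eta>' by (intro mult_right_mono) auto
      also have "\<dots> = \<eta>" using R by (simp add: \<eta>'_def)
      finally show ?thesis using barrier_deep[OF bar x True] by simp
    next
      case False
      then have "infdist x (frontier \<Omega>) \<le> d"
        using infdist_complement_eq_frontier[OF op F x] by simp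
      then have "?\<delta> x \<le> d powr \<epsilon>"
        using \<epsilon> by (intro powr_mono2) (auto simp: infdist_nonneg)
      then have "?\<delta> x * ?W x \<le> d powr \<epsilon> * K"
        using barrier_range[OF bar] by (intro mult_mono) auto
      then show ?thesis using dK by simp
    qed
    \<comment> \<open>The margin of the barrier serves as the tolerance granted to the far
      field.\<close>
    define \<theta> where "\<theta> = \<eta>' * sphere_area TYPE('a) / 8"
    have \<theta>: "0 < \<theta>" using \<eta>' sphere_area_pos[where 'a = 'a] by (simp add: \<theta>_def)
    have "\<exists>s1>0. \<forall>s. 0 < s \<longrightarrow> s < s1 \<longrightarrow> (\<forall>y\<in>\<Omega>. \<theta> / s \<le> levy_kernel.gen_adj (frac_kernel s) ?W y)"
      unfolding \<theta>_def by (rule gen_adj_barrier_eventually[OF bar])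
    then obtain s1 where s1: "0 < s1" and super: "\<forall>s. 0 < s \<longrightarrow> s < s1 \<longrightarrow>
        (\<forall>y\<in>\<Omega>. \<theta> / s \<le> levy_kernel.gen_adj (frac_kernel s) ?W y)" by (elim exE conjE)
    have "\<exists>s0>0. \<forall>s. 0 < s \<longrightarrow> s < s0 \<longrightarrow> (\<forall>y. norm y \<le> R / 2 \<longrightarrow>
        \<bar>LINT x|lborel. indicator {x. R \<le> norm x} x * (gb x * norm (x - y) powr - (real DIM('a) + 2 * s))\<bar> \<le> \<theta> / s)"
      by (rule far_field_decay[OF gb gbae loc decay[folded g0_def] intgb R \<theta>])
    then obtain s0 where s0: "0 < s0" and far: "\<forall>s. 0 < s \<longrightarrow> s < s0 \<longrightarrow> (\<forall>y. norm y \<le> R / 2 \<longrightarrow>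
        \<bar>LINT x|lborel. indicator {x. R \<le> norm x} x * (gb x * norm (x - y) powr - (real DIM('a) + 2 * s))\<bar> \<le> \<theta> / s)"
      by (elim exE conjE)
    show "\<forall>\<^sub>F s in at_right 0. AE x in lebesgue. x \<in> \<Omega> \<longrightarrow> ?\<delta> x * \<bar>u s x\<bar> \<le> \<eta>"
      unfolding eventually_at_right_field
    proof (intro exI[of _ "min (min s0 s1) (1 / 2)"] conjI allI impI)
      show "0 < min (min s0 s1) (1 / 2)" using s0 s1 by simp
      fix s assume s: "0 < s" "s < min (min s0 s1) (1 / 2)"
      then have s': "s < s0" "s < s1" "s < 1 / 2" "s < 1" by auto
      note harm = u_harm[OF s(1) s'(4)]
      have L1: "L1s s (u s)" using harm by (simp add: s_harmonic_def)
      then have "u s \<in> borel_measurable lebesgue" by (simp add: L1s_def)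
      then obtain ub where ub [measurable]: "ub \<in> borel_measurable borel" and ubae: "AE x in lborel. u s x = ub x"
        using completion_ex_borel_measurable_real[of "u s" lborel] by auto
      have intub: "integrable lborel (\<lambda>x. \<bar>ub x\<bar> * (1 + norm x) powr - (real DIM('a) + 2 * s))"
      proof -
        have "integrable lebesgue (\<lambda>x. \<bar>u s x\<bar> * (1 + norm x) powr - (real DIM('a) + 2 * s))"
          using L1 by (simp add: L1s_def)
        then show ?thesis
          by (subst (asm) lebesgue_transfer(3)[where f' = "\<lambda>x. \<bar>ub x\<bar> * (1 + norm x) powr - (real DIM('a) + 2 * s)"])
            (use ubae in \<open>auto elim: eventually_mono\<close>)
      qed
      \<comment> \<open>Of all test functions only bumps are used; the positive constant
        \<open>cNs\<close> cancels here and does not reappear.\<close>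
      have weak: "(LINT x|lborel. ub x * levy_kernel.gen (frac_kernel s) (bump c h) x) = 0"
        if h: "0 < h" "cball c h \<subseteq> \<Omega>" for c h
      proof -
        interpret levy_kernel "frac_kernel s :: 'a measure" "sphere_area TYPE('a) * (1 / (2 * s) + 1 / (1 - 2 * s))" "2 * s"
          using s(1) s'(3) by (rule levy_kernel_frac_kernel)
        obtain D where D: "minlip D (bump c h)" using minlip_bump[OF h(1)] by blast
        have [measurable]: "gen (bump c h) \<in> borel_measurable borel" by (rule gen_measurable(1)[OF D])
        have "0 = (LINT x|lebesgue. u s x * fraclap s (bump c h) x)"
          using harm test_fun_bump[OF h] by (simp add: s_harmonic_def)
        also have "\<dots> = (LINT x|lborel. cNs DIM('a) s * (ub x * gen (bump c h) x))"
        proof (rule lebesgue_transfer(2))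
          show "AE x in lborel. u s x * fraclap s (bump c h) x = cNs DIM('a) s * (ub x * gen (bump c h) x)"
            using ubae by eventually_elim (simp add: fraclap_eq_gen[OF s(1) s'(3) D])
        qed measurable
        finally show ?thesis using cNs_pos[OF s(1) s'(4), of "DIM('a)"] by simp
      qed
      have ubgb: "AE x in lborel. x \<notin> \<Omega> \<longrightarrow> ub x = gb x"
        using ubae gbae by eventually_elim (use u_ext[OF s(1) s'(4)] in \<open>auto simp: g0_def\<close>)
      obtain U B where U: "open U" "frontier \<Omega> \<subseteq> U" "AE x in lebesgue. x \<in> U \<longrightarrow> \<bar>u s x\<bar> \<le> B"
        using u_bdd[OF s(1) s'(4)] by blast
      have UB: "AE x in lborel. x \<in> U \<longrightarrow> \<bar>ub x\<bar> \<le> B"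
        using U(3)[unfolded AE_completion_iff] ubae by eventually_elim auto
      have Wg: "AE x in lborel. x \<notin> \<Omega> \<longrightarrow> norm x \<le> R \<longrightarrow> \<bar>gb x\<bar> \<le> ?W x"
        using gbae
      proof eventually_elim
        fix x assume "g0 x = gb x"
        then show "x \<notin> \<Omega> \<longrightarrow> norm x \<le> R \<longrightarrow> \<bar>gb x\<bar> \<le> ?W x"
          using K0[of x] K(2) barrier_near[OF bar] by auto
      qed
      have main: "AE x in lborel. x \<in> \<Omega> \<longrightarrow> \<sigma> * ub x \<le> ?W x" if "\<bar>\<sigma>\<bar> = 1" for \<sigma>
      proof (rule AE_upper_barrier[OF op bd False \<Omega>R R s(1) s'(3) ub intub weak gb ubgb
            minlip_barrier[OF bar] integrable_barrier[OF bar] barrier_range(1)[OF bar] Wg U(1,2) UB shell _ that])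
        fix y assume y: "y \<in> \<Omega>"
        show "\<bar>LINT x|lborel. indicator {x. R \<le> norm x} x * (gb x * norm (x - y) powr - (real DIM('a) + 2 * s))\<bar>
          \<le> levy_kernel.gen_adj (frac_kernel s) ?W y"
          using far[rule_format, OF s(1) s'(1) \<Omega>R[OF y]] super[rule_format, OF s(1) s'(2) y] by linarith
      qed
      have "AE x in lborel. x \<in> \<Omega> \<longrightarrow> \<bar>u s x\<bar> \<le> ?W x"
        using main[of 1, simplified] main[of "- 1", simplified] ubae
      proof eventually_elim
        fix x assume "x \<in> \<Omega> \<longrightarrow> ub x \<le> ?W x" "x \<in> \<Omega> \<longrightarrow> - ub x \<le> ?W x" "u s x = ub x"
        then show "x \<in> \<Omega> \<longrightarrow> \<bar>u s x\<bar> \<le> ?W x" by (auto simp: abs_le_iff)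
      qed
      then have "AE x in lborel. x \<in> \<Omega> \<longrightarrow> ?\<delta> x * \<bar>u s x\<bar> \<le> \<eta>"
      proof eventually_elim
        fix x assume *: "x \<in> \<Omega> \<longrightarrow> \<bar>u s x\<bar> \<le> ?W x"
        show "x \<in> \<Omega> \<longrightarrow> ?\<delta> x * \<bar>u s x\<bar> \<le> \<eta>"
        proof
          assume x: "x \<in> \<Omega>"
          then have "?\<delta> x * \<bar>u s x\<bar> \<le> ?\<delta> x * ?W x"
            using * by (intro mult_left_mono) auto
          then show "?\<delta> x * \<bar>u s x\<bar> \<le> \<eta>" using weighted[OF x] by linarith
        qed
      qed
      then show "AE x in lebesgue. x \<in> \<Omega> \<longrightarrow> ?\<delta> x * \<bar>u s x\<bar> \<le> \<eta>"
        by (rule AE_completion)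
    qed
  qed
qed simp

end
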